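(* Let $\underline X_n=(X_1,\dots,X_n)$ be observations from a centered stationary Gaussian process with true spectral density $f_0(\lambda)=|\lambda|^{-2d_0}\tilde f_0(\lambda)$. Assume that there exist $t_0,M_0,m_0,L_0>0$ such that either $f_0\in\bar{\mathcal G}(t_0,M_0,m_0,L_0,\rho_0)$ with $0<\rho_0\le 1$, or $f_0\in\bar{\mathcal L}(t_0,M_0,m_0,L_0)$ (in which case put $\rho_0=1$). Let $t,m,M,L$ be positive reals, and let $\pi$ be a prior probability distribution on either $\bar{\mathcal G}(t,M,m,L,\rho)$ with $\rho>0$, or $\bar{\mathcal L}(t,M,m,L)$ (in which case put $\rho=1$). Suppose $t<(\rho\wedge\rho_0)/4$ and set $\gamma=\rho\wedge\rho_0\wedge\frac12$. Assume: (i) For every $\varepsilon>0$, $\pi(\mathcal B_\varepsilon)>0$, where $$\mathcal B_\varepsilon=\{f=|\lambda|^{-2d}\tilde f\in\bar{\mathcal F}_+(t,M,m):\ h(f_0,f)\le\varepsilon,\ 8(d_0-d)<\gamma-t\}.$$ (ii) For every sufficiently small $\varepsilon>0$ there exist $r>0$, sets $\mathcal F_n\subset\tilde{\mathcal F}_+$ with $\pi(\mathcal F_n^c)\le e^{-nr}$, and a (smallest possible) finite net $\mathcal H_n\subset\{f\in\bar{\mathcal G}(t,M,m,L,\rho): d(f,f_0)>\varepsilon/2\}$ (respectively $\mathcal H_n\subset\{f\in\bar{\mathcal L}(t,M,m,L): d(f,f_0)>\varepsilon/2\}$) such that, for $n$ large enough, for every $f=|x|^{-2d}\tilde f\in\mathcal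 F_n\cap A_\varepsilon^c$ there exists $f_i=|x|^{-2d_i}\tilde f_i\in\mathcal H_n$ with $f_i\ge f$, $4(d_i-d)\le\rho\wedge\frac12$, and - if $4|d-d_0|\le\gamma-t$: $\ \frac1{2\pi}\int_{-\pi}^{\pi}\frac{(f_i-f)(x)}{f_0(x)}\,dx\le \frac{h(f_0,f_i)}4$; - if $4(d-d_0)>\gamma-t$: $\ \frac1{2\pi}\int_{-\pi}^{\pi}\frac{(f_i-f)^2(x)}{f^2(x)}\,dx\le b(f_0,f_i)\,|\log\varepsilon|^{-1}$; - if $4(d_0-d)>\gamma-t$: $\ \frac1{2\pi}\int_{-\pi}^{\pi}\frac{(f_i-f)^2(x)}{f_0^2(x)}\,dx\le b(f_i,f_0)$ and $\frac1{2\pi}\int_{-\pi}^{\pi}\frac{(f_i-f)(x)}{f(x)}\,dx\le b(f_i,f_0)\,|\log\varepsilon|^{-1}$; and, denoting by $N_n$ the logarithm of the cardinality of the smallest possible such net $\mathcal H_n$, $N_n\le nc_1$ with $c_1\le\varepsilon|\log\varepsilon|^{-2}$. Then for all $\epsilon>0$, as $n\to\infty$, $$P^\pi\big[\{f=|\lambda|^{-2d}\tilde f:\ |d-d_0|>\epsilon\}\,\big|\,\underline X_n\big]\to0,$$ almost surely under the law of the process with spectral density $f_0$, and the posterior mean $\hat d=E^\pi[d\mid\underline X_n]$ satisfies $\hat d\to d_0$ almost surely under the same law.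
   Context: Spectral densities and likelihood: $\mathcal F=\{f \text{ symmetric on }[-\pi,\pi],\ \int|f|<\infty\}$, $\mathcal F_+=\{f\in\mathcal F: f\ge0\}$. For $f\in\mathcal F$, $T_n(f)$ is the $n\times n$ Toeplitz matrix with $(j,k)$ entry $\int_{-\pi}^{\pi}f(\lambda)e^{i(j-k)\lambda}d\lambda$. Under spectral density $f$, $\underline X_n$ has density $\varphi_f(\underline X_n)=(2\pi)^{-n/2}|T_n(f)|^{-1/2}\exp(-\underline X_n'T_n(f)^{-1}\underline X_n/2)$. The posterior is $P^\pi[B\mid\underline X_n]=\int_B\varphi_f(\underline X_n)d\pi(f)/\int\varphi_f(\underline X_n)d\pi(f)$, and $E^\pi[\cdot\mid\underline X_n]$ is posterior expectation. Function classes: $\tilde{\mathcal F}=\{f\in\mathcal F: f(\lambda)=|\lambda|^{-2d}\tilde f(\lambda),\ \tilde f \text{ continuous on }[-\pi,\pi],\ -\frac12<d<\frac12\}$, $\tilde{\mathcal F}_+=\{f\in\tilde{\mathcal F}: f\ge0\}$. For $-\frac12<d<\frac12$ and $m,M,L,\rho>0$: $\mathcal G(d,M,m,L,\rho)=\{f\in\tilde{\mathcal F}_+: f(\lambda)=|\lambda|^{-2d}\tilde f(\lambda),\ m\le\tilde f\le M,\ |\tilde f(x)-\tilde f(y)|\le L|x-y|^\rho\}$; $\mathcal L^\star(M,m,L)=\{h\ge0: 0<m\le h\le M,\ |h(x)-h(y)|\le L|x-y|(|x|\wedge|y|)^{-1}\}$; $\mathcal L(d,M,m,L)=\{f=|\lambda|^{-2d}\tilde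 f(\lambda): \tilde f\in\mathcal L^\star(M,m,L)\}$. $\bar{\mathcal G}(t,M,m,L,\rho)=\bigcup_{-1/2+t\le d\le1/2-t}\mathcal G(d,M,m,L,\rho)$, $\bar{\mathcal L}(t,M,m,L)=\bigcup_{-1/2+t\le d\le1/2-t}\mathcal L(d,M,m,L)$, and $\bar{\mathcal F}_+(t,M,m)=\bigcup_{-1/2+t\le d\le1/2-t}\{f\in\mathcal F_+: f(\lambda)=|\lambda|^{-2d}\tilde f(\lambda),\ 0<m\le\tilde f\le M\}$. For $f$ in one of these classes, $d$ denotes its exponent. Discrepancies: $KL_\infty(f_0;f)=\frac1\pi\int_{-\pi}^{\pi}\big[\frac{f_0}{f}-1-\log\frac{f_0}{f}\big]d\lambda$; $d(f_0,f)=\min\{KL_\infty(f_0;f),KL_\infty(f;f_0)\}$; $h(f_0,f)=\frac1{2\pi}\int_{-\pi}^{\pi}\big[\frac{f_0}{f}+\frac{f}{f_0}-2\big]d\lambda$; $b(f_1,f)=\frac1{2\pi}\int_{-\pi}^{\pi}(f_1/f-1)^2dx$. $A_\varepsilon=\{f\in\tilde{\mathcal F}_+: d(f,f_0)\le\varepsilon\}$. *)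

theory Defs
  imports
    "HOL-Probability.Probability"
    "Jordan_Normal_Form.Determinant"
    "Jordan_Normal_Form.Gauss_Jordan_Elimination"
begin

text \<open>
  A function on the frequency interval \<open>[-\<pi>, \<pi>]\<close> is a total function on the reals whose values
  outside the interval are irrelevant. A power \<open>|\<lambda>|\<^sup>a\<close> with \<open>a < 0\<close> is infinite at the origin (and
  \<open>0 powr 0 = 0\<close>), so identities and comparisons of spectral densities are imposed on the
  punctured interval only, and the value at \<open>0\<close> is left free.
\<close>

abbreviation freqs :: "real set" where
  "freqs \<equiv> {-pi..pi}"

definition F_class :: "(real \<Rightarrow> real) set" where
  "F_class = {f. (\<forall>x\<in>freqs. f (- x) = f x) \<and> set_integrable lebesgue freqs f}"

definition F_plus :: "(real \<Rightarrow> real) set" where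
  "F_plus = {f \<in> F_class. \<forall>x\<in>freqs. 0 \<le> f x}"

definition factors :: "(real \<Rightarrow> real) \<Rightarrow> real \<Rightarrow> (real \<Rightarrow> real) \<Rightarrow> bool" where
  "factors f d g \<longleftrightarrow> (\<forall>x\<in>freqs - {0}. f x = \<bar>x\<bar> powr (- 2 * d) * g x)"

definition F_tilde :: "(real \<Rightarrow> real) set" where
  "F_tilde = {f \<in> F_class. \<exists>d g. - 1/2 < d \<and> d < 1/2 \<and> continuous_on freqs g \<and> factors f d g}"

definition F_tilde_plus :: "(real \<Rightarrow> real) set" where
  "F_tilde_plus = {f \<in> F_tilde. \<forall>x\<in>freqs. 0 \<le> f x}"

definition G_class :: "real \<Rightarrow> real \<Rightarrow> real \<Rightarrow> real \<Rightarrow> real \<Rightarrow> (real \<Rightarrow> real) set" where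
  "G_class d M m L \<rho> = {f \<in> F_tilde_plus. \<exists>g. factors f d g \<and>
     (\<forall>x\<in>freqs. m \<le> g x \<and> g x \<le> M) \<and>
     (\<forall>x\<in>freqs. \<forall>y\<in>freqs. \<bar>g x - g y\<bar> \<le> L * \<bar>x - y\<bar> powr \<rho>)}"

text \<open>
  The local Lipschitz bound is infinite when \<open>x\<close> or \<open>y\<close> is \<open>0\<close>, so it says nothing there.
\<close>

definition L_star :: "real \<Rightarrow> real \<Rightarrow> real \<Rightarrow> (real \<Rightarrow> real) set" where
  "L_star M m L = {h. (\<forall>x\<in>freqs. 0 \<le> h x) \<and> 0 < m \<and> (\<forall>x\<in>freqs. m \<le> h x \<and> h x \<le> M) \<and>
     (\<forall>x\<in>freqs - {0}. \<forall>y\<in>freqs - {0}. \<bar>h x - h y\<bar> \<le> L * \<bar>x - y\<bar> * inverse (min \<bar>x\<bar> \<bar>y\<bar>))}"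

definition L_class :: "real \<Rightarrow> real \<Rightarrow> real \<Rightarrow> real \<Rightarrow> (real \<Rightarrow> real) set" where
  "L_class d M m L = {f \<in> F_plus. \<exists>g\<in>L_star M m L. factors f d g}"

definition G_bar :: "real \<Rightarrow> real \<Rightarrow> real \<Rightarrow> real \<Rightarrow> real \<Rightarrow> (real \<Rightarrow> real) set" where
  "G_bar t M m L \<rho> = (\<Union>d\<in>{- 1/2 + t..1/2 - t}. G_class d M m L \<rho>)"

definition L_bar :: "real \<Rightarrow> real \<Rightarrow> real \<Rightarrow> real \<Rightarrow> (real \<Rightarrow> real) set" where
  "L_bar t M m L = (\<Union>d\<in>{- 1/2 + t..1/2 - t}. L_class d M m L)"

definition F_bar_plus :: "real \<Rightarrow> real \<Rightarrow> real \<Rightarrow> (real \<Rightarrow> real) set" where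
  "F_bar_plus t M m = (\<Union>d\<in>{- 1/2 + t..1/2 - t}.
     {f \<in> F_plus. \<exists>g. factors f d g \<and> 0 < m \<and> (\<forall>x\<in>freqs. m \<le> g x \<and> g x \<le> M)})"

text \<open>
  In \<open>f = |\<lambda>|\<^bsup>-2d\<^esup> g\<close> with \<open>g\<close> merely continuous, \<open>d\<close> is not determined by \<open>f\<close> (a larger \<open>d\<close>
  works, with \<open>g(0) = 0\<close>). It is determined once \<open>g\<close> is bounded away from \<open>0\<close> and infinity near
  the origin, as it is in all classes with bounds \<open>m \<le> g \<le> M\<close>; see
  \<open>has_exponent_unique\<close> and \<open>has_exponentI\<close>.
\<close>

definition has_exponent :: "(real \<Rightarrow> real) \<Rightarrow> real \<Rightarrow> bool" where
  "has_exponent f d \<longleftrightarrow> - 1/2 < d \<and> d < 1/2 \<and>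
     (\<exists>g. factors f d g \<and> (\<exists>m M. 0 < m \<and> (\<forall>\<^sub>F x in at 0. m \<le> g x \<and> g x \<le> M)))"

definition exponent :: "(real \<Rightarrow> real) \<Rightarrow> real" where
  "exponent f = (THE d. has_exponent f d)"

lemma eventually_freqs: "\<forall>\<^sub>F x::real in at 0. x \<in> freqs - {0}"
proof -
  have "\<forall>\<^sub>F x::real in at 0. dist x 0 < pi \<and> x \<noteq> 0"
    using pi_gt_zero by (auto simp: eventually_at intro!: exI[of _ pi])
  then show ?thesis by eventually_elim (auto simp: dist_real_def)
qed

lemma has_exponent_le:
  assumes "has_exponent f d" "has_exponent f e"
  shows "d \<le> e"
proof (rule ccontr)
  assume "\<not> d \<le> e"
  then have de: "2 * (d - e) > 0" by simp
  obtain g m M where g: "factors f d g" "0 < m" "\<forall>\<^sub>F x in at 0. m \<le> g x \<and> g x \<le> M"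
    using assms(1) unfolding has_exponent_def by blast
  obtain g' m' M' where g': "factors f e g'" "0 < m'" "\<forall>\<^sub>F x in at 0. m' \<le> g' x \<and> g' x \<le> M'"
    using assms(2) unfolding has_exponent_def by blast
  have ev: "\<forall>\<^sub>F x in at 0. m \<le> M' * \<bar>x\<bar> powr (2 * (d - e))"
    using g(3) g'(3) eventually_freqs
  proof eventually_elim
    case (elim x)
    have "\<bar>x\<bar> powr (- 2 * d) * g x = \<bar>x\<bar> powr (- 2 * e) * g' x"
      using g(1) g'(1) elim(3) unfolding factors_def by metis
    then have "\<bar>x\<bar> powr (2 * d) * (\<bar>x\<bar> powr (- 2 * d) * g x)
        = \<bar>x\<bar> powr (2 * d) * (\<bar>x\<bar> powr (- 2 * e) * g' x)" by simp
    then have "\<bar>x\<bar> powr (2 * d + - 2 * d) * g x = \<bar>x\<bar> powr (2 * d + - 2 * e) * g' x"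
      unfolding powr_add by (simp only: mult.assoc)
    moreover have "\<bar>x\<bar> powr (2 * d + - 2 * d) = 1" using elim(3) by simp
    moreover have "2 * d + - 2 * e = 2 * (d - e)" by simp
    ultimately have "g x = \<bar>x\<bar> powr (2 * (d - e)) * g' x" by simp
    also have "\<dots> \<le> \<bar>x\<bar> powr (2 * (d - e)) * M'"
      using elim(2) by (intro mult_left_mono) auto
    finally show ?case using elim(1) by (simp add: mult.commute)
  qed
  have "((\<lambda>x::real. M' * \<bar>x\<bar> powr (2 * (d - e))) \<longlongrightarrow> M' * 0) (at 0)"
    using de by (intro tendsto_mult tendsto_const tendsto_zero_powrI[of _ _ _ "2 * (d - e)"]
        tendsto_rabs_zero tendsto_ident_at) auto
  then have "m \<le> M' * 0"
    using ev by (intro tendsto_lowerbound[where F = "at 0"]) auto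
  with g(2) show False by simp
qed

lemma has_exponent_unique: "has_exponent f d \<Longrightarrow> has_exponent f e \<Longrightarrow> d = e"
  by (meson has_exponent_le antisym)

lemma exponent_eq: "has_exponent f d \<Longrightarrow> exponent f = d"
  unfolding exponent_def using has_exponent_unique by blast

lemma has_exponentI:
  assumes "- 1/2 < d" "d < 1/2" "factors f d g" "0 < m" "\<forall>x\<in>freqs. m \<le> g x \<and> g x \<le> M"
  shows "has_exponent f d"
proof -
  have "\<forall>\<^sub>F x in at 0. m \<le> g x \<and> g x \<le> M"
    using eventually_freqs by eventually_elim (use assms(5) in auto)
  then show ?thesis using assms unfolding has_exponent_def by blast
qed

text \<open>
  The imaginary part of the integral vanishes for symmetric \<open>f\<close>. Rows and columns are numbered
  from \<open>0\<close>, as are the observations \<open>x 0, \<dots>, x (n - 1)\<close>.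
\<close>

definition toeplitz :: "nat \<Rightarrow> (real \<Rightarrow> real) \<Rightarrow> real mat" where
  "toeplitz n f = mat n n (\<lambda>(j, k).
     Re (LINT x:freqs|lebesgue. complex_of_real (f x) * cis ((real j - real k) * x)))"

definition lik :: "nat \<Rightarrow> (real \<Rightarrow> real) \<Rightarrow> (nat \<Rightarrow> real) \<Rightarrow> real" where
  "lik n f x = (2 * pi) powr (- real n / 2) * Determinant.det (toeplitz n f) powr (- 1/2) *
     exp (- scalar_prod (vec n x) (mult_mat_vec (the (mat_inverse (toeplitz n f))) (vec n x)) / 2)"

text \<open>
  For the spectral densities with \<open>m \<le> g\<close>, all \<open>toeplitz n f\<close> are positive definite and these
  densities are those of the centered normal laws with covariance \<open>toeplitz n f\<close>, which
  determine the law of the process.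
\<close>

definition gaussian_process ::
  "'a measure \<Rightarrow> (nat \<Rightarrow> 'a \<Rightarrow> real) \<Rightarrow> (real \<Rightarrow> real) \<Rightarrow> bool" where
  "gaussian_process P X f \<longleftrightarrow> prob_space P \<and>
     (\<forall>n. distributed P (\<Pi>\<^sub>M i\<in>{..<n}. lborel) (\<lambda>\<omega>. \<lambda>i\<in>{..<n}. X i \<omega>) (\<lambda>x. ennreal (lik n f x)))"

text \<open>
  Measurability of the evaluation maps makes the likelihoods and the exponent measurable
  functions of \<open>f\<close>, so that the posterior makes sense.
\<close>

definition prior_on :: "(real \<Rightarrow> real) set \<Rightarrow> (real \<Rightarrow> real) measure \<Rightarrow> bool" where
  "prior_on C \<pi> \<longleftrightarrow> prob_space \<pi> \<and> space \<pi> \<subseteq> C \<and>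
     (\<forall>x\<in>freqs - {0}. (\<lambda>f. f x) \<in> borel_measurable \<pi>)"

definition posterior ::
  "(real \<Rightarrow> real) measure \<Rightarrow> nat \<Rightarrow> (nat \<Rightarrow> real) \<Rightarrow> (real \<Rightarrow> real) set \<Rightarrow> real" where
  "posterior \<pi> n x B = (LINT f:B|\<pi>. lik n f x) / (LINT f|\<pi>. lik n f x)"

definition posterior_expectation ::
  "(real \<Rightarrow> real) measure \<Rightarrow> nat \<Rightarrow> (nat \<Rightarrow> real) \<Rightarrow> ((real \<Rightarrow> real) \<Rightarrow> real) \<Rightarrow> real" where
  "posterior_expectation \<pi> n x \<psi> = (LINT f|\<pi>. \<psi> f * lik n f x) / (LINT f|\<pi>. lik n f x)"

text \<open>
  All integrands below are nonnegative and their integrals may be infinite. The set \<open>Z\<close> contains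
  the frequencies at which a denominator or the argument of the logarithm is zero; the integrand
  counts as infinite there, which overrides division by zero in the reals.
\<close>

definition freq_integral :: "real set \<Rightarrow> (real \<Rightarrow> real) \<Rightarrow> ennreal" where
  "freq_integral Z g = (\<integral>\<^sup>+x\<in>freqs. (if x \<in> Z then \<infinity> else ennreal (g x)) \<partial>lebesgue)"

definition KL_inf :: "(real \<Rightarrow> real) \<Rightarrow> (real \<Rightarrow> real) \<Rightarrow> ennreal" where
  "KL_inf f0 f = ennreal (1 / pi) *
     freq_integral {x. f0 x = 0 \<or> f x = 0} (\<lambda>x. f0 x / f x - 1 - ln (f0 x / f x))"

definition disc :: "(real \<Rightarrow> real) \<Rightarrow> (real \<Rightarrow> real) \<Rightarrow> ennreal" where
  "disc f0 f = min (KL_inf f0 f) (KL_inf f f0)"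

definition h_disc :: "(real \<Rightarrow> real) \<Rightarrow> (real \<Rightarrow> real) \<Rightarrow> ennreal" where
  "h_disc f0 f = ennreal (1 / (2 * pi)) *
     freq_integral {x. f0 x = 0 \<or> f x = 0} (\<lambda>x. f0 x / f x + f x / f0 x - 2)"

definition b_disc :: "(real \<Rightarrow> real) \<Rightarrow> (real \<Rightarrow> real) \<Rightarrow> ennreal" where
  "b_disc f1 f = ennreal (1 / (2 * pi)) * freq_integral {x. f x = 0} (\<lambda>x. (f1 x / f x - 1)\<^sup>2)"

definition A_set :: "(real \<Rightarrow> real) \<Rightarrow> real \<Rightarrow> (real \<Rightarrow> real) set" where
  "A_set f0 \<epsilon> = {f \<in> F_tilde_plus. disc f f0 \<le> ennreal \<epsilon>}"

definition B_set ::
  "(real \<Rightarrow> real) \<Rightarrow> real \<Rightarrow> real \<Rightarrow> real \<Rightarrow> real \<Rightarrow> real \<Rightarrow> real \<Rightarrow> (real \<Rightarrow> real) set" where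
  "B_set f0 d0 t M m \<gamma> \<epsilon> =
     {f \<in> F_bar_plus t M m. h_disc f0 f \<le> ennreal \<epsilon> \<and> 8 * (d0 - exponent f) < \<gamma> - t}"

text \<open>
  Conditions on the exponent \<open>d\<close> of \<open>f\<close> are void when \<open>f\<close> has no exponent, that is, for some
  \<open>f\<close> in \<open>F_tilde_plus\<close> that lie outside every class carrying a prior.
\<close>

definition dominates ::
  "(real \<Rightarrow> real) \<Rightarrow> real \<Rightarrow> real \<Rightarrow> real \<Rightarrow> real \<Rightarrow> real \<Rightarrow>
   (real \<Rightarrow> real) \<Rightarrow> (real \<Rightarrow> real) \<Rightarrow> bool" where
  "dominates f0 d0 \<rho> \<gamma> t \<epsilon> fi f \<longleftrightarrow>
     (\<forall>x\<in>freqs - {0}. f x \<le> fi x) \<and>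
     (\<forall>d. has_exponent f d \<longrightarrow>
        4 * (exponent fi - d) \<le> min \<rho> (1/2) \<and>
        (4 * \<bar>d - d0\<bar> \<le> \<gamma> - t \<longrightarrow>
           ennreal (1 / (2 * pi)) * freq_integral {x. f0 x = 0} (\<lambda>x. (fi x - f x) / f0 x)
             \<le> h_disc f0 fi / 4) \<and>
        (4 * (d - d0) > \<gamma> - t \<longrightarrow>
           ennreal (1 / (2 * pi)) * freq_integral {x. f x = 0} (\<lambda>x. (fi x - f x)\<^sup>2 / (f x)\<^sup>2)
             \<le> b_disc f0 fi * ennreal (inverse \<bar>ln \<epsilon>\<bar>)) \<and>
        (4 * (d0 - d) > \<gamma> - t \<longrightarrow>
           ennreal (1 / (2 * pi)) * freq_integral {x. f0 x = 0} (\<lambda>x. (fi x - f x)\<^sup>2 / (f0 x)\<^sup>2)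
             \<le> b_disc fi f0 \<and>
           ennreal (1 / (2 * pi)) * freq_integral {x. f x = 0} (\<lambda>x. (fi x - f x) / f x)
             \<le> b_disc fi f0 * ennreal (inverse \<bar>ln \<epsilon>\<bar>)))"

definition is_net ::
  "(real \<Rightarrow> real) \<Rightarrow> real \<Rightarrow> (real \<Rightarrow> real) set \<Rightarrow> real \<Rightarrow> real \<Rightarrow> real \<Rightarrow> real \<Rightarrow>
   (real \<Rightarrow> real) set \<Rightarrow> (real \<Rightarrow> real) set \<Rightarrow> bool" where
  "is_net f0 d0 C \<rho> \<gamma> t \<epsilon> F H \<longleftrightarrow>
     finite H \<and> H \<subseteq> {f \<in> C. disc f f0 > ennreal (\<epsilon> / 2)} \<and>
     (\<forall>f\<in>F \<inter> - A_set f0 \<epsilon>. \<exists>fi\<in>H. dominates f0 d0 \<rho> \<gamma> t \<epsilon> fi f)"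

text \<open>
  The case without any net is excluded wherever this is used.
\<close>

definition net_entropy ::
  "(real \<Rightarrow> real) \<Rightarrow> real \<Rightarrow> (real \<Rightarrow> real) set \<Rightarrow> real \<Rightarrow> real \<Rightarrow> real \<Rightarrow> real \<Rightarrow>
   (real \<Rightarrow> real) set \<Rightarrow> real" where
  "net_entropy f0 d0 C \<rho> \<gamma> t \<epsilon> F =
     ln (real (LEAST k. \<exists>H. is_net f0 d0 C \<rho> \<gamma> t \<epsilon> F H \<and> card H = k))"

end

theory Submission
  imports Defs "HOL-Real_Asymp.Real_Asymp"
begin

text \<open>
  The exponent is visible in the low frequencies alone, where exponentially powerful tests are available.

  Two inequalities carry the argument. For positive definite matrices,
  \<open>det B \<le> det A exp (tr (A\<^sup>-\<^sup>1 B) - n)\<close>; and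
  \<open>T\<^sub>n(g)\<^sup>-\<^sup>1 \<le> T\<^sub>n(1/g) / (4\<pi>\<^sup>2)\<close>, so that
  \<open>tr (T\<^sub>n(g)\<^sup>-\<^sup>1 T\<^sub>n(f))\<close> is at most a Fejer mean, whose limit is \<open>n/(2\<pi>)\<close> times the integral of
  \<open>f/g\<close>. Together they bound the Laplace transforms of all quadratic forms
  \<open>X' T\<^sub>n(g)\<^sup>-\<^sup>1 X\<close> up to \<open>exp (o(n))\<close>.

  If the exponents of \<open>f\<close> and \<open>f\<^sub>0\<close> differ by more than \<open>e\<close>, then \<open>f/f\<^sub>0\<close> is very large or very small
  near \<open>0\<close>, uniformly over the class because of the bounds \<open>m\<close> and \<open>M\<close>. For either sign of the
  difference a single quadratic form therefore separates \<open>f\<^sub>0\<close> from all such \<open>f\<close>, with exponentially small errors, which bounds the numerator of the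
  posterior probability. For the denominator, a small \<open>h(f\<^sub>0, f)\<close> forces the exponents to be close, and then
  the same trace bound makes the log-likelihood ratio almost surely at least \<open>- n h(f\<^sub>0, f)/2 - o(n)\<close>.
\<close>

subsection \<open>Positive definite matrices\<close>

text \<open>Only upper bounds on traces are needed, and only for pairs of fixed densities: the
  determinant inequality makes them one-sided determinant bounds, so two-sided asymptotics of traces
  or log-determinants never enter. Uniformity over the class comes from monotonicity of Toeplitz
  determinants in the density: a density of the class is replaced by a multiple of one boundary
  power of \<open>|x|\<close> lying below or above it. The poles are the obstacle. A ratio
  \<open>f / g\<close> is integrable only if the exponent of \<open>f\<close> exceeds that of
  \<open>g\<close> by less than 1/2; therefore the tests compare \<open>f0\<close> with a boundary
  exponent close to \<open>d0\<close>, however far away the exponent of \<open>f\<close> is. In the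
  likelihood ratio \<open>f0 / f\<close> may be unbounded, and the Toeplitz matrix of
  \<open>f0\<close> is bounded relative to that of \<open>f\<close> only up to a factor of order
  \<open>sqrt n\<close>. This forces a Chernoff parameter of order \<open>1 / sqrt n\<close> and
  tails \<open>exp (- c * sqrt n)\<close>, which are still summable.\<close>

definition qform :: "nat \<Rightarrow> real mat \<Rightarrow> (nat \<Rightarrow> real) \<Rightarrow> real" where
  "qform n A x = (\<Sum>i<n. \<Sum>j<n. x i * A $$ (i, j) * x j)"

text \<open>This is the trace of the product as soon as one of the two matrices is symmetric,
  written so that it is visibly linear in the entries of a Toeplitz matrix.\<close>

definition frob :: "nat \<Rightarrow> real mat \<Rightarrow> real mat \<Rightarrow> real" where
  "frob n A B = (\<Sum>i<n. \<Sum>j<n. A $$ (i, j) * B $$ (i, j))"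

definition pos_def :: "nat \<Rightarrow> real mat \<Rightarrow> bool" where
  "pos_def n A \<longleftrightarrow> A \<in> carrier_mat n n \<and> (\<forall>i<n. \<forall>j<n. A $$ (i, j) = A $$ (j, i)) \<and>
     (\<forall>x. (\<exists>i<n. x i \<noteq> 0) \<longrightarrow> 0 < qform n A x)"

abbreviation mdet :: "real mat \<Rightarrow> real" where
  "mdet \<equiv> Determinant.det"

abbreviation minv :: "real mat \<Rightarrow> real mat" where
  "minv A \<equiv> the (mat_inverse A)"

text \<open>Gaussian elimination starting from the last variable, so that the factor is lower
  triangular and the Gaussian integral can be evaluated by integrating the last variable first.\<close>

lemma cholesky_fun:
  fixes a :: "nat \<Rightarrow> nat \<Rightarrow> real"
  assumes "\<And>i j. i < n \<Longrightarrow> j < n \<Longrightarrow> a i j = a j i"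
    and "\<And>x. \<exists>i<n. x i \<noteq> 0 \<Longrightarrow> 0 < (\<Sum>i<n. \<Sum>j<n. x i * a i j * x j)"
  shows "\<exists>l. (\<forall>i<n. 0 < l i i) \<and> (\<forall>i j. i < j \<longrightarrow> l i j = 0) \<and>
    (\<forall>j<n. \<forall>k<n. a j k = (\<Sum>i<n. l i j * l i k))"
  using assms
proof (induction n arbitrary: a)
  case 0
  then show ?case by (intro exI[of _ "\<lambda>_ _. 0"]) auto
next
  case (Suc n)
  define c where "c = a n n"
  have expand: "(\<Sum>i<Suc n. \<Sum>j<Suc n. x i * a i j * x j) =
      (\<Sum>i<n. \<Sum>j<n. x i * a i j * x j) + 2 * x n * (\<Sum>i<n. a i n * x i) + c * (x n)\<^sup>2" for x
  proof -
    have "(\<Sum>j<n. x n * a n j * x j) = (\<Sum>i<n. x i * a i n * x n)"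
      using Suc.prems(1)[of n] by (intro sum.cong) auto
    then show ?thesis
      by (simp add: sum.distrib sum_distrib_left c_def power2_eq_square algebra_simps)
  qed
  have c: "c > 0"
    using Suc.prems(2)[of "\<lambda>i. if i = n then 1 else 0"] unfolding expand by (auto simp: if_distrib cong: if_cong)
  \<comment> \<open>\<open>b\<close> is the Schur complement of the last diagonal entry; its factor,
    from the induction hypothesis, supplies the first \<open>n\<close> rows.\<close>
  define b where "b = (\<lambda>i j. a i j - a i n * a j n / c)"
  have b_sym: "b i j = b j i" if "i < n" "j < n" for i j
    using Suc.prems(1)[of i j] that by (simp add: b_def)
  have b_pos: "0 < (\<Sum>i<n. \<Sum>j<n. x i * b i j * x j)" if x: "\<exists>i<n. x i \<noteq> 0" for x
  proof -
    define s where "s = (\<Sum>i<n. a i n * x i)"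
    \<comment> \<open>Among all values of the last coordinate \<open>- s / c\<close> minimises the
      form, and the minimum is the form of \<open>b\<close> at \<open>x\<close>.\<close>
    define y where "y = (\<lambda>i. if i = n then - s / c else x i)"
    have "0 < (\<Sum>i<Suc n. \<Sum>j<Suc n. y i * a i j * y j)"
      using x by (intro Suc.prems(2)) (auto simp: y_def intro: less_SucI)
    also have "\<dots> = (\<Sum>i<n. \<Sum>j<n. x i * a i j * x j) + 2 * (- s / c) * s + c * (- s / c)\<^sup>2"
      unfolding expand by (simp add: y_def s_def)
    also have "\<dots> = (\<Sum>i<n. \<Sum>j<n. x i * a i j * x j) - s * s / c"
      using c by (simp add: power2_eq_square field_simps)
    also have "s * s / c = (\<Sum>i<n. \<Sum>j<n. x i * (a i n * a j n / c) * x j)"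
      unfolding s_def sum_product sum_divide_distrib by (intro sum.cong) auto
    finally show ?thesis by (simp add: b_def sum_subtractf algebra_simps)
  qed
  have "\<exists>l. (\<forall>i<n. 0 < l i i) \<and> (\<forall>i j. i < j \<longrightarrow> l i j = 0) \<and>
      (\<forall>j<n. \<forall>k<n. b j k = (\<Sum>i<n. l i j * l i k))"
    by (rule Suc.IH) (fact b_sym b_pos)+
  then obtain l where l0: "\<forall>i<n. 0 < l i i" "\<forall>i j. i < j \<longrightarrow> l i j = 0"
    "\<forall>j<n. \<forall>k<n. b j k = (\<Sum>i<n. l i j * l i k)"
    by (elim exE conjE)
  have l: "\<And>i. i < n \<Longrightarrow> 0 < l i i" "\<And>i j. i < j \<Longrightarrow> l i j = 0"
    "\<And>j k. j < n \<Longrightarrow> k < n \<Longrightarrow> b j k = (\<Sum>i<n. l i j * l i k)"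
    using l0 by simp_all
  define l' where "l' = (\<lambda>i j. if i = n then (if j \<le> n then a j n / sqrt c else 0) else l i j)"
  have "a j k = (\<Sum>i<Suc n. l' i j * l' i k)" if "j < Suc n" "k < Suc n" for j k
  proof -
    have s: "(\<Sum>i<Suc n. l' i j * l' i k) = (\<Sum>i<n. l i j * l i k) + a j n * a k n / c"
      using that c by (simp add: l'_def power2_eq_square[symmetric] real_sqrt_mult_self)
    show ?thesis
    proof (cases "j = n \<or> k = n")
      case True
      then have "(\<Sum>i<n. l i j * l i k) = 0" using l(2) by (auto intro!: sum.neutral)
      moreover have "a j n * a k n / c = a j k"
        using True c Suc.prems(1)[of j k] that by (auto simp: c_def)
      ultimately show ?thesis using s by simp
    next
      case False
      then show ?thesis using s l(3)[of j k] that by (simp add: b_def)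
    qed
  qed
  moreover have "0 < l' i i" if "i < Suc n" for i
    using that l(1) c by (cases "i = n") (auto simp: l'_def c_def)
  moreover have "i < j \<Longrightarrow> l' i j = 0" for i j using l(2) by (auto simp: l'_def)
  ultimately show ?case by blast
qed

lemma pos_def_cholesky:
  assumes "pos_def n A"
  obtains L where "L \<in> carrier_mat n n" "\<And>i. i < n \<Longrightarrow> 0 < L $$ (i, i)"
    "\<And>i j. i < j \<Longrightarrow> j < n \<Longrightarrow> L $$ (i, j) = 0" "A = L\<^sup>T * L"
proof -
  have A: "A \<in> carrier_mat n n" using assms by (simp add: pos_def_def)
  have "\<exists>l. (\<forall>i<n. 0 < l i i) \<and> (\<forall>i j. i < j \<longrightarrow> l i j = 0) \<and>
      (\<forall>j<n. \<forall>k<n. A $$ (j, k) = (\<Sum>i<n. l i j * l i k))"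
    by (rule cholesky_fun) (use assms in \<open>simp_all add: pos_def_def qform_def\<close>)
  then obtain l where l: "\<forall>i<n. 0 < l i i" "\<forall>i j. i < j \<longrightarrow> l i j = 0"
    "\<forall>j<n. \<forall>k<n. A $$ (j, k) = (\<Sum>i<n. l i j * l i k)"
    by (elim exE conjE)
  show thesis
  proof
    show "mat n n (\<lambda>(i, j). l i j) \<in> carrier_mat n n" by simp
    show "A = (mat n n (\<lambda>(i, j). l i j))\<^sup>T * mat n n (\<lambda>(i, j). l i j)"
      using A l(3) by (intro eq_matI) (auto simp: scalar_prod_def row_def col_def lessThan_atLeast0 intro!: sum.cong)
  qed (use l in auto)
qed

lemma lower_triangular_inverse:
  fixes L :: "real mat"
  assumes L: "L \<in> carrier_mat n n" "\<And>i. i < n \<Longrightarrow> 0 < L $$ (i, i)"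
    "\<And>i j. i < j \<Longrightarrow> j < n \<Longrightarrow> L $$ (i, j) = 0"
  obtains R where "R \<in> carrier_mat n n" "L * R = 1\<^sub>m n" "R * L = 1\<^sub>m n"
    "mdet L = (\<Prod>i<n. L $$ (i, i))"
proof -
  have d: "mdet L = (\<Prod>i<n. L $$ (i, i))"
    using det_lower_triangular[OF _ L(1)] L(1,3)
    by (auto simp: prod_list_diag_prod lessThan_atLeast0)
  then have "mdet L \<noteq> 0" using L(2) by (simp add: less_imp_neq[symmetric])
  then have "L \<in> Units (ring_mat TYPE(real) n ())" using det_non_zero_imp_unit[OF L(1)] by simp
  then obtain R where "R \<in> carrier_mat n n" "R * L = 1\<^sub>m n" "L * R = 1\<^sub>m n"
    unfolding Units_def ring_mat_def by auto
  with d show thesis using that by blast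
qed

lemma pos_def_det_pos:
  assumes "pos_def n A"
  shows "0 < mdet A"
proof -
  obtain L where L: "L \<in> carrier_mat n n" "\<And>i. i < n \<Longrightarrow> 0 < L $$ (i, i)"
    "\<And>i j. i < j \<Longrightarrow> j < n \<Longrightarrow> L $$ (i, j) = 0" "A = L\<^sup>T * L"
    using pos_def_cholesky[OF assms] by metis
  have d: "mdet L = (\<Prod>i<n. L $$ (i, i))"
    using lower_triangular_inverse[OF L(1-3)] by metis
  have "mdet A = mdet L * mdet L"
    using L by (simp add: det_mult[where n = n] det_transpose)
  moreover have "0 < (\<Prod>i<n. L $$ (i, i))" using L(2) by (intro prod_pos) auto
  ultimately show ?thesis using d by simp
qed

text \<open>\<open>mat_inverse\<close> is the result of Gauss-Jordan elimination; this identifies it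
  with an inverse found algebraically.\<close>

lemma minv_unique:
  assumes "pos_def n A" "B \<in> carrier_mat n n" "A * B = 1\<^sub>m n"
  shows "minv A = B"
proof -
  have A: "A \<in> carrier_mat n n" using assms by (simp add: pos_def_def)
  have "A \<in> Units (ring_mat TYPE(real) n ())"
    using det_non_zero_imp_unit[OF A] pos_def_det_pos[OF assms(1)] by simp
  then obtain C where C: "mat_inverse A = Some C"
    using mat_inverse(1)[OF A, where b = "()"] by (cases "mat_inverse A") auto
  then have C': "C * A = 1\<^sub>m n" "C \<in> carrier_mat n n" using mat_inverse(2)[OF A C] by auto
  have "C = C * (A * B)" using assms C' by simp
  also have "\<dots> = B" using C' A assms(2) by (simp flip: assoc_mult_mat)
  finally show ?thesis using C by simp
qed

text \<open>With \<open>R\<close> the inverse of \<open>L\<close>, the forms of \<open>A\<close> and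
  of its inverse are sums of squares: of the entries of \<open>L x\<close> and of
  \<open>R\<^sup>T x\<close>.\<close>

lemma pos_def_factor:
  assumes "pos_def n A"
  obtains L R where "L \<in> carrier_mat n n" "\<And>i. i < n \<Longrightarrow> 0 < L $$ (i, i)"
    "\<And>i j. i < j \<Longrightarrow> j < n \<Longrightarrow> L $$ (i, j) = 0" "A = L\<^sup>T * L"
    "R \<in> carrier_mat n n" "L * R = 1\<^sub>m n" "R * L = 1\<^sub>m n" "minv A = R * R\<^sup>T"
    "mdet A = (\<Prod>i<n. L $$ (i, i))\<^sup>2"
proof -
  obtain L where L: "L \<in> carrier_mat n n" "\<And>i. i < n \<Longrightarrow> 0 < L $$ (i, i)"
    "\<And>i j. i < j \<Longrightarrow> j < n \<Longrightarrow> L $$ (i, j) = 0" "A = L\<^sup>T * L"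
    using pos_def_cholesky[OF assms] by metis
  obtain R where R: "R \<in> carrier_mat n n" "L * R = 1\<^sub>m n" "R * L = 1\<^sub>m n"
    and d: "mdet L = (\<Prod>i<n. L $$ (i, i))"
    using lower_triangular_inverse[OF L(1-3)] by metis
  have RT: "L\<^sup>T * R\<^sup>T = 1\<^sub>m n" using R L(1) by (metis transpose_mult transpose_one)
  have "A * (R * R\<^sup>T) = L\<^sup>T * ((L * R) * R\<^sup>T)"
    using L(1,4) R(1) by (simp add: assoc_mult_mat[where n\<^sub>1 = n and n\<^sub>2 = n and n\<^sub>3 = n and n\<^sub>4 = n])
  also have "\<dots> = 1\<^sub>m n" using R RT by simp
  finally have "minv A = R * R\<^sup>T" using minv_unique[OF assms] R(1) by simp
  moreover have "mdet A = (\<Prod>i<n. L $$ (i, i))\<^sup>2"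
    using L d by (simp add: det_mult[where n = n] det_transpose power2_eq_square)
  ultimately show thesis using that[OF L R] by blast
qed

lemma minv_carrier: "pos_def n A \<Longrightarrow> minv A \<in> carrier_mat n n"
  by (erule pos_def_factor) simp

lemma minv_mult:
  assumes "pos_def n A" shows "A * minv A = 1\<^sub>m n" "minv A * A = 1\<^sub>m n"
proof -
  have A: "A \<in> carrier_mat n n" using assms by (simp add: pos_def_def)
  have "A \<in> Units (ring_mat TYPE(real) n ())"
    using det_non_zero_imp_unit[OF A] pos_def_det_pos[OF assms(1)] by simp
  then obtain C where C: "mat_inverse A = Some C"
    using mat_inverse(1)[OF A, where b = "()"] by (cases "mat_inverse A") auto
  show "A * minv A = 1\<^sub>m n" "minv A * A = 1\<^sub>m n" using mat_inverse(2)[OF A C] C by auto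
qed

definition mvec :: "nat \<Rightarrow> real mat \<Rightarrow> (nat \<Rightarrow> real) \<Rightarrow> nat \<Rightarrow> real" where
  "mvec n A x i = (\<Sum>j<n. A $$ (i, j) * x j)"

lemma qform_mvec: "qform n A x = (\<Sum>i<n. x i * mvec n A x i)"
  by (simp add: qform_def mvec_def sum_distrib_left mult.assoc)

lemma mvec_mult:
  assumes "A \<in> carrier_mat n n" "B \<in> carrier_mat n n" "i < n"
  shows "mvec n (A * B) x i = mvec n A (mvec n B x) i"
proof -
  have "mvec n (A * B) x i = (\<Sum>j<n. \<Sum>k<n. A $$ (i, k) * B $$ (k, j) * x j)"
    using assms by (simp add: mvec_def scalar_prod_def lessThan_atLeast0 sum_distrib_right)
  also have "\<dots> = (\<Sum>k<n. \<Sum>j<n. A $$ (i, k) * B $$ (k, j) * x j)" by (rule sum.swap)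
  finally show ?thesis by (simp add: mvec_def sum_distrib_left mult.assoc)
qed

lemma mvec_one: "i < n \<Longrightarrow> mvec n (1\<^sub>m n) x i = x i"
  by (simp add: mvec_def if_distrib[of "\<lambda>u. u * _"] cong: if_cong)

lemma sum_mvec_transpose:
  assumes "A \<in> carrier_mat n n"
  shows "(\<Sum>i<n. x i * mvec n A\<^sup>T y i) = (\<Sum>i<n. mvec n A x i * y i)"
proof -
  have "(\<Sum>i<n. x i * mvec n A\<^sup>T y i) = (\<Sum>i<n. \<Sum>j<n. x i * A $$ (j, i) * y j)"
    using assms by (simp add: mvec_def sum_distrib_left mult.assoc)
  also have "\<dots> = (\<Sum>j<n. \<Sum>i<n. x i * A $$ (j, i) * y j)" by (rule sum.swap)
  also have "\<dots> = (\<Sum>i<n. mvec n A x i * y i)"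
    by (simp add: mvec_def sum_distrib_left sum_distrib_right mult_ac)
  finally show ?thesis .
qed

lemma qform_square:
  assumes "L \<in> carrier_mat n n"
  shows "qform n (L\<^sup>T * L) x = (\<Sum>i<n. (mvec n L x i)\<^sup>2)"
proof -
  have "qform n (L\<^sup>T * L) x = (\<Sum>i<n. x i * mvec n L\<^sup>T (mvec n L x) i)"
    using assms unfolding qform_mvec by (intro sum.cong) (auto simp: mvec_mult)
  then show ?thesis using assms by (simp add: sum_mvec_transpose power2_eq_square)
qed

lemma pos_def_gram:
  assumes "L \<in> carrier_mat n n" "R \<in> carrier_mat n n" "R * L = 1\<^sub>m n"
  shows "pos_def n (L\<^sup>T * L)"
proof -
  have "0 < qform n (L\<^sup>T * L) x" if x: "\<exists>i<n. x i \<noteq> 0" for x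
  proof (rule ccontr)
    assume "\<not> ?thesis"
    then have "(\<Sum>i<n. (mvec n L x i)\<^sup>2) = 0"
      unfolding qform_square[OF assms(1)] by (meson not_less order_antisym sum_nonneg zero_le_power2)
    then have "\<forall>i<n. mvec n L x i = 0" by (subst (asm) sum_nonneg_eq_0_iff) auto
    then have "\<forall>i<n. mvec n R (mvec n L x) i = 0" by (simp add: mvec_def[of n R])
    then have "\<forall>i<n. x i = 0" using assms by (metis mvec_mult mvec_one)
    with x show False by blast
  qed
  moreover have "(L\<^sup>T * L) $$ (i, j) = (L\<^sup>T * L) $$ (j, i)" if "i < n" "j < n" for i j
    using assms that by (simp add: comm_scalar_prod[where n = n])
  ultimately show ?thesis using assms by (simp add: pos_def_def)
qed

lemma pos_def_minv:
  assumes "pos_def n A" shows "pos_def n (minv A)"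
proof -
  obtain L R where "L \<in> carrier_mat n n" "R \<in> carrier_mat n n" "L * R = 1\<^sub>m n" "R * L = 1\<^sub>m n" "minv A = R * R\<^sup>T"
    using pos_def_factor[OF assms] by metis
  moreover from this have "L\<^sup>T * R\<^sup>T = 1\<^sub>m n" by (metis transpose_mult transpose_one)
  ultimately show ?thesis using pos_def_gram[of "R\<^sup>T" n "L\<^sup>T"] by simp
qed

lemma pos_def_qform_nonneg:
  assumes "pos_def n A" shows "0 \<le> qform n A x"
proof (cases "\<exists>i<n. x i \<noteq> 0")
  case True then show ?thesis using assms unfolding pos_def_def by (simp add: less_imp_le)
next
  case False then show ?thesis by (simp add: qform_def)
qed

text \<open>The determinant is the product of the squared pivots. Each squared pivot is at most the
  diagonal entry of \<open>A\<close>, a sum of squares along a column of \<open>L\<close>, and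
  \<open>z \<le> exp (z - 1)\<close>.\<close>

lemma hadamard_exp:
  assumes "pos_def n A"
  shows "mdet A \<le> exp ((\<Sum>i<n. A $$ (i, i)) - real n)"
proof -
  obtain L where L: "L \<in> carrier_mat n n" "A = L\<^sup>T * L" "mdet A = (\<Prod>i<n. L $$ (i, i))\<^sup>2"
    using pos_def_factor[OF assms] by metis
  have "(L $$ (i, i))\<^sup>2 \<le> exp (A $$ (i, i) - 1)" if "i < n" for i
  proof -
    have "(L $$ (i, i))\<^sup>2 \<le> (\<Sum>k<n. (L $$ (k, i))\<^sup>2)" using that by (intro member_le_sum) auto
    also have "\<dots> = A $$ (i, i)" using L that
      by (simp add: scalar_prod_def lessThan_atLeast0 power2_eq_square)
    also have "\<dots> \<le> exp (A $$ (i, i) - 1)" using exp_ge_add_one_self[of "A $$ (i, i) - 1"] by simp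
    finally show ?thesis .
  qed
  then have "(\<Prod>i<n. (L $$ (i, i))\<^sup>2) \<le> (\<Prod>i<n. exp (A $$ (i, i) - 1))"
    by (intro prod_mono) auto
  then show ?thesis using L by (simp add: prod_power_distrib exp_sum[symmetric] sum_subtractf)
qed

text \<open>\<open>hadamard_exp\<close> is applied to the congruent matrix \<open>C\<close>, whose
  trace is \<open>frob n (minv A) B\<close> and whose determinant is the quotient of the
  determinants of \<open>B\<close> and \<open>A\<close>.\<close>

lemma det_le_exp_frob:
  assumes A: "pos_def n A" and B: "pos_def n B"
  shows "mdet B \<le> mdet A * exp (frob n (minv A) B - real n)"
proof -
  obtain L R where L: "L \<in> carrier_mat n n" "A = L\<^sup>T * L" "mdet A = (\<Prod>i<n. L $$ (i, i))\<^sup>2"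
    and R: "R \<in> carrier_mat n n" "L * R = 1\<^sub>m n" "R * L = 1\<^sub>m n" "minv A = R * R\<^sup>T"
    by (rule pos_def_factor[OF A], rule that)
  obtain K Q where K: "K \<in> carrier_mat n n" "B = K\<^sup>T * K"
    and Q: "Q \<in> carrier_mat n n" "K * Q = 1\<^sub>m n" "Q * K = 1\<^sub>m n"
    using pos_def_factor[OF B] by metis
  note as = assoc_mult_mat[where n\<^sub>1 = n and n\<^sub>2 = n and n\<^sub>3 = n and n\<^sub>4 = n]
  define C where "C = R\<^sup>T * B * R"
  have C: "C = (K * R)\<^sup>T * (K * R)"
    using K R by (simp add: C_def transpose_mult[where nr = n and n = n and nc = n] as)
  have "(L * Q) * (K * R) = L * (Q * K) * R" using K(1) Q(1) L(1) R(1) by (simp add: as)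
  then have "(L * Q) * (K * R) = 1\<^sub>m n" unfolding Q(3) using L(1) R(1,2) by simp
  then have "pos_def n C" unfolding C using pos_def_gram[of "K * R" n "L * Q"] K R L Q by simp
  then have "mdet C \<le> exp ((\<Sum>i<n. C $$ (i, i)) - real n)" by (rule hadamard_exp)
  moreover have "(\<Sum>i<n. C $$ (i, i)) = frob n (minv A) B"
  proof -
    \<comment> \<open>Reordering this triple sum is the cyclicity of the trace.\<close>
    have "(\<Sum>k<n. C $$ (k, k)) = (\<Sum>k<n. \<Sum>j<n. \<Sum>i<n. R $$ (i, k) * B $$ (i, j) * R $$ (j, k))"
      using R K by (intro sum.cong refl)
        (simp add: C_def scalar_prod_def lessThan_atLeast0 sum_distrib_right)
    also have "\<dots> = (\<Sum>j<n. \<Sum>k<n. \<Sum>i<n. R $$ (i, k) * B $$ (i, j) * R $$ (j, k))" by (rule sum.swap)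
    also have "\<dots> = (\<Sum>j<n. \<Sum>i<n. \<Sum>k<n. R $$ (i, k) * B $$ (i, j) * R $$ (j, k))"
      by (intro sum.cong refl sum.swap)
    also have "\<dots> = (\<Sum>i<n. \<Sum>j<n. \<Sum>k<n. R $$ (i, k) * B $$ (i, j) * R $$ (j, k))" by (rule sum.swap)
    also have "\<dots> = frob n (minv A) B"
      unfolding frob_def using R
      by (intro sum.cong refl) (simp add: scalar_prod_def lessThan_atLeast0 sum_distrib_left sum_distrib_right mult_ac)
    finally show ?thesis .
  qed
  moreover have "mdet A * mdet C = mdet B"
  proof -
    have "mdet L * mdet R = 1" using L R det_mult[of L n R] by simp
    moreover have "mdet C = mdet R * mdet B * mdet R"
      using R K by (simp add: C_def det_mult[where n = n] det_transpose)
    moreover have "mdet A = mdet L * mdet L"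
      using L by (simp add: det_mult[where n = n] det_transpose)
    ultimately show ?thesis by (metis mult.assoc mult.commute mult.left_neutral)
  qed
  ultimately show ?thesis using pos_def_det_pos[OF A] by (metis mult_le_cancel_left_pos)
qed

lemma qform_add_smult:
  assumes "A \<in> carrier_mat n n" "B \<in> carrier_mat n n"
  shows "qform n (A + c \<cdot>\<^sub>m B) x = qform n A x + c * qform n B x"
  using assms by (simp add: qform_def sum.distrib algebra_simps sum_distrib_left)

lemma qform_scale: "qform n A (\<lambda>i. c * x i) = c\<^sup>2 * qform n A x"
  by (simp add: qform_def sum_distrib_left power2_eq_square mult_ac)

lemma qform_minv_mvec:
  assumes "pos_def n A"
  shows "qform n A (mvec n (minv A) x) = qform n (minv A) x"
    "(\<Sum>i<n. x i * mvec n (minv A) x i) = qform n (minv A) x"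
proof -
  have A: "A \<in> carrier_mat n n" using assms by (simp add: pos_def_def)
  have "mvec n A (mvec n (minv A) x) i = x i" if "i < n" for i
    using mvec_mult[OF A minv_carrier[OF assms] that, of x] mvec_one[OF that, of x] minv_mult[OF assms] by simp
  then show "qform n A (mvec n (minv A) x) = qform n (minv A) x"
    unfolding qform_mvec by (intro sum.cong refl) (simp add: mult.commute)
qed (simp add: qform_mvec)

text \<open>The difference of the two sides is the squared norm of \<open>R\<^sup>T x - L y\<close>.
  The comparisons of inverses below all come from inserting a suitable \<open>y\<close>.\<close>

lemma pos_def_fenchel:
  assumes "pos_def n A"
  shows "2 * (\<Sum>i<n. x i * y i) - qform n A y \<le> qform n (minv A) x"
proof -
  obtain L R where L: "L \<in> carrier_mat n n" "A = L\<^sup>T * L"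
    and R: "R \<in> carrier_mat n n" "L * R = 1\<^sub>m n" "R * L = 1\<^sub>m n" "minv A = R * R\<^sup>T"
    using pos_def_factor[OF assms] by metis
  have q: "qform n (minv A) x = (\<Sum>i<n. (mvec n R\<^sup>T x i)\<^sup>2)"
    using qform_square[of "R\<^sup>T" n x] R by simp
  have "(\<Sum>i<n. x i * y i) = (\<Sum>i<n. y i * mvec n L\<^sup>T (mvec n R\<^sup>T x) i)"
  proof (intro sum.cong refl)
    fix i assume "i \<in> {..<n}"
    moreover have "L\<^sup>T * R\<^sup>T = 1\<^sub>m n" using L R by (metis transpose_mult transpose_one)
    ultimately have "mvec n L\<^sup>T (mvec n R\<^sup>T x) i = x i"
      using L R mvec_mult[of "L\<^sup>T" n "R\<^sup>T" i x] by (simp add: mvec_one)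
    then show "x i * y i = y i * mvec n L\<^sup>T (mvec n R\<^sup>T x) i" by simp
  qed
  also have "\<dots> = (\<Sum>i<n. mvec n L y i * mvec n R\<^sup>T x i)" using L by (simp add: sum_mvec_transpose)
  finally have xy: "(\<Sum>i<n. x i * y i) = (\<Sum>i<n. mvec n L y i * mvec n R\<^sup>T x i)" .
  have "0 \<le> (\<Sum>i<n. (mvec n R\<^sup>T x i - mvec n L y i)\<^sup>2)" by (intro sum_nonneg) auto
  also have "\<dots> = qform n (minv A) x + qform n A y - 2 * (\<Sum>i<n. x i * y i)"
    unfolding q xy using L
    by (simp add: qform_square power2_diff sum.distrib sum_subtractf sum_distrib_left mult_ac)
  finally show ?thesis by simp
qed

text \<open>The Fenchel inequality is taken at \<open>t * y\<close> with the optimal scale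
  \<open>t\<close>.\<close>

lemma pos_def_cauchy_schwarz:
  assumes "pos_def n A"
  shows "(\<Sum>i<n. x i * y i)\<^sup>2 \<le> qform n (minv A) x * qform n A y"
proof (cases "\<exists>i<n. y i \<noteq> 0")
  case True
  then have q: "0 < qform n A y" using assms by (simp add: pos_def_def)
  define s where "s = (\<Sum>i<n. x i * y i)"
  define t where "t = s / qform n A y"
  have "2 * (\<Sum>i<n. x i * (t * y i)) - qform n A (\<lambda>i. t * y i) \<le> qform n (minv A) x"
    by (rule pos_def_fenchel[OF assms])
  moreover have "(\<Sum>i<n. x i * (t * y i)) = t * s" by (simp add: s_def sum_distrib_left mult_ac)
  ultimately have "2 * t * s - t\<^sup>2 * qform n A y \<le> qform n (minv A) x" by (simp add: qform_scale)
  moreover have "2 * t * s - t\<^sup>2 * qform n A y = s\<^sup>2 / qform n A y"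
    using q by (simp add: t_def power2_eq_square field_simps)
  ultimately show ?thesis using q by (simp add: s_def pos_divide_le_eq)
next
  case False then show ?thesis by (simp add: qform_def)
qed

text \<open>Inserting \<open>c\<close> times \<open>minv B\<close> applied to \<open>x\<close> into
  the Fenchel inequality for \<open>A\<close> reverses the order of the inverses.\<close>

lemma qform_minv_antimono:
  assumes A: "pos_def n A" and B: "pos_def n B" and c: "0 < c"
    and le: "\<And>y. c * qform n A y \<le> qform n B y"
  shows "c * qform n (minv B) x \<le> qform n (minv A) x"
proof -
  define y where "y = mvec n (minv B) x"
  have "2 * (\<Sum>i<n. x i * (c * y i)) - qform n A (\<lambda>i. c * y i) \<le> qform n (minv A) x"
    by (rule pos_def_fenchel[OF A])
  moreover have "(\<Sum>i<n. x i * (c * y i)) = c * qform n (minv B) x"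
    using qform_minv_mvec(2)[OF B, of x] by (simp add: y_def mult.left_commute flip: sum_distrib_left)
  moreover have "c * (c * qform n A y) \<le> c * qform n B y" using le c by (intro mult_left_mono) auto
  moreover have "qform n B y = qform n (minv B) x" unfolding y_def by (rule qform_minv_mvec(1)[OF B])
  ultimately show ?thesis by (simp add: qform_scale power2_eq_square mult_ac)
qed

text \<open>Multiplying the sum by \<open>A\<close> on the left and by \<open>B\<close> on the right
  gives \<open>B + c \<cdot>\<^sub>m A\<close>, hence the determinant. Either sign of
  \<open>c\<close> is allowed because upper tails of a quadratic form require a negative
  one.\<close>

lemma pos_def_minv_add_smult:
  assumes A: "pos_def n A" and B: "pos_def n B" and AB: "pos_def n (B + c \<cdot>\<^sub>m A)"
  shows "pos_def n (minv A + c \<cdot>\<^sub>m minv B)"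
    "mdet A * mdet (minv A + c \<cdot>\<^sub>m minv B) =
      mdet (B + c \<cdot>\<^sub>m A) / mdet B"
proof -
  have cA: "A \<in> carrier_mat n n" and cB: "B \<in> carrier_mat n n" using A B by (auto simp: pos_def_def)
  note car = cA cB minv_carrier[OF A] minv_carrier[OF B]
  note as = assoc_mult_mat[where n\<^sub>1 = n and n\<^sub>2 = n and n\<^sub>3 = n and n\<^sub>4 = n]
  have iA: "pos_def n (minv A)" and iB: "pos_def n (minv B)" using A B by (auto intro: pos_def_minv)
  have "0 < qform n (minv A + c \<cdot>\<^sub>m minv B) x" if x: "\<exists>i<n. x i \<noteq> 0" for x
  proof (cases "c \<ge> 0")
    case True
    have "0 < qform n (minv A) x" using iA x by (simp add: pos_def_def)
    moreover have "0 \<le> qform n (minv B) x" by (rule pos_def_qform_nonneg[OF iB])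
    ultimately show ?thesis using True by (simp add: qform_add_smult[OF car(3,4)] add_pos_nonneg)
  next
    case False
    \<comment> \<open>For negative \<open>c\<close> the Fenchel inequality for \<open>A\<close> at
      \<open>- c * y\<close> leaves as remainder \<open>- c\<close> times the form of
      \<open>B + c \<cdot>\<^sub>m A\<close> at \<open>y\<close>, which is positive by
      \<open>AB\<close>.\<close>
    define y where "y = mvec n (minv B) x"
    have "2 * (\<Sum>i<n. x i * (- c * y i)) - qform n A (\<lambda>i. - c * y i) \<le> qform n (minv A) x"
      by (rule pos_def_fenchel[OF A])
    moreover have "(\<Sum>i<n. x i * (- c * y i)) = - c * qform n (minv B) x"
      using qform_minv_mvec(2)[OF B, of x] by (simp add: y_def mult.left_commute sum_negf flip: sum_distrib_left)
    moreover have q: "qform n B y = qform n (minv B) x" unfolding y_def by (rule qform_minv_mvec(1)[OF B])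
    moreover have "\<exists>i<n. y i \<noteq> 0"
    proof (rule ccontr)
      assume "\<not> ?thesis"
      then have "qform n (minv B) x = 0" unfolding q[symmetric] by (simp add: qform_def)
      moreover have "0 < qform n (minv B) x" using iB x by (simp add: pos_def_def)
      ultimately show False by simp
    qed
    then have "0 < qform n B y + c * qform n A y"
      using AB unfolding pos_def_def qform_add_smult[OF cB cA, symmetric] by blast
    then have "- c * (qform n B y + c * qform n A y) > 0" using False by (intro mult_pos_pos) auto
    ultimately show ?thesis unfolding qform_add_smult[OF car(3,4)] qform_scale
      by (simp add: power2_eq_square algebra_simps)
  qed
  then show "pos_def n (minv A + c \<cdot>\<^sub>m minv B)"
    using iA iB car by (auto simp: pos_def_def)
  have "A * (minv A + c \<cdot>\<^sub>m minv B) * B = (A * minv A) * B + c \<cdot>\<^sub>m (A * (minv B * B))"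
    using car by (simp add: mult_add_distrib_mat[where nr = n and n = n and nc = n]
        add_mult_distrib_mat[where nr = n and n = n and nc = n] as
        mult_smult_distrib[where nr = n and n = n and nc = n] mult_smult_assoc_mat[where nr = n and n = n and nc = n])
  also have "\<dots> = B + c \<cdot>\<^sub>m A" using car by (simp add: minv_mult[OF A] minv_mult[OF B])
  finally have "mdet (B + c \<cdot>\<^sub>m A) = mdet (A * (minv A + c \<cdot>\<^sub>m minv B) * B)" by simp
  also have "\<dots> = mdet A * mdet (minv A + c \<cdot>\<^sub>m minv B) * mdet B"
    using car by (simp add: det_mult[where n = n])
  finally show "mdet A * mdet (minv A + c \<cdot>\<^sub>m minv B) =
      mdet (B + c \<cdot>\<^sub>m A) / mdet B"
    using pos_def_det_pos[OF B] by simp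
qed

lemma frob_minv_self:
  assumes "pos_def n A" shows "frob n (minv A) A = real n"
proof -
  have A: "A \<in> carrier_mat n n" "\<And>i j. i < n \<Longrightarrow> j < n \<Longrightarrow> A $$ (i, j) = A $$ (j, i)"
    using assms by (auto simp: pos_def_def)
  have "frob n (minv A) A = (\<Sum>i<n. (minv A * A) $$ (i, i))"
    unfolding frob_def using A minv_carrier[OF assms]
    by (intro sum.cong refl) (auto simp: scalar_prod_def lessThan_atLeast0 intro!: sum.cong)
  then show ?thesis by (simp add: minv_mult[OF assms])
qed

subsection \<open>Gaussian integrals\<close>

lemma nn_integral_gaussian_affine:
  fixes a c :: real
  assumes "0 < a"
  shows "(\<integral>\<^sup>+y. ennreal (exp (- (c + a * y)\<^sup>2 / 2)) \<partial>lborel) = ennreal (sqrt (2 * pi) / a)"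
proof -
  have e: "exp (- (c + a * y)\<^sup>2 / 2) = sqrt (2 * pi) / a * normal_density (- c / a) (1 / a) y" for y
  proof -
    have "y - - c / a = (c + a * y) / a" using assms by (simp add: field_simps)
    then have "- (y - - c / a)\<^sup>2 / (2 * (1 / a)\<^sup>2) = - (c + a * y)\<^sup>2 / 2"
      using assms by (simp add: power_divide)
    moreover have "sqrt (2 * pi * (1 / a)\<^sup>2) = sqrt (2 * pi) / a"
      using assms by (simp add: power_divide real_sqrt_divide real_sqrt_mult)
    ultimately show ?thesis using assms by (simp add: normal_density_def)
  qed
  interpret prob_space "density lborel (normal_density (- c / a) (1 / a))"
    by (rule prob_space_normal_density) (use assms in simp)
  have "(\<integral>\<^sup>+y. ennreal (normal_density (- c / a) (1 / a) y) \<partial>lborel) = 1"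
    using emeasure_space_1 by (simp add: emeasure_density)
  moreover have "(\<integral>\<^sup>+y. ennreal (sqrt (2 * pi) / a * normal_density (- c / a) (1 / a) y) \<partial>lborel) =
      ennreal (sqrt (2 * pi) / a) * (\<integral>\<^sup>+y. ennreal (normal_density (- c / a) (1 / a) y) \<partial>lborel)"
    using assms by (subst nn_integral_cmult[symmetric]) (auto simp flip: ennreal_mult')
  ultimately show ?thesis unfolding e by simp
qed

lemma nn_integral_gaussian_triangular:
  fixes l :: "nat \<Rightarrow> nat \<Rightarrow> real"
  assumes "\<And>i. i < n \<Longrightarrow> 0 < l i i" "\<And>i j. i < j \<Longrightarrow> j < n \<Longrightarrow> l i j = 0"
  shows "(\<integral>\<^sup>+x. ennreal (exp (- (\<Sum>i<n. (\<Sum>j<n. l i j * x j)\<^sup>2) / 2)) \<partial>(\<Pi>\<^sub>M i\<in>{..<n}. lborel)) =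
    ennreal (\<Prod>i<n. sqrt (2 * pi) / l i i)"
  using assms
proof (induction n)
  case 0
  interpret product_sigma_finite "\<lambda>_::nat. lborel :: real measure" ..
  show ?case by (simp add: space_PiM_empty)
next
  case (Suc n)
  interpret product_sigma_finite "\<lambda>_::nat. lborel :: real measure" ..
  define h where "h = (\<lambda>x. exp (- (\<Sum>i<n. (\<Sum>j<n. l i j * x j)\<^sup>2) / 2))"
  define c where "c = (\<lambda>x. \<Sum>j<n. l n j * x j)"
  have split: "exp (- (\<Sum>i<Suc n. (\<Sum>j<Suc n. l i j * (x(n := y)) j)\<^sup>2) / 2) =
      h x * exp (- (c x + l n n * y)\<^sup>2 / 2)" for x y
  proof -
    have "(\<Sum>j<Suc n. l i j * (x(n := y)) j) = (\<Sum>j<n. l i j * x j)" if "i < n" for i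
      using Suc.prems(2)[of i n] that by simp
    then have "(\<Sum>i<n. (\<Sum>j<Suc n. l i j * (x(n := y)) j)\<^sup>2) = (\<Sum>i<n. (\<Sum>j<n. l i j * x j)\<^sup>2)"
      by (intro sum.cong refl) (metis lessThan_iff)
    then have "(\<Sum>i<Suc n. (\<Sum>j<Suc n. l i j * (x(n := y)) j)\<^sup>2) =
        (\<Sum>i<n. (\<Sum>j<n. l i j * x j)\<^sup>2) + (c x + l n n * y)\<^sup>2"
      by (subst sum.lessThan_Suc) (simp add: c_def)
    then show ?thesis by (simp add: h_def exp_add[symmetric] add_divide_distrib)
  qed
  have [measurable]: "h \<in> borel_measurable (Pi\<^sub>M {..<n} (\<lambda>_. lborel))"
    unfolding h_def by measurable
  have "(\<integral>\<^sup>+x. ennreal (exp (- (\<Sum>i<Suc n. (\<Sum>j<Suc n. l i j * x j)\<^sup>2) / 2))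
          \<partial>(Pi\<^sub>M (insert n {..<n}) (\<lambda>_. lborel)))
      = (\<integral>\<^sup>+x. \<integral>\<^sup>+y. ennreal (exp (- (\<Sum>i<Suc n. (\<Sum>j<Suc n. l i j * (x(n := y)) j)\<^sup>2) / 2)) \<partial>lborel
          \<partial>(Pi\<^sub>M {..<n} (\<lambda>_. lborel)))"
    by (subst product_nn_integral_insert) (auto simp flip: lessThan_Suc simp del: sum.lessThan_Suc)
  also have "\<dots>
      = (\<integral>\<^sup>+x. \<integral>\<^sup>+y. ennreal (h x) * ennreal (exp (- (c x + l n n * y)\<^sup>2 / 2)) \<partial>lborel
          \<partial>(Pi\<^sub>M {..<n} (\<lambda>_. lborel)))"
    unfolding split by (simp add: ennreal_mult' h_def)
  also have "\<dots> = (\<integral>\<^sup>+x. ennreal (h x) * ennreal (sqrt (2 * pi) / l n n) \<partial>(Pi\<^sub>M {..<n} (\<lambda>_. lborel)))"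
    using Suc.prems(1)[of n] by (simp add: nn_integral_cmult nn_integral_gaussian_affine[simplified])
  also have "\<dots> = ennreal (\<Prod>i<n. sqrt (2 * pi) / l i i) * ennreal (sqrt (2 * pi) / l n n)"
    using Suc by (simp add: nn_integral_multc h_def)
  also have "\<dots> = ennreal (\<Prod>i<Suc n. sqrt (2 * pi) / l i i)"
    using Suc.prems(1)[of n] by (subst ennreal_mult''[symmetric]) auto
  finally show ?case by (simp add: lessThan_Suc)
qed

lemma nn_integral_gaussian_pos_def:
  assumes "pos_def n Q"
  shows "(\<integral>\<^sup>+x. ennreal (exp (- qform n Q x / 2)) \<partial>(\<Pi>\<^sub>M i\<in>{..<n}. lborel)) =
    ennreal ((2 * pi) powr (real n / 2) * mdet Q powr (- 1 / 2))"
proof -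
  obtain L R where L: "L \<in> carrier_mat n n" "\<And>i. i < n \<Longrightarrow> 0 < L $$ (i, i)"
    "\<And>i j. i < j \<Longrightarrow> j < n \<Longrightarrow> L $$ (i, j) = 0" "Q = L\<^sup>T * L"
    "mdet Q = (\<Prod>i<n. L $$ (i, i))\<^sup>2"
    by (rule pos_def_factor[OF assms]) (rule that)
  have p: "0 < (\<Prod>i<n. L $$ (i, i))" using L(2) by (intro prod_pos) auto
  have "(\<Prod>i<n. sqrt (2 * pi) / L $$ (i, i)) = (2 * pi) powr (real n / 2) / (\<Prod>i<n. L $$ (i, i))"
  proof -
    have "sqrt (2 * pi) ^ n = ((2 * pi) powr (1 / 2)) powr real n"
      by (subst powr_realpow) (auto simp: powr_half_sqrt)
    then show ?thesis by (simp add: prod_dividef powr_powr)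
  qed
  also have "\<dots> = (2 * pi) powr (real n / 2) * mdet Q powr (- 1 / 2)"
  proof -
    have "sqrt (mdet Q) = (\<Prod>i<n. L $$ (i, i))"
      unfolding L(5) real_sqrt_abs using p by (rule abs_of_pos)
    then have "mdet Q powr (- (1 / 2)) = inverse (\<Prod>i<n. L $$ (i, i))"
      using pos_def_det_pos[OF assms] by (simp only: powr_minus powr_half_sqrt)
    then have *: "mdet Q powr (- 1 / 2) = inverse (\<Prod>i<n. L $$ (i, i))" by simp
    show ?thesis unfolding * by (rule divide_inverse)
  qed
  finally have *: "(\<Prod>i<n. sqrt (2 * pi) / L $$ (i, i)) =
    (2 * pi) powr (real n / 2) * mdet Q powr (- 1 / 2)" .
  have "qform n Q x = (\<Sum>i<n. (\<Sum>j<n. L $$ (i, j) * x j)\<^sup>2)" for x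
    unfolding L(4) qform_square[OF L(1)] mvec_def ..
  then show ?thesis
    unfolding *[symmetric]
    using nn_integral_gaussian_triangular[of n "\<lambda>i j. L $$ (i, j)", OF L(2,3)] by presburger
qed

section \<open>The Gaussian likelihood and its Laplace transform\<close>

lemma toeplitz_carrier [simp]: "toeplitz n f \<in> carrier_mat n n"
  by (simp add: toeplitz_def)

lemma lik_qform:
  assumes "pos_def n (toeplitz n f)"
  shows "lik n f x = (2 * pi) powr (- real n / 2) * mdet (toeplitz n f) powr (- 1 / 2) *
     exp (- qform n (minv (toeplitz n f)) x / 2)"
proof -
  have "scalar_prod (vec n x) (mult_mat_vec (minv (toeplitz n f)) (vec n x)) = qform n (minv (toeplitz n f)) x"
    using minv_carrier[OF assms]
    by (simp add: scalar_prod_def mult_mat_vec_def qform_def lessThan_atLeast0 sum_distrib_left mult.assoc)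
  then show ?thesis by (simp add: lik_def)
qed

lemma lik_pos: "pos_def n (toeplitz n f) \<Longrightarrow> 0 < lik n f x"
  using pos_def_det_pos[of n "toeplitz n f"] by (simp add: lik_qform)

lemma qform_measurable [measurable]:
  "(\<lambda>x. qform n A x) \<in> borel_measurable (Pi\<^sub>M {..<n} (\<lambda>_. lborel))"
  unfolding qform_def by measurable

lemma lik_measurable:
  assumes "pos_def n (toeplitz n f)"
  shows "lik n f \<in> borel_measurable (Pi\<^sub>M {..<n} (\<lambda>_. lborel))"
  unfolding lik_qform[OF assms, abs_def] by measurable

text \<open>The integrand is an unnormalised Gaussian density with precision matrix
  \<open>Q\<close>. Its normalising constant combines with the determinant in \<open>lik\<close> to
  the ratio computed in \<open>pos_def_minv_add_smult\<close>.\<close>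

lemma lik_laplace:
  assumes A: "pos_def n (toeplitz n f)" and B: "pos_def n B" and AB: "pos_def n (B + c \<cdot>\<^sub>m toeplitz n f)"
  shows "(\<integral>\<^sup>+x. ennreal (lik n f x * exp (- c * qform n (minv B) x / 2)) \<partial>(\<Pi>\<^sub>M i\<in>{..<n}. lborel)) =
    ennreal ((mdet (B + c \<cdot>\<^sub>m toeplitz n f) / mdet B) powr (- 1 / 2))"
proof -
  let ?A = "toeplitz n f"
  define Q where "Q = minv ?A + c \<cdot>\<^sub>m minv B"
  define k where "k = (2 * pi) powr (- real n / 2) * mdet ?A powr (- 1 / 2)"
  have Q: "pos_def n Q" "mdet ?A * mdet Q = mdet (B + c \<cdot>\<^sub>m ?A) / mdet B"
    unfolding Q_def by (rule pos_def_minv_add_smult[OF A B AB])+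
  have k: "k \<ge> 0" by (simp add: k_def)
  have e: "lik n f x * exp (- c * qform n (minv B) x / 2) = k * exp (- qform n Q x / 2)" for x
    unfolding lik_qform[OF A] Q_def qform_add_smult[OF minv_carrier[OF A] minv_carrier[OF B]] k_def
    by (simp add: exp_add[symmetric] add_divide_distrib)
  have "(\<integral>\<^sup>+x. ennreal (lik n f x * exp (- c * qform n (minv B) x / 2)) \<partial>(\<Pi>\<^sub>M i\<in>{..<n}. lborel)) =
      ennreal k * ennreal ((2 * pi) powr (real n / 2) * mdet Q powr (- 1 / 2))"
    unfolding e nn_integral_gaussian_pos_def[OF Q(1), symmetric] using k
    by (subst nn_integral_cmult[symmetric]) (auto simp flip: ennreal_mult')
  also have "\<dots> = ennreal (k * ((2 * pi) powr (real n / 2) * mdet Q powr (- 1 / 2)))"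
    using k by (simp add: ennreal_mult')
  also have "k * ((2 * pi) powr (real n / 2) * mdet Q powr (- 1 / 2)) =
      ((2 * pi) powr (- real n / 2) * (2 * pi) powr (real n / 2)) * (mdet ?A powr (- 1 / 2) * mdet Q powr (- 1 / 2))"
    by (simp add: k_def)
  also have "\<dots> = (mdet ?A * mdet Q) powr (- 1 / 2)"
    using pos_def_det_pos[OF A] pos_def_det_pos[OF Q(1)]
    by (subst powr_add[symmetric]) (simp add: powr_mult)
  finally show ?thesis unfolding Q(2) .
qed

subsection \<open>Toeplitz matrices\<close>

abbreviation FQ :: "real measure" where
  "FQ \<equiv> lebesgue_on freqs"

lemma finite_measure_FQ: "finite_measure FQ"
  by (intro finite_measureI) (simp add: emeasure_restrict_space)

lemma measure_FQ: "measure FQ freqs = 2 * pi"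
  by (simp add: measure_restrict_space)

lemma set_integral_FQ:
  fixes f :: "real \<Rightarrow> 'a::{banach, second_countable_topology}"
  shows "(LINT x:freqs|lebesgue. f x) = integral\<^sup>L FQ f"
  unfolding set_lebesgue_integral_def by (rule integral_restrict_space[symmetric]) auto

lemma AE_FQ_iff: "(AE x in FQ. P x) \<longleftrightarrow> (AE x in lebesgue. x \<in> freqs \<longrightarrow> P x)"
  by (intro AE_restrict_space_iff) simp

text \<open>The endpoints are removed together with the origin: \<open>pi\<close> and
  \<open>- pi\<close> coincide on the circle, so a Fejer kernel centred at one of them also has mass
  near the other.\<close>

lemma AE_FQ_punctured: "AE x in FQ. x \<in> {-pi<..<pi} - {0}"
proof -
  have "negligible {0::real, pi, -pi}" by simp
  then have "AE x in lebesgue. x \<notin> {0::real, pi, -pi}"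
    unfolding negligible_iff_null_sets by (rule AE_not_in)
  then show ?thesis unfolding AE_FQ_iff by eventually_elim auto
qed

lemma AE_FQI: "(\<And>x. x \<in> freqs - {0} \<Longrightarrow> P x) \<Longrightarrow> AE x in FQ. P x"
  using AE_FQ_punctured by eventually_elim auto

lemma continuous_FQ_measurable:
  fixes f :: "real \<Rightarrow> real"
  assumes "continuous_on (freqs - {0}) f"
  shows "f \<in> borel_measurable FQ"
proof -
  have "(\<lambda>x. indicator (freqs - {0}) x *\<^sub>R f x) \<in> borel_measurable borel"
    using assms by (intro borel_measurable_continuous_on_indicator) auto
  then have "(\<lambda>x. indicator (freqs - {0}) x *\<^sub>R f x + indicator {0} x * f 0) \<in> borel_measurable borel"
    by measurable
  then have "(\<lambda>x. indicator (freqs - {0}) x *\<^sub>R f x + indicator {0} x * f 0) \<in> borel_measurable FQ"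
    by (intro measurable_restrict_space1 measurable_completion) simp
  then show ?thesis
    by (rule measurable_cong[THEN iffD1, rotated]) (auto simp: indicator_def)
qed

lemma integrable_FQ_bounded_mult:
  fixes f b :: "real \<Rightarrow> real"
  assumes "integrable FQ f" "continuous_on UNIV b" "\<And>x. x \<in> freqs \<Longrightarrow> \<bar>b x\<bar> \<le> C"
  shows "integrable FQ (\<lambda>x. f x * b x)"
proof (rule Bochner_Integration.integrable_bound)
  show "integrable FQ (\<lambda>x. f x * C)" using assms by simp
  have "b \<in> borel_measurable FQ" by (rule continuous_FQ_measurable) (rule continuous_on_subset[OF assms(2)], simp)
  then show "(\<lambda>x. f x * b x) \<in> borel_measurable FQ" using assms(1) by simp
  show "AE x in FQ. norm (f x * b x) \<le> norm (f x * C)"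
  proof (rule AE_FQI)
    fix x :: real assume "x \<in> freqs - {0}"
    then have "\<bar>b x\<bar> \<le> C" using assms(3) by blast
    then show "norm (f x * b x) \<le> norm (f x * C)" by (simp add: abs_mult mult_left_mono)
  qed
qed

lemma integrable_FQ_cos: "integrable FQ f \<Longrightarrow> integrable FQ (\<lambda>x. f x * cos (a * x))"
  by (rule integrable_FQ_bounded_mult[where C = 1]) (auto intro!: continuous_intros)

lemma integrable_FQ_sin: "integrable FQ f \<Longrightarrow> integrable FQ (\<lambda>x. f x * sin (a * x))"
  by (rule integrable_FQ_bounded_mult[where C = 1]) (auto intro!: continuous_intros)

lemma integrable_FQ_const: "integrable FQ (\<lambda>x. c::real)"
  using finite_measure_FQ by (simp add: finite_measure.integrable_const)

lemma integral_FQ_FTC: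
  fixes F f :: "real \<Rightarrow> real"
  assumes "\<And>x. (F has_real_derivative f x) (at x)" "continuous_on UNIV f"
  shows "integral\<^sup>L FQ f = F pi - F (- pi)"
proof -
  have "integrable FQ f"
    by (intro continuous_imp_integrable_real) (rule continuous_on_subset[OF assms(2)], simp)
  then have "integral\<^sup>L FQ f = integral freqs f" by (simp add: lebesgue_integral_eq_integral)
  also have "(f has_integral (F pi - F (- pi))) freqs"
    using assms(1) by (intro fundamental_theorem_of_calculus)
      (auto simp: has_real_derivative_iff_has_vector_derivative[symmetric] intro: has_field_derivative_at_within)
  then have "integral freqs f = F pi - F (- pi)" by (rule integral_unique)
  finally show ?thesis .
qed

lemma integral_FQ_cos_int: "(\<integral>x. cos (of_int k * x) \<partial>FQ) = (if k = 0 then 2 * pi else 0)"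
proof (cases "k = 0")
  case False
  then have "(\<integral>x. cos (of_int k * x) \<partial>FQ) = sin (of_int k * pi) / of_int k - sin (of_int k * - pi) / of_int k"
    by (intro integral_FQ_FTC) (auto intro!: derivative_eq_intros continuous_intros)
  then show ?thesis using False by (simp add: sin_integer_2pi mult.commute sin_zero_iff_int2)
qed (simp add: measure_FQ)

lemma integral_FQ_sin_int: "(\<integral>x. sin (of_int k * x) \<partial>FQ) = 0"
proof (cases "k = 0")
  case False
  then have "(\<integral>x. sin (of_int k * x) \<partial>FQ) = - cos (of_int k * pi) / of_int k - - cos (of_int k * - pi) / of_int k"
    by (intro integral_FQ_FTC) (auto intro!: derivative_eq_intros continuous_intros)
  then show ?thesis by simp
qed simp

lemma integral_FQ_cos: "(\<integral>x. cos ((real j - real k) * x) \<partial>FQ) = (if j = k then 2 * pi else 0)"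
  using integral_FQ_cos_int[of "int j - int k"] by simp

lemma integral_FQ_sin: "(\<integral>x. sin ((real j - real k) * x) \<partial>FQ) = 0"
  using integral_FQ_sin_int[of "int j - int k"] by simp

lemma integral_FQ_odd:
  assumes "\<And>x. x \<in> freqs \<Longrightarrow> g (- x) = - g x"
  shows "integral\<^sup>L FQ g = (0::real)"
proof -
  have "integral\<^sup>L FQ g = (\<integral>x. g (- x) \<partial>FQ)" using Equivalence_Lebesgue_Henstock_Integration.integral_reflect_real[of pi "-pi" g] by simp
  also have "\<dots> = (\<integral>x. - g x \<partial>FQ)" using assms by (intro Bochner_Integration.integral_cong) auto
  finally show ?thesis by simp
qed

lemma toeplitz_index:
  assumes "integrable FQ f" "j < n" "k < n"
  shows "toeplitz n f $$ (j, k) = (\<integral>x. f x * cos ((real j - real k) * x) \<partial>FQ)"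
proof -
  let ?a = "real j - real k"
  have "integrable FQ (\<lambda>x. complex_of_real (f x * cos (?a * x)) + \<i> * complex_of_real (f x * sin (?a * x)))"
    by (intro Bochner_Integration.integrable_add integrable_mult_right integrable_of_real integrable_FQ_cos integrable_FQ_sin assms)
  moreover have "complex_of_real (f x * cos (?a * x)) + \<i> * complex_of_real (f x * sin (?a * x)) =
      complex_of_real (f x) * cis (?a * x)" for x
    by (simp add: complex_eq_iff)
  ultimately have i: "integrable FQ (\<lambda>x. complex_of_real (f x) * cis (?a * x))" by simp
  have "toeplitz n f $$ (j, k) = Re (\<integral>x. complex_of_real (f x) * cis (?a * x) \<partial>FQ)"
    using assms(2,3) by (simp add: toeplitz_def set_integral_FQ)
  also have "\<dots> = (\<integral>x. f x * cos (?a * x) \<partial>FQ)"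
    using i by (subst integral_Re[symmetric]) auto
  finally show ?thesis .
qed

lemma toeplitz_add_smult:
  assumes "integrable FQ f" "integrable FQ g"
  shows "toeplitz n (\<lambda>x. f x + c * g x) = toeplitz n f + c \<cdot>\<^sub>m toeplitz n g"
proof (rule eq_matI)
  fix j k assume "j < dim_row (toeplitz n f + c \<cdot>\<^sub>m toeplitz n g)" "k < dim_col (toeplitz n f + c \<cdot>\<^sub>m toeplitz n g)"
  then have jk: "j < n" "k < n" by (auto simp: toeplitz_def)
  have "(\<integral>x. (f x + c * g x) * cos ((real j - real k) * x) \<partial>FQ) =
      (\<integral>x. f x * cos ((real j - real k) * x) + c * (g x * cos ((real j - real k) * x)) \<partial>FQ)"
    by (simp add: algebra_simps)
  also have "\<dots> = (\<integral>x. f x * cos ((real j - real k) * x) \<partial>FQ) + c * (\<integral>x. g x * cos ((real j - real k) * x) \<partial>FQ)"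
    using assms by (subst Bochner_Integration.integral_add) (auto intro: integrable_FQ_cos)
  finally show "toeplitz n (\<lambda>x. f x + c * g x) $$ (j, k) = (toeplitz n f + c \<cdot>\<^sub>m toeplitz n g) $$ (j, k)"
    using jk assms by (simp add: toeplitz_index toeplitz_carrier[THEN carrier_matD(1)] toeplitz_carrier[THEN carrier_matD(2)])
qed (auto simp: toeplitz_def)

section \<open>Trigonometric polynomials and Toeplitz quadratic forms\<close>

definition cosv :: "real \<Rightarrow> nat \<Rightarrow> real" where "cosv x j = cos (real j * x)"
definition sinv :: "real \<Rightarrow> nat \<Rightarrow> real" where "sinv x j = sin (real j * x)"

text \<open>The squared modulus at frequency \<open>x\<close> of the trigonometric polynomial with
  coefficients \<open>y\<close>; the form of a Toeplitz matrix integrates it against the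
  density.\<close>

definition trig_sq :: "nat \<Rightarrow> (nat \<Rightarrow> real) \<Rightarrow> real \<Rightarrow> real" where
  "trig_sq n y x = (\<Sum>j<n. cosv x j * y j)\<^sup>2 + (\<Sum>j<n. sinv x j * y j)\<^sup>2"

text \<open>For symmetric \<open>A\<close> this is its Hermitian form at the vector of all
  \<open>cis (j * x)\<close>, split into real forms so that inequalities between real quadratic
  forms apply. It expresses traces against Toeplitz matrices as integrals over frequencies.\<close>

definition kern :: "nat \<Rightarrow> real mat \<Rightarrow> real \<Rightarrow> real" where
  "kern n A x = qform n A (cosv x) + qform n A (sinv x)"

lemma cos_diff_nat: "cos ((real j - real k) * x) = cosv x j * cosv x k + sinv x j * sinv x k"
  by (simp add: left_diff_distrib cos_diff cosv_def sinv_def)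

lemma trig_sq_eq: "trig_sq n y x = (\<Sum>j<n. \<Sum>k<n. y j * y k * cos ((real j - real k) * x))"
  unfolding trig_sq_def cos_diff_nat
  by (simp add: power2_eq_square sum_product sum.distrib[symmetric] algebra_simps)

lemma kern_eq: "kern n A x = (\<Sum>j<n. \<Sum>k<n. A $$ (j, k) * cos ((real j - real k) * x))"
  unfolding kern_def qform_def cos_diff_nat by (simp add: sum.distrib[symmetric] algebra_simps)

lemma trig_sq_nonneg: "0 \<le> trig_sq n y x"
  by (simp add: trig_sq_def)

lemma kern_nonneg: "pos_def n A \<Longrightarrow> 0 \<le> kern n A x"
  by (simp add: kern_def pos_def_qform_nonneg)

lemma integrable_FQ_trig_sum:
  assumes "integrable FQ f"
  shows "integrable FQ (\<lambda>x. f x * (\<Sum>j<n. \<Sum>k<n. a j k * cos ((real j - real k) * x)))"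
    "(\<integral>x. f x * (\<Sum>j<n. \<Sum>k<n. a j k * cos ((real j - real k) * x)) \<partial>FQ) =
      (\<Sum>j<n. \<Sum>k<n. a j k * (\<integral>x. f x * cos ((real j - real k) * x) \<partial>FQ))"
proof -
  have e: "f x * (\<Sum>j<n. \<Sum>k<n. a j k * cos ((real j - real k) * x)) =
    (\<Sum>j<n. \<Sum>k<n. a j k * (f x * cos ((real j - real k) * x)))" for x
    by (simp add: sum_distrib_left mult_ac)
  have i: "integrable FQ (\<lambda>x. a j k * (f x * cos ((real j - real k) * x)))" for j k
    using integrable_FQ_cos[OF assms] by simp
  show "integrable FQ (\<lambda>x. f x * (\<Sum>j<n. \<Sum>k<n. a j k * cos ((real j - real k) * x)))"
    unfolding e by (intro Bochner_Integration.integrable_sum i)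
  show "(\<integral>x. f x * (\<Sum>j<n. \<Sum>k<n. a j k * cos ((real j - real k) * x)) \<partial>FQ) =
      (\<Sum>j<n. \<Sum>k<n. a j k * (\<integral>x. f x * cos ((real j - real k) * x) \<partial>FQ))"
    unfolding e using i by (simp add: Bochner_Integration.integral_sum)
qed

lemma integrable_FQ_trig_sq: "integrable FQ f \<Longrightarrow> integrable FQ (\<lambda>x. f x * trig_sq n y x)"
  unfolding trig_sq_eq by (rule integrable_FQ_trig_sum)

lemma integrable_FQ_kern: "integrable FQ f \<Longrightarrow> integrable FQ (\<lambda>x. f x * kern n A x)"
  unfolding kern_eq by (rule integrable_FQ_trig_sum)

lemma qform_toeplitz:
  assumes "integrable FQ f"
  shows "qform n (toeplitz n f) y = (\<integral>x. f x * trig_sq n y x \<partial>FQ)"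
  unfolding trig_sq_eq integrable_FQ_trig_sum(2)[OF assms] qform_def
  using assms by (intro sum.cong refl) (simp add: toeplitz_index)

lemma frob_toeplitz:
  assumes "integrable FQ f"
  shows "frob n A (toeplitz n f) = (\<integral>x. f x * kern n A x \<partial>FQ)"
  unfolding kern_eq integrable_FQ_trig_sum(2)[OF assms] frob_def
  using assms by (intro sum.cong refl) (simp add: toeplitz_index)

lemma integral_trig_sq: "(\<integral>x. trig_sq n y x \<partial>FQ) = 2 * pi * (\<Sum>j<n. (y j)\<^sup>2)"
proof -
  have "(\<integral>x. trig_sq n y x \<partial>FQ) = (\<Sum>j<n. \<Sum>k<n. y j * y k * (if j = k then 2 * pi else 0))"
    using integrable_FQ_trig_sum(2)[OF integrable_FQ_const, of 1 "\<lambda>j k. y j * y k" n]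
    unfolding trig_sq_eq by (simp add: integral_FQ_cos)
  also have "\<dots> = (\<Sum>j<n. 2 * pi * (y j)\<^sup>2)"
    by (intro sum.cong refl) (simp add: if_distrib[of "\<lambda>u. _ * u"] power2_eq_square cong: if_cong)
  finally show ?thesis by (simp add: sum_distrib_left)
qed

text \<open>The form at \<open>y\<close> integrates \<open>trig_sq n y\<close> against
  \<open>f\<close>. If it vanished, the trigonometric polynomial would vanish almost everywhere, and
  Parseval's identity \<open>integral_trig_sq\<close> would make the coefficients zero.\<close>

lemma pos_def_toeplitz:
  assumes f: "integrable FQ f" and pos: "AE x in FQ. 0 < f x"
  shows "pos_def n (toeplitz n f)"
  unfolding pos_def_def
proof (intro conjI allI impI)
  fix i j assume "i < n" "j < n"
  moreover have "cos ((real i - real j) * x) = cos ((real j - real i) * x)" for x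
    by (metis cos_minus minus_diff_eq mult_minus_left)
  ultimately show "toeplitz n f $$ (i, j) = toeplitz n f $$ (j, i)"
    using f by (simp add: toeplitz_index)
next
  fix y :: "nat \<Rightarrow> real" assume y: "\<exists>i<n. y i \<noteq> 0"
  have nn: "AE x in FQ. 0 \<le> f x * trig_sq n y x"
    using pos by eventually_elim (simp add: trig_sq_nonneg)
  show "0 < qform n (toeplitz n f) y"
  proof (rule ccontr)
    assume "\<not> ?thesis"
    then have "(\<integral>x. f x * trig_sq n y x \<partial>FQ) = 0"
      unfolding qform_toeplitz[OF f] using integral_nonneg_AE[OF nn] by simp
    then have "AE x in FQ. f x * trig_sq n y x = 0"
      using integral_nonneg_eq_0_iff_AE[OF integrable_FQ_trig_sq[OF f] nn] by simp
    then have "AE x in FQ. trig_sq n y x = 0"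
      using pos by eventually_elim auto
    then have "(\<integral>x. trig_sq n y x \<partial>FQ) = 0" by (rule integral_eq_zero_AE)
    then have "(\<Sum>j<n. (y j)\<^sup>2) = 0" by (simp add: integral_trig_sq)
    then have "\<forall>j<n. y j = 0" by (subst (asm) sum_nonneg_eq_0_iff) auto
    with y show False by blast
  qed
qed simp

text \<open>Polarised Parseval identity: orthogonality of the cosines leaves only the terms with
  \<open>j = k\<close>.\<close>

lemma sum_mult_eq_integral:
  "2 * pi * (\<Sum>j<n. x j * y j) =
    (\<integral>u. (\<Sum>j<n. cosv u j * x j) * (\<Sum>j<n. cosv u j * y j) + (\<Sum>j<n. sinv u j * x j) * (\<Sum>j<n. sinv u j * y j) \<partial>FQ)"
proof -
  have "(\<Sum>j<n. cosv u j * x j) * (\<Sum>j<n. cosv u j * y j) + (\<Sum>j<n. sinv u j * x j) * (\<Sum>j<n. sinv u j * y j) =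
      1 * (\<Sum>j<n. \<Sum>k<n. (x j * y k) * cos ((real j - real k) * u))" for u
    unfolding cos_diff_nat by (simp add: sum_product sum.distrib[symmetric] algebra_simps)
  moreover have "(\<integral>u. 1 * (\<Sum>j<n. \<Sum>k<n. (x j * y k) * cos ((real j - real k) * u)) \<partial>FQ) =
      (\<Sum>j<n. \<Sum>k<n. x j * y k * (if j = k then 2 * pi else 0))"
    using integrable_FQ_trig_sum(2)[OF integrable_FQ_const, of 1 "\<lambda>j k. x j * y k" n] by (simp add: integral_FQ_cos)
  moreover have "(\<Sum>j<n. \<Sum>k<n. x j * y k * (if j = k then 2 * pi else 0)) = (\<Sum>j<n. 2 * pi * (x j * y j))"
    by (intro sum.cong refl) (simp add: if_distrib[of "\<lambda>u. _ * u"] cong: if_cong)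
  ultimately show ?thesis by (simp add: sum_distrib_left)
qed

text \<open>With \<open>y = T(g)\<^sup>-\<^sup>1 x\<close>, the inner product of \<open>x\<close> and \<open>y\<close> is both the left-hand quadratic form and an
  integral of the product of the two trigonometric polynomials, to which the
  inequality \<open>2ab \<le> c g a\<^sup>2 + b\<^sup>2 / (c g)\<close> with \<open>c = 2\<pi>\<close> is applied.\<close>

lemma qform_minv_toeplitz_le:
  assumes g: "integrable FQ g" "AE x in FQ. 0 < g x" "integrable FQ (\<lambda>x. 1 / g x)"
  shows "qform n (minv (toeplitz n g)) x \<le> qform n (toeplitz n (\<lambda>x. 1 / g x)) x / (4 * pi\<^sup>2)"
proof -
  note pd = pos_def_toeplitz[OF g(1,2), of n]
  define y where "y = mvec n (minv (toeplitz n g)) x"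
  define q where "q = qform n (minv (toeplitz n g)) x"
  have xy: "(\<Sum>i<n. x i * y i) = q" and yy: "qform n (toeplitz n g) y = q"
    unfolding y_def q_def by (rule qform_minv_mvec[OF pd])+
  define a where "a = (\<lambda>u. \<Sum>j<n. cosv u j * x j)"
  define b where "b = (\<lambda>u. \<Sum>j<n. cosv u j * y j)"
  define c where "c = (\<lambda>u. \<Sum>j<n. sinv u j * x j)"
  define d where "d = (\<lambda>u. \<Sum>j<n. sinv u j * y j)"
  have amgm: "a * b \<le> (2 * pi * g) * b\<^sup>2 / 2 + a\<^sup>2 / (2 * (2 * pi * g))" if "0 < g" for a b g :: real
  proof -
    have "0 \<le> ((2 * pi * g) * b - a)\<^sup>2 / (2 * (2 * pi * g))" using that by simp
    also have "\<dots> = (2 * pi * g) * b\<^sup>2 / 2 + a\<^sup>2 / (2 * (2 * pi * g)) - a * b"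
      using that by (simp add: power2_eq_square field_simps)
    finally show ?thesis by simp
  qed
  have ts: "trig_sq n x u = (a u)\<^sup>2 + (c u)\<^sup>2" "trig_sq n y u = (b u)\<^sup>2 + (d u)\<^sup>2" for u
    by (simp_all add: trig_sq_def a_def b_def c_def d_def)
  have "2 * pi * q = (\<integral>u. a u * b u + c u * d u \<partial>FQ)"
    using sum_mult_eq_integral[where x = x and y = y and n = n] unfolding xy a_def b_def c_def d_def .
  also have "\<dots> \<le> (\<integral>u. pi * (g u * trig_sq n y u) + (1 / (4 * pi)) * (1 / g u * trig_sq n x u) \<partial>FQ)"
  proof (rule integral_mono_AE)
    show "integrable FQ (\<lambda>u. a u * b u + c u * d u)"
      unfolding a_def b_def c_def d_def cosv_def sinv_def
      by (intro continuous_imp_integrable_real continuous_intros)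
    show "integrable FQ (\<lambda>u. pi * (g u * trig_sq n y u) + (1 / (4 * pi)) * (1 / g u * trig_sq n x u))"
      by (intro Bochner_Integration.integrable_add integrable_mult_right integrable_FQ_trig_sq g)
    show "AE u in FQ. a u * b u + c u * d u \<le> pi * (g u * trig_sq n y u) + (1 / (4 * pi)) * (1 / g u * trig_sq n x u)"
      using g(2)
    proof eventually_elim
      case (elim u)
      have "pi * (g u * trig_sq n y u) + (1 / (4 * pi)) * (1 / g u * trig_sq n x u) =
          ((2 * pi * g u) * (b u)\<^sup>2 / 2 + (a u)\<^sup>2 / (2 * (2 * pi * g u))) +
          ((2 * pi * g u) * (d u)\<^sup>2 / 2 + (c u)\<^sup>2 / (2 * (2 * pi * g u)))"
        unfolding ts using elim by (simp add: field_simps)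
      then show ?case using amgm[OF elim, of "a u" "b u"] amgm[OF elim, of "c u" "d u"] by linarith
    qed
  qed
  also have "\<dots> = pi * qform n (toeplitz n g) y + (1 / (4 * pi)) * qform n (toeplitz n (\<lambda>x. 1 / g x)) x"
    unfolding qform_toeplitz[OF g(1)] qform_toeplitz[OF g(3)]
    by (subst Bochner_Integration.integral_add[OF integrable_mult_right[OF integrable_FQ_trig_sq[OF g(1)]]
          integrable_mult_right[OF integrable_FQ_trig_sq[OF g(3)]]]) (simp only: integral_mult_right_zero)
  finally have "pi * q \<le> (1 / (4 * pi)) * qform n (toeplitz n (\<lambda>x. 1 / g x)) x" by (simp add: yy)
  then have "q \<le> (1 / (4 * pi)) * qform n (toeplitz n (\<lambda>x. 1 / g x)) x / pi"
    by (simp add: pos_le_divide_eq mult_ac)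
  then show ?thesis by (simp add: q_def power2_eq_square field_simps)
qed

text \<open>The preceding inequality is used at \<open>cosv x\<close> and \<open>sinv x\<close> for
  each frequency \<open>x\<close> and integrated against \<open>f\<close>. The upper bound no longer
  contains an inverse matrix, so Fourier analysis can evaluate it.\<close>

lemma frob_minv_toeplitz_le:
  assumes f: "integrable FQ f" "AE x in FQ. 0 \<le> f x"
    and g: "integrable FQ g" "AE x in FQ. 0 < g x" "integrable FQ (\<lambda>x. 1 / g x)"
  shows "frob n (minv (toeplitz n g)) (toeplitz n f) \<le>
    (\<integral>x. f x * kern n (toeplitz n (\<lambda>x. 1 / g x)) x \<partial>FQ) / (4 * pi\<^sup>2)"
proof -
  have "frob n (minv (toeplitz n g)) (toeplitz n f) = (\<integral>x. f x * kern n (minv (toeplitz n g)) x \<partial>FQ)"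
    by (rule frob_toeplitz[OF f(1)])
  also have "\<dots> \<le> (\<integral>x. (f x * kern n (toeplitz n (\<lambda>x. 1 / g x)) x) / (4 * pi\<^sup>2) \<partial>FQ)"
  proof (rule integral_mono_AE)
    show "AE x in FQ. f x * kern n (minv (toeplitz n g)) x \<le> (f x * kern n (toeplitz n (\<lambda>x. 1 / g x)) x) / (4 * pi\<^sup>2)"
      using f(2)
    proof eventually_elim
      case (elim x)
      have "kern n (minv (toeplitz n g)) x \<le> kern n (toeplitz n (\<lambda>x. 1 / g x)) x / (4 * pi\<^sup>2)"
        unfolding kern_def add_divide_distrib by (intro add_mono qform_minv_toeplitz_le g)
      from mult_left_mono[OF this elim] show ?case by simp
    qed
  qed (use integrable_FQ_kern[OF f(1)] in auto)
  finally show ?thesis by simp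
qed

lemma frob_toeplitz_mono:
  assumes "pos_def n A" "integrable FQ f" "integrable FQ g" "AE x in FQ. f x \<le> g x"
  shows "frob n A (toeplitz n f) \<le> frob n A (toeplitz n g)"
  unfolding frob_toeplitz[OF assms(2)] frob_toeplitz[OF assms(3)]
proof (rule integral_mono_AE)
  show "AE x in FQ. f x * kern n A x \<le> g x * kern n A x"
    using assms(4) by eventually_elim (intro mult_right_mono kern_nonneg assms(1))
qed (use integrable_FQ_kern assms in auto)

text \<open>The trace of \<open>minv (toeplitz n g)\<close> against the smaller matrix is at most
  its trace against \<open>toeplitz n g\<close>, which is \<open>n\<close>; so the exponential in
  \<open>det_le_exp_frob\<close> is at most 1.\<close>

lemma det_toeplitz_mono:
  assumes f: "integrable FQ f" "AE x in FQ. 0 < f x" and g: "integrable FQ g"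
    and fg: "AE x in FQ. f x \<le> g x"
  shows "mdet (toeplitz n f) \<le> mdet (toeplitz n g)"
proof -
  have gp: "AE x in FQ. 0 < g x" using f(2) fg by eventually_elim auto
  note pf = pos_def_toeplitz[OF f, of n] and pg = pos_def_toeplitz[OF g gp, of n]
  have "frob n (minv (toeplitz n g)) (toeplitz n f) \<le> real n"
    using frob_toeplitz_mono[OF pos_def_minv[OF pg] f(1) g fg] by (simp add: frob_minv_self[OF pg])
  then have "mdet (toeplitz n g) * exp (frob n (minv (toeplitz n g)) (toeplitz n f) - real n)
      \<le> mdet (toeplitz n g) * 1"
    using pos_def_det_pos[OF pg] by (intro mult_left_mono) auto
  then show ?thesis using det_le_exp_frob[OF pg pf] by simp
qed

text \<open>The largest eigenvalue of the Toeplitz matrix relative to \<open>A\<close> is at most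
  the sum of all of them. The proof is the Cauchy-Schwarz inequality at each frequency, integrated
  against \<open>w\<close>.\<close>

lemma qform_toeplitz_le_frob:
  assumes w: "integrable FQ w" "AE x in FQ. 0 \<le> w x" and A: "pos_def n A"
  shows "qform n (toeplitz n w) y \<le> frob n (minv A) (toeplitz n w) * qform n A y"
proof -
  have "qform n (toeplitz n w) y = (\<integral>x. w x * trig_sq n y x \<partial>FQ)" by (rule qform_toeplitz[OF w(1)])
  also have "\<dots> \<le> (\<integral>x. (w x * kern n (minv A) x) * qform n A y \<partial>FQ)"
  proof (rule integral_mono_AE)
    show "AE x in FQ. w x * trig_sq n y x \<le> (w x * kern n (minv A) x) * qform n A y"
      using w(2)
    proof eventually_elim
      case (elim x)
      have "trig_sq n y x \<le> kern n (minv A) x * qform n A y"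
        unfolding trig_sq_def kern_def distrib_right by (intro add_mono pos_def_cauchy_schwarz A)
      from mult_left_mono[OF this elim] show ?case by (simp add: mult.assoc)
    qed
  qed (use integrable_FQ_kern integrable_FQ_trig_sq w in auto)
  finally show ?thesis by (simp add: frob_toeplitz[OF w(1)])
qed

subsection \<open>Fejer means\<close>

text \<open>For positive \<open>n\<close> its integral over a period is \<open>2 * pi\<close>, not
  1; at \<open>n = 0\<close> division by zero makes it vanish.\<close>

definition fejer :: "nat \<Rightarrow> real \<Rightarrow> real" where
  "fejer n u = ((\<Sum>j<n. cosv u j)\<^sup>2 + (\<Sum>j<n. sinv u j)\<^sup>2) / real n"

lemma fejer_nonneg: "0 \<le> fejer n u"
  by (simp add: fejer_def)

lemma fejer_eq: "fejer n u = (\<Sum>j<n. \<Sum>k<n. cos ((real j - real k) * u)) / real n"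
  unfolding fejer_def cos_diff_nat by (simp add: power2_eq_square sum_product sum.distrib[symmetric])

lemma fejer_diff_eq:
  "fejer n (x - y) = (\<Sum>j<n. \<Sum>k<n. cos ((real j - real k) * x) * cos ((real j - real k) * y) +
     sin ((real j - real k) * x) * sin ((real j - real k) * y)) / real n"
proof -
  have "cos (a * (x - y)) = cos (a * x) * cos (a * y) + sin (a * x) * sin (a * y)" for a :: real
    by (simp add: right_diff_distrib cos_diff)
  then show ?thesis by (simp add: fejer_eq)
qed

text \<open>The kernel is the squared modulus of a geometric sum, divided by \<open>n\<close>: the
  numerator of that sum has modulus at most 2, and its denominator has squared modulus
  \<open>2 * (1 - cos u)\<close>.\<close>

lemma fejer_le:
  assumes "cos u < 1"
  shows "fejer n u \<le> 2 / (real n * (1 - cos u))"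
proof -
  have z: "cis u \<noteq> 1" using assms by (metis cis.sel(1) one_complex.sel(1) less_irrefl)
  have "(\<Sum>j<n. cosv u j)\<^sup>2 + (\<Sum>j<n. sinv u j)\<^sup>2 = (cmod (\<Sum>j<n. cis u ^ j))\<^sup>2"
    by (simp add: cmod_power2 Complex.DeMoivre cosv_def sinv_def)
  also have "(\<Sum>j<n. cis u ^ j) = (1 - cis u ^ n) / (1 - cis u)"
    using z by (simp add: sum_gp_strict)
  also have "(cmod \<dots>)\<^sup>2 \<le> 4 / (2 * (1 - cos u))"
  proof -
    have "(cmod (1 - cis u))\<^sup>2 = (1 - cos u)\<^sup>2 + (sin u)\<^sup>2" by (simp add: cmod_power2)
    also have "\<dots> = 2 * (1 - cos u)"
      using sin_cos_squared_add[of u] by (simp add: power2_eq_square algebra_simps)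
    finally have d: "(cmod (1 - cis u))\<^sup>2 = 2 * (1 - cos u)" .
    have "cmod (1 - cis u ^ n) \<le> cmod 1 + cmod (cis u ^ n)" by (rule norm_triangle_ineq4)
    then have "cmod (1 - cis u ^ n) \<le> 2" by (simp add: norm_power)
    then have "(cmod (1 - cis u ^ n))\<^sup>2 \<le> 2\<^sup>2" by (intro power_mono) auto
    then show ?thesis using assms by (simp add: norm_divide power_divide d divide_right_mono)
  qed
  finally have "(\<Sum>j<n. cosv u j)\<^sup>2 + (\<Sum>j<n. sinv u j)\<^sup>2 \<le> 2 / (1 - cos u)"
    using assms by (simp add: field_simps)
  from divide_right_mono[OF this, of "real n"] show ?thesis
    by (simp add: fejer_def mult.commute)
qed

text \<open>The Fejer means are kept as finite sums of products of one-dimensional integrals, so that no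
  product measure is needed.\<close>

lemma fejer_convolution:
  assumes r: "integrable FQ r"
  shows "integrable FQ (\<lambda>y. r y * fejer n (x - y))"
    "(\<integral>y. r y * fejer n (x - y) \<partial>FQ) = (\<Sum>j<n. \<Sum>k<n.
       cos ((real j - real k) * x) * (\<integral>y. r y * cos ((real j - real k) * y) \<partial>FQ) +
       sin ((real j - real k) * x) * (\<integral>y. r y * sin ((real j - real k) * y) \<partial>FQ)) / real n"
proof -
  have e: "r y * fejer n (x - y) = (\<Sum>j<n. \<Sum>k<n.
       cos ((real j - real k) * x) * (r y * cos ((real j - real k) * y)) +
       sin ((real j - real k) * x) * (r y * sin ((real j - real k) * y))) / real n" for y
    unfolding fejer_diff_eq by (simp add: sum_distrib_left algebra_simps)
  have i: "integrable FQ (\<lambda>y. c * (r y * cos (a * y)))" "integrable FQ (\<lambda>y. c * (r y * sin (a * y)))" for a c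
    using integrable_FQ_cos[OF r] integrable_FQ_sin[OF r] by auto
  show "integrable FQ (\<lambda>y. r y * fejer n (x - y))"
    unfolding e by (intro integrable_divide_zero Bochner_Integration.integrable_sum Bochner_Integration.integrable_add i)
  show "(\<integral>y. r y * fejer n (x - y) \<partial>FQ) = (\<Sum>j<n. \<Sum>k<n.
       cos ((real j - real k) * x) * (\<integral>y. r y * cos ((real j - real k) * y) \<partial>FQ) +
       sin ((real j - real k) * x) * (\<integral>y. r y * sin ((real j - real k) * y) \<partial>FQ)) / real n"
    unfolding e using i by (simp add: Bochner_Integration.integral_sum Bochner_Integration.integral_add)
qed

lemma integral_fejer:
  assumes "0 < n"
  shows "(\<integral>y. fejer n (x - y) \<partial>FQ) = 2 * pi"
proof -
  have "(\<integral>y. 1 * fejer n (x - y) \<partial>FQ) =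
      (\<Sum>j<n. \<Sum>k<n. cos ((real j - real k) * x) * (if j = k then 2 * pi else 0)) / real n"
    unfolding fejer_convolution(2)[OF integrable_FQ_const] by (simp add: integral_FQ_cos integral_FQ_sin)
  also have "\<dots> = (\<Sum>j<n. 2 * pi) / real n"
    by (intro arg_cong2[where f = "(/)"] sum.cong refl) (simp add: if_distrib[of "\<lambda>u. _ * u"] cong: if_cong)
  finally show ?thesis using assms by simp
qed

text \<open>Integration in \<open>x\<close> annihilates every frequency except those with
  \<open>j = k\<close>, and the \<open>n\<close> equal terms cancel the division by
  \<open>n\<close>.\<close>

lemma integral_fejer_convolution_const:
  assumes r: "integrable FQ r" and n: "0 < n"
  shows "integrable FQ (\<lambda>x. \<integral>y. r y * fejer n (x - y) \<partial>FQ)"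
    "(\<integral>x. (\<integral>y. r y * fejer n (x - y) \<partial>FQ) \<partial>FQ) = 2 * pi * integral\<^sup>L FQ r"
proof -
  let ?c = "\<lambda>j k. \<integral>y. r y * cos ((real j - real k) * y) \<partial>FQ"
  let ?s = "\<lambda>j k. \<integral>y. r y * sin ((real j - real k) * y) \<partial>FQ"
  have i: "integrable FQ (\<lambda>x. cos ((real j - real k) * x) * c)" "integrable FQ (\<lambda>x. sin ((real j - real k) * x) * c)" for j k c
    using integrable_FQ_cos[OF integrable_FQ_const[of 1], of "real j - real k"]
      integrable_FQ_sin[OF integrable_FQ_const[of 1], of "real j - real k"] by auto
  show "integrable FQ (\<lambda>x. \<integral>y. r y * fejer n (x - y) \<partial>FQ)"
    unfolding fejer_convolution(2)[OF r]
    by (intro integrable_divide_zero Bochner_Integration.integrable_sum Bochner_Integration.integrable_add i)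
  have "(\<integral>x. (\<integral>y. r y * fejer n (x - y) \<partial>FQ) \<partial>FQ) =
      (\<Sum>j<n. \<Sum>k<n. (if j = k then 2 * pi else 0) * ?c j k + 0 * ?s j k) / real n"
    unfolding fejer_convolution(2)[OF r] using i
    by (simp add: Bochner_Integration.integral_sum Bochner_Integration.integral_add integral_FQ_cos integral_FQ_sin)
  also have "\<dots> = (\<Sum>j<n. 2 * pi * integral\<^sup>L FQ r) / real n"
    by (intro arg_cong2[where f = "(/)"] sum.cong refl) (simp add: if_distrib[of "\<lambda>u. u * _"] cong: if_cong)
  finally show "(\<integral>x. (\<integral>y. r y * fejer n (x - y) \<partial>FQ) \<partial>FQ) = 2 * pi * integral\<^sup>L FQ r"
    using n by simp
qed

lemma integrable_mult_fejer_convolution: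
  assumes r: "integrable FQ r" and f: "integrable FQ f"
  shows "integrable FQ (\<lambda>x. f x * (\<integral>y. r y * fejer n (x - y) \<partial>FQ))"
proof -
  have e: "f x * (\<integral>y. r y * fejer n (x - y) \<partial>FQ) = (\<Sum>j<n. \<Sum>k<n.
       (f x * cos ((real j - real k) * x)) * (\<integral>y. r y * cos ((real j - real k) * y) \<partial>FQ) +
       (f x * sin ((real j - real k) * x)) * (\<integral>y. r y * sin ((real j - real k) * y) \<partial>FQ)) / real n" for x
    unfolding fejer_convolution(2)[OF r] by (simp add: sum_distrib_left algebra_simps)
  show ?thesis
    unfolding e by (intro integrable_divide_zero Bochner_Integration.integrable_sum
        Bochner_Integration.integrable_add integrable_mult_left integrable_FQ_cos integrable_FQ_sin f)
qed

text \<open>Since \<open>x\<close> is interior, \<open>x - y\<close> is shorter than a period and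
  \<open>cos (x - y) = 1\<close> only for \<open>y = x\<close>; compactness makes the gap
  uniform.\<close>

lemma cos_bound_away:
  assumes x: "x \<in> {-pi<..<pi}" and \<delta>: "0 < \<delta>"
  obtains \<kappa> where "0 < \<kappa>" "\<And>y. y \<in> freqs \<Longrightarrow> \<delta> \<le> \<bar>x - y\<bar> \<Longrightarrow> \<kappa> \<le> 1 - cos (x - y)"
proof -
  let ?S = "{y \<in> freqs. \<delta> \<le> \<bar>x - y\<bar>}"
  have lt: "cos (x - y) < 1" if "y \<in> ?S" for y
  proof -
    have "cos (x - y) \<noteq> 1"
    proof
      assume "cos (x - y) = 1"
      then obtain m :: int where m: "x - y = of_int m * 2 * pi" using cos_one_2pi_int by auto
      have "\<bar>x - y\<bar> < 2 * pi" using x that by auto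
      then have "\<bar>real_of_int m\<bar> * (2 * pi) < 1 * (2 * pi)" unfolding m by (simp add: abs_mult)
      then have "m = 0" by (subst (asm) mult_less_cancel_right) auto
      then show False using m that \<delta> by auto
    qed
    then show ?thesis using cos_le_one[of "x - y"] by linarith
  qed
  have "compact ?S"
  proof -
    have "?S = freqs \<inter> {y. \<delta> \<le> \<bar>x - y\<bar>}" by auto
    moreover have "closed {y. \<delta> \<le> \<bar>x - y\<bar>}" by (intro closed_Collect_le continuous_intros)
    ultimately show ?thesis by (simp add: compact_Int_closed)
  qed
  moreover have "continuous_on ?S (\<lambda>y. 1 - cos (x - y))" by (intro continuous_intros)
  ultimately show thesis
  proof (cases "?S = {}")
    case True
    then show thesis using that[of 1] by auto
  next
    case False
    then obtain y0 where y0: "y0 \<in> ?S" "\<forall>y\<in>?S. 1 - cos (x - y0) \<le> 1 - cos (x - y)"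
      using continuous_attains_inf[OF \<open>compact ?S\<close> False \<open>continuous_on ?S _\<close>] by blast
    then show thesis using that[of "1 - cos (x - y0)"] lt[OF y0(1)] by auto
  qed
qed

text \<open>The statement is one-sided because \<open>E\<close> may be unbounded near the origin.
  Close to \<open>x\<close> continuity gives \<open>E x - \<eta> \<le> E y\<close>; elsewhere
  \<open>E\<close> is nonnegative and the kernel is of order \<open>1 / n\<close>.\<close>

lemma fejer_liminf:
  fixes E :: "real \<Rightarrow> real"
  assumes x: "x \<in> {-pi<..<pi} - {0}" and E: "integrable FQ E" "\<And>y. y \<in> freqs - {0} \<Longrightarrow> 0 \<le> E y"
    and cont: "continuous_on (freqs - {0}) E" and e: "0 < e"
  shows "\<forall>\<^sub>F n in sequentially. 2 * pi * E x - e \<le> (\<integral>y. E y * fejer n (x - y) \<partial>FQ)"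
proof -
  \<comment> \<open>One half of \<open>e\<close> pays for \<open>2 * pi * \<eta>\<close>, the other
    half for the kernel tail \<open>2 * pi * c\<close>.\<close>
  define \<eta> where "\<eta> = e / (4 * pi)"
  have \<eta>: "0 < \<eta>" using e by (simp add: \<eta>_def)
  have xf: "x \<in> freqs - {0}" using x by auto
  then have Ex: "0 \<le> E x" by (rule E)
  obtain \<delta> where \<delta>: "0 < \<delta>" "\<And>y. y \<in> freqs - {0} \<Longrightarrow> \<bar>y - x\<bar> < \<delta> \<Longrightarrow> \<bar>E y - E x\<bar> < \<eta>"
    using cont xf \<eta> unfolding continuous_on_iff dist_real_def by metis
  obtain \<kappa> where \<kappa>: "0 < \<kappa>" "\<And>y. y \<in> freqs \<Longrightarrow> \<delta> \<le> \<bar>x - y\<bar> \<Longrightarrow> \<kappa> \<le> 1 - cos (x - y)"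
    using cos_bound_away[of x \<delta>] x \<delta>(1) by blast
  have "((\<lambda>n. 4 * pi * E x / \<kappa> * (1 / real n)) \<longlongrightarrow> 4 * pi * E x / \<kappa> * 0) sequentially"
    by (intro tendsto_mult tendsto_const lim_1_over_n)
  then have "\<forall>\<^sub>F n in sequentially. 4 * pi * E x / \<kappa> * (1 / real n) < e / 2"
    using e by (intro order_tendstoD) auto
  then show ?thesis
    using eventually_gt_at_top[of "0::nat"]
  proof eventually_elim
    case (elim n)
    define c where "c = E x * (2 / (real n * \<kappa>))"
    have low: "(E x - \<eta>) * fejer n (x - y) - c \<le> E y * fejer n (x - y)" if y: "y \<in> freqs - {0}" for y
    proof (cases "\<bar>y - x\<bar> < \<delta>")
      case True
      then have "E x - \<eta> \<le> E y" using \<delta>(2)[OF y] by fastforce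
      then have "(E x - \<eta>) * fejer n (x - y) \<le> E y * fejer n (x - y)"
        by (intro mult_right_mono fejer_nonneg)
      moreover have "0 \<le> c" using Ex \<kappa>(1) by (simp add: c_def)
      ultimately show ?thesis by linarith
    next
      case False
      then have k: "\<kappa> \<le> 1 - cos (x - y)" using \<kappa>(2)[of y] y by (auto simp: abs_minus_commute)
      then have "fejer n (x - y) \<le> 2 / (real n * (1 - cos (x - y)))" using \<kappa>(1) by (intro fejer_le) linarith
      also have "\<dots> \<le> 2 / (real n * \<kappa>)" using k \<kappa>(1) elim by (intro divide_left_mono mult_left_mono) auto
      finally have "E x * fejer n (x - y) \<le> c" unfolding c_def using Ex by (intro mult_left_mono)
      moreover have "0 \<le> \<eta> * fejer n (x - y)" using \<eta> fejer_nonneg by simp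
      moreover have "0 \<le> E y * fejer n (x - y)" using E(2)[OF y] fejer_nonneg by simp
      ultimately show ?thesis by (simp add: algebra_simps)
    qed
    have ik: "integrable FQ (\<lambda>y. (E x - \<eta>) * fejer n (x - y))"
      using fejer_convolution(1)[OF integrable_FQ_const] .
    have "(E x - \<eta>) * (2 * pi) - 2 * pi * c = (\<integral>y. (E x - \<eta>) * fejer n (x - y) - c \<partial>FQ)"
      using ik elim by (subst Bochner_Integration.integral_diff) (auto simp: integrable_FQ_const measure_FQ integral_fejer)
    also have "\<dots> \<le> (\<integral>y. E y * fejer n (x - y) \<partial>FQ)"
    proof (rule integral_mono_AE)
      show "integrable FQ (\<lambda>y. (E x - \<eta>) * fejer n (x - y) - c)"
        by (intro Bochner_Integration.integrable_diff ik integrable_FQ_const)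
      show "integrable FQ (\<lambda>y. E y * fejer n (x - y))" by (rule fejer_convolution(1)[OF E(1)])
      show "AE y in FQ. (E x - \<eta>) * fejer n (x - y) - c \<le> E y * fejer n (x - y)"
        using low by (rule AE_FQI)
    qed
    finally have "(E x - \<eta>) * (2 * pi) - 2 * pi * c \<le> (\<integral>y. E y * fejer n (x - y) \<partial>FQ)" .
    moreover have "2 * pi * c < e / 2" using elim by (simp add: c_def mult_ac)
    moreover have "\<eta> * (2 * pi) = e / 2" by (simp add: \<eta>_def)
    ultimately show ?case by (simp add: algebra_simps)
  qed
qed

text \<open>The double integral of \<open>f(x) r(y)\<close> against the Fejer kernel is bounded above by applying Fatou's
  lemma to the nonnegative function \<open>F(x) + R(y) - f(x) r(y)\<close>.\<close>

lemma fejer_limsup: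
  fixes f r F R :: "real \<Rightarrow> real"
  assumes int: "integrable FQ f" "integrable FQ r" "integrable FQ F" "integrable FQ R"
    and cont: "continuous_on (freqs - {0}) r" "continuous_on (freqs - {0}) R"
    and nonneg: "\<And>x. x \<in> freqs - {0} \<Longrightarrow> 0 \<le> f x" "\<And>x. x \<in> freqs - {0} \<Longrightarrow> 0 \<le> r x"
    and dom: "\<And>x y. x \<in> freqs - {0} \<Longrightarrow> y \<in> freqs - {0} \<Longrightarrow> f x * r y \<le> F x + R y"
    and e: "0 < e"
  shows "integrable FQ (\<lambda>x. f x * r x)"
    "\<forall>\<^sub>F n in sequentially. (\<integral>x. f x * (\<integral>y. r y * fejer n (x - y) \<partial>FQ) \<partial>FQ) \<le>
      2 * pi * (\<integral>x. f x * r x \<partial>FQ) + e"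
proof -
  show i: "integrable FQ (\<lambda>x. f x * r x)"
  proof (rule Bochner_Integration.integrable_bound)
    show "integrable FQ (\<lambda>x. F x + R x)" using int by simp
    show "AE x in FQ. norm (f x * r x) \<le> norm (F x + R x)"
      using nonneg dom by (intro AE_FQI) fastforce
  qed (use int in auto)
  define E where "E = (\<lambda>x y. F x + R y - f x * r y)"
  define g where "g = (\<lambda>n x. \<integral>y. E x y * fejer n (x - y) \<partial>FQ)"
  define J where "J = (\<lambda>n. \<integral>x. f x * (\<integral>y. r y * fejer n (x - y) \<partial>FQ) \<partial>FQ)"
  define S where "S = integral\<^sup>L FQ F + integral\<^sup>L FQ R"
  have Eint: "integrable FQ (E x)" for x
    unfolding E_def by (intro Bochner_Integration.integrable_add Bochner_Integration.integrable_diff integrable_mult_right int integrable_FQ_const)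
  have Enn: "0 \<le> E x y" if "x \<in> freqs - {0}" "y \<in> freqs - {0}" for x y
    using dom[OF that] by (simp add: E_def)
  have g_eq: "g n x = 2 * pi * F x + (\<integral>y. R y * fejer n (x - y) \<partial>FQ) - f x * (\<integral>y. r y * fejer n (x - y) \<partial>FQ)"
    if "0 < n" for n x
  proof -
    have "g n x = (\<integral>y. F x * fejer n (x - y) + R y * fejer n (x - y) - f x * (r y * fejer n (x - y)) \<partial>FQ)"
      by (simp add: g_def E_def algebra_simps)
    also have "\<dots> = F x * (2 * pi) + (\<integral>y. R y * fejer n (x - y) \<partial>FQ) - f x * (\<integral>y. r y * fejer n (x - y) \<partial>FQ)"
      using fejer_convolution(1)[OF integrable_FQ_const] fejer_convolution(1)[OF int(4)] fejer_convolution(1)[OF int(2)] that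
      by (simp add: integral_fejer)
    finally show ?thesis by simp
  qed
  have g_int: "integrable FQ (g n)" if "0 < n" for n
    unfolding g_eq[OF that, abs_def]
    by (intro Bochner_Integration.integrable_add Bochner_Integration.integrable_diff integrable_mult_right
        int integral_fejer_convolution_const(1) integrable_mult_fejer_convolution that)
  \<comment> \<open>\<open>F\<close> and \<open>R\<close> contribute the same amount for every
    \<open>n\<close>, so a lower bound on the integrals of \<open>g n\<close> is an upper bound on
    \<open>J n\<close>.\<close>
  have g_integral: "integral\<^sup>L FQ (g n) = 2 * pi * S - J n" if "0 < n" for n
    unfolding g_eq[OF that, abs_def] J_def S_def
    using int(3) integral_fejer_convolution_const[OF int(4) that] integrable_mult_fejer_convolution[OF int(2,1), of n]
    by (simp add: distrib_left)
  have g_nn: "0 \<le> g n x" if "x \<in> freqs - {0}" for n x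
    unfolding g_def using Enn[OF that] fejer_nonneg by (intro integral_nonneg_AE AE_FQI) auto
  have Eint2: "integrable FQ (\<lambda>x. E x x)"
    unfolding E_def using int i by auto
  have lim: "ennreal (2 * pi * E x x) \<le> liminf (\<lambda>n. ennreal (g n x))" if x: "x \<in> {-pi<..<pi} - {0}" for x
  proof (rule le_Liminf_iff[THEN iffD2], intro allI impI)
    fix c :: ennreal assume c: "c < ennreal (2 * pi * E x x)"
    then obtain c' where c': "c = ennreal c'" "0 \<le> c'" by (cases c) (auto simp: top_unique)
    then have lt: "c' < 2 * pi * E x x" using c by (simp add: ennreal_less_iff)
    have "\<forall>\<^sub>F n in sequentially. 2 * pi * E x x - (2 * pi * E x x - c') / 2 \<le> g n x"
      unfolding g_def
    proof (rule fejer_liminf[OF x Eint])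
      have "x \<in> freqs - {0}" using x by auto
      then show "\<And>y. y \<in> freqs - {0} \<Longrightarrow> 0 \<le> E x y" by (rule Enn)
      show "continuous_on (freqs - {0}) (E x)" unfolding E_def by (intro continuous_intros cont)
    qed (use lt in simp)
    then show "\<forall>\<^sub>F n in sequentially. c < ennreal (g n x)"
    proof eventually_elim
      case (elim n)
      have "c' < a - (a - c') / 2" if "c' < a" for a using that by (simp add: field_simps)
      from this[OF lt] elim have "c' < g n x" by (rule less_le_trans)
      then show ?case using c' by (simp add: ennreal_less_iff)
    qed
  qed
  have gmeas: "(\<lambda>x. ennreal (g n x)) \<in> borel_measurable FQ" for n
  proof (cases "n = 0")
    case True
    then have "g n = (\<lambda>x. 0)" by (simp add: g_def fejer_def fun_eq_iff)
    then show ?thesis by simp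
  qed (use g_int[of n] in auto)
  have Enn2: "AE x in FQ. 0 \<le> 2 * pi * E x x" using Enn by (intro AE_FQI) auto
  have "ennreal (2 * pi * (\<integral>x. E x x \<partial>FQ)) = (\<integral>\<^sup>+x. ennreal (2 * pi * E x x) \<partial>FQ)"
    using Eint2 Enn2 by (subst nn_integral_eq_integral) auto
  also have "\<dots> \<le> (\<integral>\<^sup>+x. liminf (\<lambda>n. ennreal (g n x)) \<partial>FQ)"
    using AE_FQ_punctured lim by (intro nn_integral_mono_AE) (auto elim: eventually_mono)
  also have "\<dots> \<le> liminf (\<lambda>n. \<integral>\<^sup>+x. ennreal (g n x) \<partial>FQ)"
    by (rule nn_integral_liminf) (rule gmeas)
  finally have fatou: "ennreal (2 * pi * (\<integral>x. E x x \<partial>FQ)) \<le> liminf (\<lambda>n. \<integral>\<^sup>+x. ennreal (g n x) \<partial>FQ)" .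
  have IE: "(\<integral>x. E x x \<partial>FQ) = S - (\<integral>x. f x * r x \<partial>FQ)"
    unfolding E_def S_def using int i by simp
  show "\<forall>\<^sub>F n in sequentially. J n \<le> 2 * pi * (\<integral>x. f x * r x \<partial>FQ) + e"
  proof -
    define c where "c = 2 * pi * (\<integral>x. E x x \<partial>FQ) - e"
    have "\<forall>\<^sub>F n in sequentially. c \<le> integral\<^sup>L FQ (g n)"
    \<comment> \<open>\<open>ennreal\<close> truncates a negative \<open>c\<close> to 0, so this
      case relies on nonnegativity of the integrals instead of Fatou's lemma.\<close>
    proof (cases "c < 0")
      case True
      have "\<And>n. 0 \<le> integral\<^sup>L FQ (g n)" using g_nn by (intro integral_nonneg_AE AE_FQI) auto
      with True show ?thesis by (intro always_eventually) (meson less_imp_le order_trans)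
    next
      case False
      then have "ennreal c < ennreal (2 * pi * (\<integral>x. E x x \<partial>FQ))" using e by (simp add: ennreal_less_iff c_def)
      then have "ennreal c < liminf (\<lambda>n. \<integral>\<^sup>+x. ennreal (g n x) \<partial>FQ)" using fatou by (rule less_le_trans)
      then have "\<forall>\<^sub>F n in sequentially. ennreal c < (\<integral>\<^sup>+x. ennreal (g n x) \<partial>FQ)"
        using le_Liminf_iff[THEN iffD1, OF order_refl] by blast
      then show ?thesis using eventually_gt_at_top[of "0::nat"]
      proof eventually_elim
        case (elim n)
        have "(\<integral>\<^sup>+x. ennreal (g n x) \<partial>FQ) = ennreal (integral\<^sup>L FQ (g n))"
          using g_int[of n] g_nn elim by (intro nn_integral_eq_integral AE_FQI) auto
        then show ?case using elim(1) False by (simp add: ennreal_less_iff)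
      qed
    qed
    then show ?thesis using eventually_gt_at_top[of "0::nat"]
    proof eventually_elim
      case (elim n)
      then show ?case using g_integral[of n] unfolding c_def IE by (simp add: right_diff_distrib)
    qed
  qed
qed

subsection \<open>Traces for power-type densities\<close>

lemma integrable_FQ_powr:
  fixes s :: real
  assumes "s < 1"
  shows "integrable FQ (\<lambda>x. \<bar>x\<bar> powr (- s))"
proof -
  have "(\<lambda>x. x powr (- s)) integrable_on {0..pi}"
    using has_integral_powr_from_0[of "- s" pi] assms by (auto simp: integrable_on_def)
  then have "(\<lambda>x. x powr (- s)) absolutely_integrable_on {0..pi}"
    by (rule nonnegative_absolutely_integrable_1) auto
  then have 1: "(\<lambda>x. \<bar>x\<bar> powr (- s)) absolutely_integrable_on {0..pi}"
    by (rule absolutely_integrable_spike[of _ _ "{}"]) auto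
  then have "(\<lambda>x. \<bar>- x\<bar> powr (- s)) absolutely_integrable_on {-pi..-0}"
    by (subst absolutely_integrable_reflect_real)
  then have 2: "(\<lambda>x. \<bar>x\<bar> powr (- s)) absolutely_integrable_on {-pi..0}" by simp
  have "{-pi..0} \<union> {0..pi} = freqs" by (rule ivl_disj_un_two_touch) auto
  with absolutely_integrable_Un[OF 2 1] have "(\<lambda>x. \<bar>x\<bar> powr (- s)) absolutely_integrable_on freqs" by simp
  then show ?thesis by (rule absolutely_integrable_imp_integrable) simp
qed

abbreviation pole :: "real \<Rightarrow> real \<Rightarrow> real" where
  "pole d x \<equiv> \<bar>x\<bar> powr (- 2 * d)"

text \<open>The common core of the two classes. It passes to reciprocals, with \<open>d\<close>
  negated, and to the auxiliary densities built for the tests.\<close>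

definition power_bounded :: "(real \<Rightarrow> real) \<Rightarrow> real \<Rightarrow> real \<Rightarrow> real \<Rightarrow> bool" where
  "power_bounded f d m M \<longleftrightarrow> - 1/2 < d \<and> d < 1/2 \<and> 0 < m \<and> continuous_on (freqs - {0}) f \<and>
     (\<forall>x\<in>freqs - {0}. f (- x) = f x) \<and>
     (\<forall>x\<in>freqs - {0}. m * pole d x \<le> f x \<and> f x \<le> M * pole d x)"

lemma power_bounded_pos:
  assumes "power_bounded f d m M" "x \<in> freqs - {0}"
  shows "0 < f x"
proof -
  have "0 < m * pole d x" using assms by (auto simp: power_bounded_def)
  then show ?thesis using assms unfolding power_bounded_def by (meson less_le_trans)
qed

lemma power_bounded_AE_pos: "power_bounded f d m M \<Longrightarrow> AE x in FQ. 0 < f x"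
  by (intro AE_FQI power_bounded_pos)

lemma power_bounded_upper_pos:
  assumes "power_bounded f d m M" shows "0 < M"
proof -
  have "0 < f pi" by (rule power_bounded_pos[OF assms]) auto
  also have "f pi \<le> M * pole d pi"
    using assms unfolding power_bounded_def by (metis DiffI atLeastAtMost_iff less_eq_real_def neg_le_iff_le
        neg_equal_zero pi_ge_zero pi_neq_zero singletonD order_trans minus_le_iff)
  finally show ?thesis by (simp add: zero_less_mult_iff)
qed

lemma power_bounded_integrable:
  assumes "power_bounded f d m M"
  shows "integrable FQ f"
proof (rule Bochner_Integration.integrable_bound)
  show "integrable FQ (\<lambda>x. M * \<bar>x\<bar> powr (- (2 * d)))"
    using assms by (intro integrable_mult_right integrable_FQ_powr) (auto simp: power_bounded_def)
  show "f \<in> borel_measurable FQ" using assms by (intro continuous_FQ_measurable) (simp add: power_bounded_def)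
  show "AE x in FQ. norm (f x) \<le> norm (M * \<bar>x\<bar> powr (- (2 * d)))"
  proof (rule AE_FQI)
    fix x assume x: "x \<in> freqs - {0}"
    then have "0 < f x" by (rule power_bounded_pos[OF assms])
    moreover have "f x \<le> M * \<bar>x\<bar> powr (- (2 * d))" using assms x by (auto simp: power_bounded_def)
    ultimately show "norm (f x) \<le> norm (M * \<bar>x\<bar> powr (- (2 * d)))" by simp
  qed
qed

lemma power_bounded_recip:
  assumes "power_bounded f d m M"
  shows "power_bounded (\<lambda>x. 1 / f x) (- d) (1 / M) (1 / m)"
proof -
  have m: "0 < m" "0 < M" using assms power_bounded_upper_pos by (auto simp: power_bounded_def)
  have "1 / M * \<bar>x\<bar> powr (- 2 * - d) \<le> 1 / f x \<and> 1 / f x \<le> 1 / m * \<bar>x\<bar> powr (- 2 * - d)"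
    if x: "x \<in> freqs - {0}" for x
  proof -
    have f: "0 < f x" by (rule power_bounded_pos[OF assms x])
    have p: "0 < pole d x" using x by auto
    have b: "m * pole d x \<le> f x" "f x \<le> M * pole d x"
      using assms x by (auto simp: power_bounded_def)
    have e: "\<bar>x\<bar> powr (- 2 * - d) = 1 / pole d x" by (simp add: powr_minus_divide)
    have "1 / (M * pole d x) \<le> 1 / f x" using f b(2) by (intro divide_left_mono) auto
    moreover have "1 / f x \<le> 1 / (m * pole d x)" using f b(1) m p by (intro divide_left_mono) auto
    ultimately show ?thesis unfolding e by simp
  qed
  moreover have "continuous_on (freqs - {0}) (\<lambda>x. 1 / f x)"
    using assms less_imp_neq[OF power_bounded_pos[OF assms], symmetric]
    by (intro continuous_intros ballI) (simp_all add: power_bounded_def)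
  ultimately show ?thesis using assms m by (auto simp: power_bounded_def)
qed

text \<open>For negative \<open>a\<close> the power has no pole and is at most \<open>pi\<close> on
  the interval; only genuine poles remain on the right.\<close>

lemma powr_le_pos_part:
  fixes x a :: real
  assumes "0 < \<bar>x\<bar>" "\<bar>x\<bar> \<le> pi" "- 1 < a" "a < 1"
  shows "\<bar>x\<bar> powr (- a) \<le> pi * \<bar>x\<bar> powr (- max a 0)"
proof (cases "0 \<le> a")
  case True
  then show ?thesis using pi_ge_two by (simp add: max_def mult_le_cancel_right1)
next
  case False
  then have "\<bar>x\<bar> powr (- a) \<le> pi powr (- a)" using assms by (intro powr_mono2) auto
  also have "\<dots> \<le> pi powr 1" using assms pi_ge_two by (intro powr_mono) auto
  finally show ?thesis using False assms by (simp add: max_def)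
qed

text \<open>Both factors are bounded by powers of the smaller of \<open>x\<close> and
  \<open>y\<close>. A product of two poles thus becomes a sum of the form \<open>F x + R y\<close>
  that \<open>fejer_limsup\<close> asks for.\<close>

lemma powr_mult_le_add:
  fixes x y a b :: real
  assumes "0 < x" "0 < y" "0 \<le> a" "0 \<le> b"
  shows "x powr (- a) * y powr (- b) \<le> x powr (- (a + b)) + y powr (- (a + b))"
proof (cases "x \<le> y")
  case True
  then have "x powr (- a) * y powr (- b) \<le> x powr (- a) * x powr (- b)"
    using assms by (intro mult_left_mono powr_mono2') auto
  also have "\<dots> = x powr (- (a + b))" by (simp add: powr_add[symmetric])
  finally show ?thesis by (simp add: add_increasing2)
next
  case False
  then have "x powr (- a) * y powr (- b) \<le> y powr (- a) * y powr (- b)"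
    using assms by (intro mult_right_mono powr_mono2') auto
  also have "\<dots> = y powr (- (a + b))" by (simp add: powr_add[symmetric])
  finally show ?thesis by (simp add: add_increasing)
qed

text \<open>Symmetry of \<open>r\<close> kills the sine coefficients, so the cosine sum is the whole
  Fejer mean.\<close>

lemma kern_toeplitz_fejer:
  assumes r: "integrable FQ r" and sym: "\<And>x. x \<in> freqs - {0} \<Longrightarrow> r (- x) = r x" and n: "0 < n"
  shows "kern n (toeplitz n r) x = real n * (\<integral>y. r y * fejer n (x - y) \<partial>FQ)"
proof -
  have s: "(\<integral>y. r y * sin (a * y) \<partial>FQ) = 0" for a
  proof (rule integral_FQ_odd)
    fix x :: real assume "x \<in> freqs"
    then show "r (- x) * sin (a * - x) = - (r x * sin (a * x))"
      using sym[of x] by (cases "x = 0") auto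
  qed
  have "kern n (toeplitz n r) x = (\<Sum>j<n. \<Sum>k<n. (\<integral>y. r y * cos ((real j - real k) * y) \<partial>FQ) * cos ((real j - real k) * x))"
    unfolding kern_eq using r by (intro sum.cong refl) (simp add: toeplitz_index)
  also have "\<dots> = real n * (\<integral>y. r y * fejer n (x - y) \<partial>FQ)"
    unfolding fejer_convolution(2)[OF r] s using n by (simp add: mult.commute)
  finally show ?thesis .
qed

lemma power_bounded_trace:
  assumes f: "power_bounded f d m M" and g: "power_bounded g e k K" and de: "\<bar>d - e\<bar> < 1/2"
  shows "integrable FQ (\<lambda>x. f x / g x)"
    "0 < \<epsilon> \<Longrightarrow> \<forall>\<^sub>F n in sequentially.
       frob n (minv (toeplitz n g)) (toeplitz n f) \<le> real n * ((\<integral>x. f x / g x \<partial>FQ) / (2 * pi) + \<epsilon>)"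
proof -
  define r where "r = (\<lambda>x. 1 / g x)"
  have r: "power_bounded r (- e) (1 / K) (1 / k)" unfolding r_def by (rule power_bounded_recip[OF g])
  \<comment> \<open>The total order of the poles of \<open>f x * r y\<close>. It is below 1: if both
    parts are positive it is \<open>2 * (d - e)\<close>, otherwise it is \<open>2 * d\<close>,
    \<open>- 2 * e\<close> or 0.\<close>
  define s where "s = max (2 * d) 0 + max (- 2 * e) 0"
  define F where "F = (\<lambda>x::real. M * pi * (1 / k * pi) * \<bar>x\<bar> powr (- s))"
  have s: "s < 1" using f g de unfolding s_def power_bounded_def max_def by auto
  have F: "integrable FQ F" unfolding F_def by (intro integrable_mult_right integrable_FQ_powr s)
  have M: "0 < M" "0 < k" using f g power_bounded_upper_pos by (auto simp: power_bounded_def)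
  have dom: "f x * r y \<le> F x + F y" if x: "x \<in> freqs - {0}" and y: "y \<in> freqs - {0}" for x y
  proof -
    have "f x \<le> M * \<bar>x\<bar> powr (- (2 * d))" using f x by (auto simp: power_bounded_def)
    also have "\<dots> \<le> M * (pi * \<bar>x\<bar> powr (- max (2 * d) 0))"
      using M x f by (intro mult_left_mono powr_le_pos_part) (auto simp: power_bounded_def)
    finally have 1: "f x \<le> M * pi * \<bar>x\<bar> powr (- max (2 * d) 0)" by (simp add: mult.assoc)
    have "r y \<le> 1 / k * \<bar>y\<bar> powr (- (- 2 * e))" using r y by (auto simp: power_bounded_def)
    also have "\<dots> \<le> 1 / k * (pi * \<bar>y\<bar> powr (- max (- 2 * e) 0))"
      using M y g by (intro mult_left_mono powr_le_pos_part) (auto simp: power_bounded_def)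
    finally have 2: "r y \<le> 1 / k * pi * \<bar>y\<bar> powr (- max (- 2 * e) 0)" by (simp add: mult.assoc)
    have "f x * r y \<le> (M * pi * \<bar>x\<bar> powr (- max (2 * d) 0)) * (1 / k * pi * \<bar>y\<bar> powr (- max (- 2 * e) 0))"
      using power_bounded_pos[OF r y] M by (intro mult_mono 1 2) auto
    also have "\<dots> = M * pi * (1 / k * pi) * (\<bar>x\<bar> powr (- max (2 * d) 0) * \<bar>y\<bar> powr (- max (- 2 * e) 0))"
      by (simp add: mult_ac)
    also have "\<dots> \<le> M * pi * (1 / k * pi) * (\<bar>x\<bar> powr (- s) + \<bar>y\<bar> powr (- s))"
      unfolding s_def using M x y by (intro mult_left_mono powr_mult_le_add) auto
    finally show ?thesis by (simp add: F_def distrib_left)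
  qed
  note fi = power_bounded_integrable[OF f] and ri = power_bounded_integrable[OF r]
    and gi = power_bounded_integrable[OF g]
  have contF: "continuous_on (freqs - {0}) F" unfolding F_def by (intro continuous_intros) auto
  have contr: "continuous_on (freqs - {0}) r" using r by (simp add: power_bounded_def)
  note lim = fejer_limsup[OF fi ri F F contr contF less_imp_le[OF power_bounded_pos[OF f]]
    less_imp_le[OF power_bounded_pos[OF r]] dom]
  show "integrable FQ (\<lambda>x. f x / g x)" using lim(1)[of 1] by (simp add: r_def)
  assume \<epsilon>: "0 < \<epsilon>"
  \<comment> \<open>The slack \<open>4 * pi\<^sup>2 * \<epsilon>\<close> becomes
    \<open>\<epsilon>\<close> after the division in \<open>frob_minv_toeplitz_le\<close>.\<close>
  have "\<forall>\<^sub>F n in sequentially. (\<integral>x. f x * (\<integral>y. r y * fejer n (x - y) \<partial>FQ) \<partial>FQ) \<le>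
      2 * pi * (\<integral>x. f x * r x \<partial>FQ) + 4 * pi\<^sup>2 * \<epsilon>"
    by (rule lim(2)) (use \<epsilon> in auto)
  then show "\<forall>\<^sub>F n in sequentially.
       frob n (minv (toeplitz n g)) (toeplitz n f) \<le> real n * ((\<integral>x. f x / g x \<partial>FQ) / (2 * pi) + \<epsilon>)"
    using eventually_gt_at_top[of "0::nat"]
  proof eventually_elim
    case (elim n)
    have rsym: "\<And>x. x \<in> freqs - {0} \<Longrightarrow> r (- x) = r x" using r by (simp add: power_bounded_def)
    have "frob n (minv (toeplitz n g)) (toeplitz n f) \<le> (\<integral>x. f x * kern n (toeplitz n r) x \<partial>FQ) / (4 * pi\<^sup>2)"
      unfolding r_def
    proof (rule frob_minv_toeplitz_le[OF fi _ gi power_bounded_AE_pos[OF g]])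
      show "AE x in FQ. 0 \<le> f x" using power_bounded_AE_pos[OF f] by eventually_elim simp
      show "integrable FQ (\<lambda>x. 1 / g x)" using ri by (simp add: r_def)
    qed
    also have "(\<integral>x. f x * kern n (toeplitz n r) x \<partial>FQ) = real n * (\<integral>x. f x * (\<integral>y. r y * fejer n (x - y) \<partial>FQ) \<partial>FQ)"
      using elim(2) by (subst kern_toeplitz_fejer[OF ri rsym]) (simp_all add: mult.left_commute)
    also have "\<dots> / (4 * pi\<^sup>2) \<le> real n * (2 * pi * (\<integral>x. f x * r x \<partial>FQ) + 4 * pi\<^sup>2 * \<epsilon>) / (4 * pi\<^sup>2)"
      using elim(1) by (intro divide_right_mono mult_left_mono) auto
    also have "\<dots> = real n * ((\<integral>x. f x / g x \<partial>FQ) / (2 * pi) + \<epsilon>)"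
      by (simp add: r_def power2_eq_square field_simps)
    finally show ?case .
  qed
qed

subsection \<open>Exponential tests\<close>

abbreviation obs_space :: "nat \<Rightarrow> (nat \<Rightarrow> real) measure" where
  "obs_space n \<equiv> (\<Pi>\<^sub>M i\<in>{..<n}. lborel)"

abbreviation lik_mass :: "nat \<Rightarrow> (real \<Rightarrow> real) \<Rightarrow> (nat \<Rightarrow> real) set \<Rightarrow> ennreal" where
  "lik_mass n f W \<equiv> (\<integral>\<^sup>+x\<in>W. lik n f x \<partial>obs_space n)"

text \<open>Exponential Markov inequality with the transform of \<open>lik_laplace\<close>. A
  positive \<open>c\<close> treats lower tails of the form and a negative \<open>c\<close> upper
  tails; \<open>D\<close> says that the determinant ratio is at least
  \<open>exp (- k)\<close>.\<close>

lemma chernoff: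
  assumes f: "pos_def n (toeplitz n f)" and B: "pos_def n B" and AB: "pos_def n (B + c \<cdot>\<^sub>m toeplitz n f)"
    and W: "\<And>x. x \<in> W \<Longrightarrow> c * qform n (minv B) x \<le> c * \<tau>"
    and D: "mdet B \<le> mdet (B + c \<cdot>\<^sub>m toeplitz n f) * exp k"
  shows "lik_mass n f W \<le> ennreal (exp (c * \<tau> / 2 + k / 2))"
proof -
  let ?D = "mdet (B + c \<cdot>\<^sub>m toeplitz n f) / mdet B"
  have d: "0 < ?D" using pos_def_det_pos[OF AB] pos_def_det_pos[OF B] by simp
  have "ennreal (lik n f x) * indicator W x \<le>
      ennreal (exp (c * \<tau> / 2)) * ennreal (lik n f x * exp (- c * qform n (minv B) x / 2))" for x
  proof (cases "x \<in> W")
    case True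
    have "1 \<le> exp (c * \<tau> / 2) * exp (- c * qform n (minv B) x / 2)"
      using W[OF True] by (simp add: exp_add[symmetric])
    then have "lik n f x * 1 \<le> lik n f x * (exp (c * \<tau> / 2) * exp (- c * qform n (minv B) x / 2))"
      using lik_pos[OF f, of x] by (intro mult_left_mono) auto
    then show ?thesis using True by (simp add: ennreal_mult'[symmetric] mult_ac ennreal_leI)
  qed simp
  then have "lik_mass n f W \<le>
      (\<integral>\<^sup>+x. ennreal (exp (c * \<tau> / 2)) * ennreal (lik n f x * exp (- c * qform n (minv B) x / 2)) \<partial>obs_space n)"
    by (intro nn_integral_mono)
  also have "\<dots> = ennreal (exp (c * \<tau> / 2)) * ennreal (?D powr (- 1 / 2))"
    unfolding lik_laplace[OF f B AB, symmetric] using lik_measurable[OF f] by (intro nn_integral_cmult) simp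
  also have "\<dots> \<le> ennreal (exp (c * \<tau> / 2)) * ennreal (exp (k / 2))"
  proof (intro mult_left_mono ennreal_leI)
    have "exp (- k) \<le> ?D"
      using D pos_def_det_pos[OF B] by (simp add: field_simps exp_minus)
    then have "?D powr (- 1 / 2) \<le> exp (- k) powr (- 1 / 2)" by (intro powr_mono2') auto
    also have "\<dots> = exp (k / 2)" by (simp add: powr_def)
    finally show "?D powr (- 1 / 2) \<le> exp (k / 2)" .
  qed simp
  finally show ?thesis by (simp add: ennreal_mult'[symmetric] exp_add)
qed

lemma det_le_det_exp:
  assumes "pos_def n A" "pos_def n B" "frob n (minv A) B \<le> real n + k"
  shows "mdet B \<le> mdet A * exp k"
proof -
  have "mdet B \<le> mdet A * exp (frob n (minv A) B - real n)"
    by (rule det_le_exp_frob[OF assms(1,2)])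
  also have "\<dots> \<le> mdet A * exp k"
    using assms(3) pos_def_det_pos[OF assms(1)] by (intro mult_left_mono) auto
  finally show ?thesis .
qed

lemma power_bounded_powr_mult:
  assumes "- 1/2 < d" "d < 1/2" "0 < a" "continuous_on (freqs - {0}) w"
    and "\<And>x. x \<in> freqs - {0} \<Longrightarrow> w (- x) = w x" "\<And>x. x \<in> freqs - {0} \<Longrightarrow> a \<le> w x \<and> w x \<le> b"
  shows "power_bounded (\<lambda>x. pole d x * w x) d a b"
  using assms unfolding power_bounded_def
  by (auto intro!: continuous_intros mult_right_mono simp: mult.commute[of "\<bar>_\<bar> powr _"])

text \<open>Lower spectral exponents put less energy at the low frequencies. The statistic is the quadratic form
  with the density \<open>g = u (1 + (x/\<eta>)\<^sup>2)\<close>, for which \<open>u/g\<close> is small while \<open>v/g\<close> is large on \<open>|x| \<le> \<eta>\<close>.\<close>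

lemma low_frequency_test:
  fixes a b d e :: real
  assumes ab: "0 < a" "0 < b" and de: "- 1/2 < d" "d < e" "e < 1/2" "e - d < 1/2"
  shows "\<exists>\<delta>>0. \<exists>W. (\<forall>n. W n \<in> sets (obs_space n)) \<and> (\<forall>\<^sub>F n in sequentially.
    (\<forall>f. integrable FQ f \<and> (\<forall>x\<in>freqs - {0}. 0 < f x \<and> f x \<le> a * pole d x) \<longrightarrow>
       lik_mass n f (W n) \<le> ennreal (exp (- real n * \<delta>))) \<and>
    (\<forall>f. integrable FQ f \<and> (\<forall>x\<in>freqs - {0}. b * pole e x \<le> f x) \<longrightarrow>
       lik_mass n f (- W n) \<le> ennreal (exp (- real n * \<delta>))))"
proof -
  \<comment> \<open>The power is chosen to make \<open>\<kappa>\<close> at most 1/100; the cap 1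
    keeps the band \<open>|x| \<le> \<eta>\<close> inside the frequency interval.\<close>
  define \<eta> where "\<eta> = min 1 ((100 * a / b) powr (- 1 / (2 * (e - d))))"
  have \<eta>: "0 < \<eta>" "\<eta> \<le> 1" using ab by (auto simp: \<eta>_def)
  have \<eta>pi: "\<eta> \<le> pi" using \<eta> pi_ge_two by linarith
  \<comment> \<open>The smallest factor with \<open>u x \<le> \<kappa> * v x\<close> on the whole
    band. It is also the Chernoff parameter for the second error.\<close>
  define \<kappa> where "\<kappa> = (a / b) * \<eta> powr (2 * (e - d))"
  have \<kappa>0: "0 < \<kappa>" using ab \<eta> by (simp add: \<kappa>_def)
  have \<kappa>1: "\<kappa> \<le> 1 / 100"
  proof -
    have "\<eta> powr (2 * (e - d)) \<le> ((100 * a / b) powr (- 1 / (2 * (e - d)))) powr (2 * (e - d))"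
      using de \<eta> by (intro powr_mono2) (auto simp: \<eta>_def)
    also have "\<dots> = (100 * a / b) powr (- 1 / (2 * (e - d)) * (2 * (e - d)))" by (rule powr_powr)
    also have "- 1 / (2 * (e - d)) * (2 * (e - d)) = - 1" using de by simp
    also have "(100 * a / b) powr (- 1) = inverse (100 * a / b)" using ab by (simp add: powr_minus)
    finally show ?thesis unfolding \<kappa>_def using ab by (simp add: field_simps)
  qed
  define \<beta> where "\<beta> = 1 + pi\<^sup>2 / \<eta>\<^sup>2"
  define u where "u = (\<lambda>x. pole d x * a)"
  define v where "v = (\<lambda>x. pole e x * b)"
  define g where "g = (\<lambda>x. pole d x * (a * (1 + x\<^sup>2 / \<eta>\<^sup>2)))"
  \<comment> \<open>\<open>g1\<close> is \<open>g - u / 2\<close> and \<open>g2\<close> is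
    \<open>g + \<kappa> * v\<close>. They are the extremal cases of \<open>g - f / 2\<close> for
    \<open>f \<le> u\<close> and of \<open>g + \<kappa> * f\<close> for \<open>v \<le> f\<close>,
    and \<open>det_toeplitz_mono\<close> puts their determinants into the Chernoff bounds.\<close>
  define g1 where "g1 = (\<lambda>x. pole d x * (a * (1 / 2 + x\<^sup>2 / \<eta>\<^sup>2)))"
  define g2 where "g2 = (\<lambda>x. g x + \<kappa> * v x)"
  have sq: "x\<^sup>2 / \<eta>\<^sup>2 \<le> pi\<^sup>2 / \<eta>\<^sup>2" if "x \<in> freqs - {0}" for x
    using that by (intro divide_right_mono) (auto simp: abs_le_square_iff[symmetric])
  have u: "power_bounded u d a a" and v: "power_bounded v e b b"
    unfolding u_def v_def using de ab by (intro power_bounded_powr_mult; force)+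
  have g: "power_bounded g d a (a * \<beta>)"
    unfolding g_def \<beta>_def using de ab sq \<eta> by (intro power_bounded_powr_mult) (auto intro!: continuous_intros)
  have g1: "power_bounded g1 d (a * (1 / 2)) (a * \<beta>)"
    unfolding g1_def \<beta>_def
  proof (intro power_bounded_powr_mult conjI mult_left_mono)
    show "1 / 2 + x\<^sup>2 / \<eta>\<^sup>2 \<le> 1 + pi\<^sup>2 / \<eta>\<^sup>2" if "x \<in> freqs - {0}" for x
      using sq[OF that] by simp
  qed (use de ab \<eta> in \<open>auto intro!: continuous_intros\<close>)
  have gpos: "0 < g x" "0 < v x" "0 < u x" if "x \<in> freqs - {0}" for x
    using power_bounded_pos[OF g that] power_bounded_pos[OF v that] power_bounded_pos[OF u that] by auto
  have g2: "power_bounded g2 e (\<kappa> * b) (a * \<beta> * pi powr (2 * (e - d)) + \<kappa> * b)"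
    unfolding power_bounded_def
  proof (intro conjI ballI)
    show "continuous_on (freqs - {0}) g2"
      unfolding g2_def using g v by (intro continuous_intros) (auto simp: power_bounded_def)
    fix x assume x: "x \<in> freqs - {0}"
    show "g2 (- x) = g2 x" using g v x by (simp add: g2_def power_bounded_def)
    have "\<bar>x\<bar> powr (2 * (e - d)) \<le> pi powr (2 * (e - d))" using x de by (intro powr_mono2) auto
    then have "pole e x * \<bar>x\<bar> powr (2 * (e - d)) \<le> pole e x * pi powr (2 * (e - d))"
      by (intro mult_left_mono) auto
    then have "pole d x \<le> pole e x * pi powr (2 * (e - d))"
      by (simp add: powr_add[symmetric] algebra_simps)
    then have "a * \<beta> * pole d x \<le> a * \<beta> * (pole e x * pi powr (2 * (e - d)))"
      using ab by (intro mult_left_mono) (auto simp: \<beta>_def)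
    moreover have "g x \<le> a * \<beta> * pole d x" using g x by (auto simp: power_bounded_def)
    ultimately show "g2 x \<le> (a * \<beta> * pi powr (2 * (e - d)) + \<kappa> * b) * pole e x"
      by (simp add: g2_def v_def algebra_simps)
    show "\<kappa> * b * pole e x \<le> g2 x"
      using gpos(1)[OF x] by (simp add: g2_def v_def mult_ac)
  qed (use de \<kappa>0 ab in auto)
  note gi = power_bounded_integrable[OF g] and g1i = power_bounded_integrable[OF g1]
    and g2i = power_bounded_integrable[OF g2]
  \<comment> \<open>With parameter -1/2 the first error has exponent \<open>- \<tau> / 4\<close>
    plus \<open>0.26 * \<eta> * n\<close>. With parameter \<open>\<kappa>\<close> the second has
    exponent \<open>\<kappa> * \<tau> / 2\<close>, at most \<open>\<eta> * n / 50\<close>, minus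
    \<open>\<eta> * n / 25\<close>. Both are at most \<open>- \<eta> * n / 50\<close>.\<close>
  define \<tau> where "\<tau> = (\<lambda>n. 4 * \<eta> * real n)"
  define W where "W = (\<lambda>n. {x \<in> space (obs_space n). \<tau> n < qform n (minv (toeplitz n g)) x})"
  have Wm: "W n \<in> sets (obs_space n)" for n unfolding W_def by measurable

  \<comment> \<open>The excess over \<open>2 * pi\<close> is only of order \<open>\<eta>\<close>,
    because the growing factor in \<open>g\<close> makes \<open>u\<close> negligible off the band;
    the remaining bump has integral at most \<open>pi * \<eta>\<close> by its arctangent
    primitive.\<close>
  have I1: "(\<integral>x. g x / g1 x \<partial>FQ) \<le> 2 * pi + pi * \<eta>"
  proof -
    have k: "integrable FQ (\<lambda>x. inverse (1 + (x / \<eta>)\<^sup>2))"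
      by (intro continuous_imp_integrable_real continuous_intros) (use \<eta> in \<open>auto simp: add_nonneg_eq_0_iff\<close>)
    have "(\<integral>x. g x / g1 x \<partial>FQ) \<le> (\<integral>x. 1 + inverse (1 + (x / \<eta>)\<^sup>2) \<partial>FQ)"
    proof (rule integral_mono_AE)
      show "integrable FQ (\<lambda>x. g x / g1 x)" by (rule power_bounded_trace(1)[OF g g1]) simp
      show "AE x in FQ. g x / g1 x \<le> 1 + inverse (1 + (x / \<eta>)\<^sup>2)"
      proof (rule AE_FQI)
        fix x assume x: "x \<in> freqs - {0}"
        define y where "y = x\<^sup>2 / \<eta>\<^sup>2"
        have y: "0 \<le> y" by (simp add: y_def)
        have "g x / g1 x = (1 + y) / (1 / 2 + y)" using x ab by (simp add: g_def g1_def y_def)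
        also have "\<dots> \<le> 1 + inverse (1 + y)" using y by (simp add: field_simps)
        finally show "g x / g1 x \<le> 1 + inverse (1 + (x / \<eta>)\<^sup>2)" by (simp add: y_def power_divide)
      qed
    qed (intro Bochner_Integration.integrable_add integrable_FQ_const k)
    also have "\<dots> = 2 * pi + (\<integral>x. inverse (1 + (x / \<eta>)\<^sup>2) \<partial>FQ)"
      using k by (simp add: integrable_FQ_const measure_FQ)
    also have "(\<integral>x. inverse (1 + (x / \<eta>)\<^sup>2) \<partial>FQ) = \<eta> * arctan (pi / \<eta>) - \<eta> * arctan (- pi / \<eta>)"
      using \<eta> by (intro integral_FQ_FTC[where F = "\<lambda>x. \<eta> * arctan (x / \<eta>)"] continuous_intros)
        (auto intro!: derivative_eq_intros simp: add_nonneg_eq_0_iff)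
    also have "\<eta> * arctan (pi / \<eta>) - \<eta> * arctan (- pi / \<eta>) \<le> \<eta> * (pi / 2) - \<eta> * (- (pi / 2))"
      using \<eta> arctan_bounded[of "pi / \<eta>"] arctan_bounded[of "- pi / \<eta>"]
      by (intro diff_mono mult_left_mono) auto
    finally show ?thesis by (simp add: algebra_simps)
  qed

  \<comment> \<open>On the band \<open>g \<le> 2 * u \<le> 2 * \<kappa> * v\<close>, so the ratio is
    at most 2/3; elsewhere it is at most 1. The saving is a third of the length
    \<open>2 * \<eta>\<close>.\<close>
  have I2: "(\<integral>x. g x / g2 x \<partial>FQ) \<le> 2 * pi - 2 * \<eta> / 3"
  proof -
    have "{-\<eta>..\<eta>} \<in> sets FQ" using \<eta> \<eta>pi by (subst sets_restrict_space_iff) auto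
    then have k: "integrable FQ (\<lambda>x. (1 / 3) * indicator {-\<eta>..\<eta>} x :: real)"
      by (intro integrable_mult_right) (auto intro!: finite_measure.integrable_const_bound[OF finite_measure_FQ, where B = 1])
    have "(\<integral>x. g x / g2 x \<partial>FQ) \<le> (\<integral>x. 1 - (1 / 3) * indicator {-\<eta>..\<eta>} x \<partial>FQ)"
    proof (rule integral_mono_AE)
      show "integrable FQ (\<lambda>x. g x / g2 x)" by (rule power_bounded_trace(1)[OF g g2]) (use de in simp)
      show "AE x in FQ. g x / g2 x \<le> 1 - (1 / 3) * indicator {-\<eta>..\<eta>} x"
      proof (rule AE_FQI)
        fix x assume x: "x \<in> freqs - {0}"
        show "g x / g2 x \<le> 1 - (1 / 3) * indicator {-\<eta>..\<eta>} x"
        proof (cases "x \<in> {-\<eta>..\<eta>}")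
          case True
          then have "x\<^sup>2 / \<eta>\<^sup>2 \<le> 1" using \<eta> by (auto simp: abs_le_square_iff[symmetric])
          then have "pole d x * (a * (1 + x\<^sup>2 / \<eta>\<^sup>2)) \<le> pole d x * (a * 2)"
            using ab by (intro mult_left_mono) auto
          then have "g x \<le> 2 * u x" by (simp add: g_def u_def)
          moreover have "u x \<le> \<kappa> * v x"
          proof -
            have "\<bar>x\<bar> powr (2 * (e - d)) \<le> \<eta> powr (2 * (e - d))" using True de by (intro powr_mono2) auto
            then have "pole e x * \<bar>x\<bar> powr (2 * (e - d)) \<le> pole e x * \<eta> powr (2 * (e - d))"
              by (intro mult_left_mono) auto
            then have "pole d x \<le> pole e x * \<eta> powr (2 * (e - d))"
              by (simp add: powr_add[symmetric] algebra_simps)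
            then have "a * pole d x \<le> a * (pole e x * \<eta> powr (2 * (e - d)))"
              using ab by (intro mult_left_mono) auto
            then show ?thesis using ab by (simp add: u_def v_def \<kappa>_def mult_ac)
          qed
          ultimately have "3 * g x \<le> 2 * (g x + \<kappa> * v x)" by simp
          then show ?thesis using True gpos[OF x] \<kappa>0 by (simp add: g2_def field_simps add_pos_pos)
        next
          case False
          moreover have "0 < g x + \<kappa> * v x" using gpos[OF x] \<kappa>0 by (intro add_pos_pos mult_pos_pos)
          moreover have "0 < \<kappa> * v x" using gpos[OF x] \<kappa>0 by (intro mult_pos_pos)
          ultimately show ?thesis by (simp add: g2_def)
        qed
      qed
    qed (intro Bochner_Integration.integrable_diff integrable_FQ_const k)
    also have "\<dots> = 2 * pi - (1 / 3) * measure FQ {-\<eta>..\<eta>}"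
      using k \<eta> \<eta>pi by (simp add: integrable_FQ_const measure_FQ Int_absorb2)
    also have "measure FQ {-\<eta>..\<eta>} = 2 * \<eta>"
      using \<eta> \<eta>pi by (simp add: measure_restrict_space)
    finally show ?thesis by simp
  qed

  define \<epsilon> where "\<epsilon> = \<eta> / 50"
  have "0 < \<epsilon>" using \<eta> by (simp add: \<epsilon>_def)
  note t1 = power_bounded_trace(2)[OF g g1 _ \<open>0 < \<epsilon>\<close>] and t2 = power_bounded_trace(2)[OF g g2 _ \<open>0 < \<epsilon>\<close>]
  have ev: "\<forall>\<^sub>F n in sequentially.
    (\<forall>f. integrable FQ f \<and> (\<forall>x\<in>freqs - {0}. 0 < f x \<and> f x \<le> a * pole d x) \<longrightarrow>
       lik_mass n f (W n) \<le> ennreal (exp (- real n * (\<eta> / 50)))) \<and>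
    (\<forall>f. integrable FQ f \<and> (\<forall>x\<in>freqs - {0}. b * pole e x \<le> f x) \<longrightarrow>
       lik_mass n f (- W n) \<le> ennreal (exp (- real n * (\<eta> / 50))))"
  proof -
    have "\<forall>\<^sub>F n in sequentially. frob n (minv (toeplitz n g1)) (toeplitz n g) \<le> real n * ((\<integral>x. g x / g1 x \<partial>FQ) / (2 * pi) + \<epsilon>)"
      by (rule t1) simp
    moreover have "\<forall>\<^sub>F n in sequentially. frob n (minv (toeplitz n g2)) (toeplitz n g) \<le> real n * ((\<integral>x. g x / g2 x \<partial>FQ) / (2 * pi) + \<epsilon>)"
      by (rule t2) (use de in simp)
    ultimately show ?thesis
    proof eventually_elim
      case (elim n)
      note pg = pos_def_toeplitz[OF gi power_bounded_AE_pos[OF g], of n]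
        and pg1 = pos_def_toeplitz[OF g1i power_bounded_AE_pos[OF g1], of n]
        and pg2 = pos_def_toeplitz[OF g2i power_bounded_AE_pos[OF g2], of n]
      have "real n * ((\<integral>x. g x / g1 x \<partial>FQ) / (2 * pi) + \<epsilon>) \<le> real n * ((2 * pi + pi * \<eta>) / (2 * pi) + \<epsilon>)"
        using I1 by (intro mult_left_mono add_right_mono divide_right_mono) auto
      also have "\<dots> = real n + real n * (\<eta> / 2 + \<eta> / 50)" by (simp add: \<epsilon>_def field_simps)
      finally have D1: "mdet (toeplitz n g) \<le> mdet (toeplitz n g1) * exp (real n * (\<eta> / 2 + \<eta> / 50))"
        using elim(1) by (intro det_le_det_exp[OF pg1 pg]) linarith
      \<comment> \<open>The saving \<open>2 * \<eta> / (6 * pi)\<close> is at least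
        \<open>\<eta> / 10\<close>; subtracting the trace error \<open>\<epsilon>\<close> leaves the
        \<open>2 * \<eta> / 25\<close> of \<open>D2\<close>.\<close>
      have "1 / 20 \<le> 1 / (6 * pi)" using pi_less_4 pi_approx by (simp add: field_simps)
      have "real n * ((\<integral>x. g x / g2 x \<partial>FQ) / (2 * pi) + \<epsilon>) \<le> real n * ((2 * pi - 2 * \<eta> / 3) / (2 * pi) + \<epsilon>)"
        using I2 by (intro mult_left_mono add_right_mono divide_right_mono) auto
      also have "\<dots> = real n + real n * (\<epsilon> - 2 * \<eta> * (1 / (6 * pi)))" by (simp add: field_simps)
      also have "\<dots> \<le> real n + real n * (\<epsilon> - 2 * \<eta> * (1 / 20))"
        using \<open>1 / 20 \<le> 1 / (6 * pi)\<close> \<eta> by (intro add_left_mono mult_left_mono diff_left_mono) auto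
      finally have D2: "mdet (toeplitz n g) \<le> mdet (toeplitz n g2) * exp (real n * (- 2 * \<eta> / 25))"
        using elim(2) by (intro det_le_det_exp[OF pg2 pg]) (simp add: \<epsilon>_def algebra_simps)
      have 1: "lik_mass n f (W n) \<le> ennreal (exp (- real n * (\<eta> / 50)))"
        if f: "integrable FQ f" "\<And>x. x \<in> freqs - {0} \<Longrightarrow> 0 < f x \<and> f x \<le> a * pole d x" for f
      proof -
        have fp: "AE x in FQ. 0 < f x" by (rule AE_FQI) (use f in auto)
        have T: "toeplitz n (\<lambda>x. g x + - (1 / 2) * f x) = toeplitz n g + - (1 / 2) \<cdot>\<^sub>m toeplitz n f"
          by (rule toeplitz_add_smult[OF gi f(1)])
        have ge: "g1 x \<le> g x + - (1 / 2) * f x" if "x \<in> freqs - {0}" for x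
          using f(2)[OF that] by (simp add: g1_def g_def algebra_simps)
        have hi: "integrable FQ (\<lambda>x. g x + - (1 / 2) * f x)"
          by (intro Bochner_Integration.integrable_add gi integrable_mult_right f)
        have hp: "AE x in FQ. 0 < g x + - (1 / 2) * f x"
          by (rule AE_FQI) (use ge power_bounded_pos[OF g1] in fastforce)
        have "mdet (toeplitz n g1) \<le> mdet (toeplitz n g + - (1 / 2) \<cdot>\<^sub>m toeplitz n f)"
          unfolding T[symmetric] by (intro det_toeplitz_mono g1i power_bounded_AE_pos[OF g1] hi AE_FQI ge)
        then have "mdet (toeplitz n g) \<le>
            mdet (toeplitz n g + - (1 / 2) \<cdot>\<^sub>m toeplitz n f) * exp (real n * (\<eta> / 2 + \<eta> / 50))"
          using D1 by (meson exp_ge_zero mult_right_mono order_trans)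
        then have "lik_mass n f (W n) \<le>
            ennreal (exp (- (1 / 2) * \<tau> n / 2 + real n * (\<eta> / 2 + \<eta> / 50) / 2))"
        proof (rule chernoff[OF pos_def_toeplitz[OF f(1) fp] pg, rotated 2])
          show "pos_def n (toeplitz n g + - (1 / 2) \<cdot>\<^sub>m toeplitz n f)"
            unfolding T[symmetric] by (rule pos_def_toeplitz[OF hi hp])
        qed (auto simp: W_def)
        also have "\<dots> \<le> ennreal (exp (- real n * (\<eta> / 50)))"
        proof (intro ennreal_leI, subst exp_le_cancel_iff)
          have "0 \<le> real n * \<eta>" using \<eta> by simp
          then show "- (1 / 2) * \<tau> n / 2 + real n * (\<eta> / 2 + \<eta> / 50) / 2 \<le> - real n * (\<eta> / 50)"
            by (simp add: \<tau>_def algebra_simps)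
        qed
        finally show ?thesis .
      qed
      have 2: "lik_mass n f (- W n) \<le> ennreal (exp (- real n * (\<eta> / 50)))"
        if f: "integrable FQ f" "\<And>x. x \<in> freqs - {0} \<Longrightarrow> b * pole e x \<le> f x" for f
      proof -
        have ge: "v x \<le> f x" if "x \<in> freqs - {0}" for x using f(2)[OF that] by (simp add: v_def mult.commute)
        have fp: "AE x in FQ. 0 < f x" by (rule AE_FQI) (use ge gpos(2) in fastforce)
        have T: "toeplitz n (\<lambda>x. g x + \<kappa> * f x) = toeplitz n g + \<kappa> \<cdot>\<^sub>m toeplitz n f"
          by (rule toeplitz_add_smult[OF gi f(1)])
        have hi: "integrable FQ (\<lambda>x. g x + \<kappa> * f x)"
          by (intro Bochner_Integration.integrable_add gi integrable_mult_right f)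
        have ge2: "g2 x \<le> g x + \<kappa> * f x" if "x \<in> freqs - {0}" for x
          using ge[OF that] \<kappa>0 by (simp add: g2_def)
        have hp: "AE x in FQ. 0 < g x + \<kappa> * f x"
          by (rule AE_FQI) (use ge2 power_bounded_pos[OF g2] in fastforce)
        have "mdet (toeplitz n g2) \<le> mdet (toeplitz n g + \<kappa> \<cdot>\<^sub>m toeplitz n f)"
          unfolding T[symmetric] by (intro det_toeplitz_mono g2i power_bounded_AE_pos[OF g2] hi AE_FQI ge2)
        then have "mdet (toeplitz n g) \<le>
            mdet (toeplitz n g + \<kappa> \<cdot>\<^sub>m toeplitz n f) * exp (real n * (- 2 * \<eta> / 25))"
          using D2 by (meson exp_ge_zero mult_right_mono order_trans)
        then have "lik_mass n f (space (obs_space n) - W n) \<le>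
            ennreal (exp (\<kappa> * \<tau> n / 2 + real n * (- 2 * \<eta> / 25) / 2))"
        proof (rule chernoff[OF pos_def_toeplitz[OF f(1) fp] pg, rotated 2])
          show "pos_def n (toeplitz n g + \<kappa> \<cdot>\<^sub>m toeplitz n f)"
            unfolding T[symmetric] by (rule pos_def_toeplitz[OF hi hp])
        qed (use \<kappa>0 in \<open>auto simp: W_def\<close>)
        also have "lik_mass n f (space (obs_space n) - W n) =
            lik_mass n f (- W n)"
          by (intro nn_integral_cong) (auto simp: indicator_def)
        also have "ennreal (exp (\<kappa> * \<tau> n / 2 + real n * (- 2 * \<eta> / 25) / 2)) \<le> ennreal (exp (- real n * (\<eta> / 50)))"
        proof (intro ennreal_leI, subst exp_le_cancel_iff)
          have "\<kappa> * (\<eta> * real n) \<le> (1 / 100) * (\<eta> * real n)" using \<kappa>1 \<eta> by (intro mult_right_mono) auto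
          then show "\<kappa> * \<tau> n / 2 + real n * (- 2 * \<eta> / 25) / 2 \<le> - real n * (\<eta> / 50)"
            by (simp add: \<tau>_def algebra_simps)
        qed
        finally show ?thesis .
      qed
      show ?case using 1 2 by blast
    qed
  qed
  show ?thesis
    by (rule exI[of _ "\<eta> / 50"], intro conjI exI[of _ W] allI Wm ev) (use \<eta> in simp)
qed

subsection \<open>Likelihood ratios\<close>

lemma frob_add_smult:
  assumes "B \<in> carrier_mat n n" "C \<in> carrier_mat n n"
  shows "frob n A (B + c \<cdot>\<^sub>m C) = frob n A B + c * frob n A C"
  using assms by (simp add: frob_def sum.distrib algebra_simps sum_distrib_left)

text \<open>The perturbation retains at least the fraction \<open>1 - \<theta>\<close> of the form
  of \<open>A\<close>, and inversion reverses this comparison.\<close>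

lemma pos_def_add_smult:
  assumes A: "pos_def n A" and B: "pos_def n B" and \<theta>: "\<theta> < 1"
    and le: "\<And>y. - c * qform n B y \<le> \<theta> * qform n A y"
  shows "pos_def n (A + c \<cdot>\<^sub>m B)"
    "(1 - \<theta>) * qform n (minv (A + c \<cdot>\<^sub>m B)) x \<le> qform n (minv A) x"
proof -
  have car: "A \<in> carrier_mat n n" "B \<in> carrier_mat n n" using A B by (auto simp: pos_def_def)
  have le2: "(1 - \<theta>) * qform n A y \<le> qform n (A + c \<cdot>\<^sub>m B) y" for y
    using le[of y] unfolding qform_add_smult[OF car] by (simp add: algebra_simps)
  have "0 < qform n (A + c \<cdot>\<^sub>m B) y" if "\<exists>i<n. y i \<noteq> 0" for y
  proof -
    have "0 < (1 - \<theta>) * qform n A y" using A that \<theta> by (auto simp: pos_def_def)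
    then show ?thesis using le2[of y] by linarith
  qed
  then show pd: "pos_def n (A + c \<cdot>\<^sub>m B)" using A B by (auto simp: pos_def_def)
  show "(1 - \<theta>) * qform n (minv (A + c \<cdot>\<^sub>m B)) x \<le> qform n (minv A) x"
    by (rule qform_minv_antimono[OF A pd _ le2]) (use \<theta> in simp)
qed

lemma power_bounded_square_div:
  assumes f0: "power_bounded f0 d0 m0 M0" and f: "power_bounded f d m M"
    and "- 1/2 < 2 * d0 - d" "2 * d0 - d < 1/2"
  shows "power_bounded (\<lambda>x. (f0 x)\<^sup>2 / f x) (2 * d0 - d) (m0\<^sup>2 / M) (M0\<^sup>2 / m)"
proof -
  have m: "0 < m" "0 < M" "0 < m0" "0 < M0"
    using f f0 power_bounded_upper_pos by (auto simp: power_bounded_def)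
  have "m0\<^sup>2 / M * pole (2 * d0 - d) x \<le> (f0 x)\<^sup>2 / f x \<and> (f0 x)\<^sup>2 / f x \<le> M0\<^sup>2 / m * pole (2 * d0 - d) x"
    if x: "x \<in> freqs - {0}" for x
  proof -
    define p where "p = pole d0 x"
    define q where "q = pole d x"
    have pq: "0 < p" "0 < q" using x by (auto simp: p_def q_def)
    have b: "m0 * p \<le> f0 x" "f0 x \<le> M0 * p" "m * q \<le> f x" "f x \<le> M * q"
      using f0 f x by (auto simp: power_bounded_def p_def q_def)
    note fp = power_bounded_pos[OF f0 x] power_bounded_pos[OF f x]
    have e: "pole (2 * d0 - d) x = p\<^sup>2 / q"
      by (simp add: p_def q_def power2_eq_square powr_add[symmetric] powr_diff[symmetric] algebra_simps)
    have "(m0 * p)\<^sup>2 / (M * q) \<le> (f0 x)\<^sup>2 / f x"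
      using fp b m pq by (intro frac_le power_mono) auto
    moreover have "(f0 x)\<^sup>2 / f x \<le> (M0 * p)\<^sup>2 / (m * q)"
      using fp b m pq by (intro frac_le power_mono) auto
    ultimately show ?thesis unfolding e by (simp add: power_mult_distrib)
  qed
  moreover have "continuous_on (freqs - {0}) (\<lambda>x. (f0 x)\<^sup>2 / f x)"
    using f f0 less_imp_neq[OF power_bounded_pos[OF f], symmetric]
    by (intro continuous_intros ballI) (simp_all add: power_bounded_def)
  ultimately show ?thesis using assms m by (auto simp: power_bounded_def)
qed

text \<open>The inequality \<open>2 f\<^sub>0 \<le> f\<^sub>0\<^sup>2 / (f \<surd>n) + f \<surd>n\<close> turns the trace bound for \<open>f\<^sub>0\<^sup>2 / f\<close> into an operator bound of
  order \<open>\<surd>n\<close> even though \<open>f\<^sub>0 / f\<close> may be unbounded.\<close>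

lemma toeplitz_dominated_sqrt:
  assumes f0: "power_bounded f0 d0 m0 M0" and f: "power_bounded f d m M"
    and d: "\<bar>d - d0\<bar> < 1/4" "- 1/2 < 2 * d0 - d" "2 * d0 - d < 1/2"
  obtains K where "0 < K" "\<forall>\<^sub>F n in sequentially. \<forall>y.
    qform n (toeplitz n f0) y \<le> K * sqrt (real n) * qform n (toeplitz n f) y"
proof -
  define w where "w = (\<lambda>x. (f0 x)\<^sup>2 / f x)"
  have w: "power_bounded w (2 * d0 - d) (m0\<^sup>2 / M) (M0\<^sup>2 / m)"
    unfolding w_def by (rule power_bounded_square_div[OF f0 f d(2,3)])
  note wi = power_bounded_integrable[OF w] and fi = power_bounded_integrable[OF f]
    and f0i = power_bounded_integrable[OF f0]
  \<comment> \<open>\<open>w / f\<close> is the square of \<open>f0 / f\<close>, with exponent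
    \<open>2 * (d0 - d)\<close>; its integrability is what the bound 1/4 on
    \<open>\<bar>d - d0\<bar>\<close> is for.\<close>
  define C where "C = (\<integral>x. w x / f x \<partial>FQ) / (2 * pi) + 1"
  have wnn: "AE x in FQ. 0 \<le> w x" using power_bounded_AE_pos[OF w] by eventually_elim simp
  have C: "1 \<le> C"
  proof -
    have "0 \<le> (\<integral>x. w x / f x \<partial>FQ)"
      by (intro integral_nonneg_AE AE_FQI) (simp add: less_imp_le power_bounded_pos[OF f] w_def)
    then show ?thesis by (simp add: C_def)
  qed
  have "\<forall>\<^sub>F n in sequentially. frob n (minv (toeplitz n f)) (toeplitz n w) \<le> real n * C"
    unfolding C_def by (rule power_bounded_trace(2)[OF w f]) (use d(1) in linarith)+
  then have "\<forall>\<^sub>F n in sequentially. \<forall>y.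
    qform n (toeplitz n f0) y \<le> (C + 1) / 2 * sqrt (real n) * qform n (toeplitz n f) y"
    using eventually_gt_at_top[of "0::nat"]
  proof eventually_elim
    case (elim n)
    define s where "s = sqrt (real n)"
    have s: "0 < s" "s * s = real n" using elim by (auto simp: s_def)
    note pd = pos_def_toeplitz[OF fi power_bounded_AE_pos[OF f], of n]
    show ?case
    proof
      fix y
      have "qform n (toeplitz n f0) y \<le> (\<integral>x. 1 / (2 * s) * (w x * trig_sq n y x) + s / 2 * (f x * trig_sq n y x) \<partial>FQ)"
        unfolding qform_toeplitz[OF f0i]
      proof (intro integral_mono_AE AE_FQI)
        fix x assume x: "x \<in> freqs - {0}"
        have fx: "0 < f x" by (rule power_bounded_pos[OF f x])
        have "0 \<le> (f0 x - s * f x)\<^sup>2 / (2 * s * f x)" using fx s by simp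
        also have "\<dots> = 1 / (2 * s) * w x + s / 2 * f x - f0 x"
          using fx s by (simp add: w_def power2_eq_square field_simps)
        finally have "f0 x * trig_sq n y x \<le> (1 / (2 * s) * w x + s / 2 * f x) * trig_sq n y x"
          by (intro mult_right_mono trig_sq_nonneg) simp
        then show "f0 x * trig_sq n y x \<le> 1 / (2 * s) * (w x * trig_sq n y x) + s / 2 * (f x * trig_sq n y x)"
          by (simp add: distrib_right)
      qed (intro Bochner_Integration.integrable_add integrable_mult_right integrable_FQ_trig_sq wi fi f0i)+
      also have "\<dots> = 1 / (2 * s) * qform n (toeplitz n w) y + s / 2 * qform n (toeplitz n f) y"
        unfolding qform_toeplitz[OF wi] qform_toeplitz[OF fi]
        by (subst Bochner_Integration.integral_add[OF integrable_mult_right[OF integrable_FQ_trig_sq[OF wi]]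
            integrable_mult_right[OF integrable_FQ_trig_sq[OF fi]]]) (simp only: integral_mult_right_zero)
      also have "qform n (toeplitz n w) y \<le> (real n * C) * qform n (toeplitz n f) y"
      proof -
        have "qform n (toeplitz n w) y \<le> frob n (minv (toeplitz n f)) (toeplitz n w) * qform n (toeplitz n f) y"
          by (rule qform_toeplitz_le_frob[OF wi wnn pd])
        also have "\<dots> \<le> (real n * C) * qform n (toeplitz n f) y"
          using elim(1) pos_def_qform_nonneg[OF pd] by (rule mult_right_mono)
        finally show ?thesis .
      qed
      also have "1 / (2 * s) * ((real n * C) * qform n (toeplitz n f) y) + s / 2 * qform n (toeplitz n f) y =
          (C + 1) / 2 * s * qform n (toeplitz n f) y"
        unfolding s(2)[symmetric] using s(1) by (simp add: field_simps)
      finally show "qform n (toeplitz n f0) y \<le> (C + 1) / 2 * sqrt (real n) * qform n (toeplitz n f) y"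
        using s(1) by (simp add: s_def divide_right_mono)
    qed
  qed
  then show thesis using that[of "(C + 1) / 2"] C by simp
qed

text \<open>Minus twice the log-likelihood ratio is a difference of log-determinants plus a
  difference of two quadratic forms. A trace bounds the former by \<open>n * (I2 - 1)\<close>; an
  upper tail for the form of \<open>f\<close> and a lower tail for that of \<open>f0\<close> bound
  the latter by \<open>n * (I1 - 1)\<close>, each up to multiples of \<open>n * \<epsilon>\<close>.
  The sum is \<open>n * H\<close>.\<close>

lemma likelihood_ratio_tail:
  assumes f0: "power_bounded f0 d0 m0 M0" and f: "power_bounded f d m M"
    and d: "\<bar>d - d0\<bar> < 1/4" "- 1/2 < 2 * d0 - d" "2 * d0 - d < 1/2" and \<epsilon>: "0 < \<epsilon>" "\<epsilon> \<le> 1"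
  defines "H \<equiv> (\<integral>x. f0 x / f x \<partial>FQ) / (2 * pi) + (\<integral>x. f x / f0 x \<partial>FQ) / (2 * pi) - 2"
  shows "\<exists>c>0. \<forall>\<^sub>F n in sequentially.
    lik_mass n f0 {x \<in> space (obs_space n). lik n f x < exp (- real n * (H + 5 * \<epsilon>) / 2) * lik n f0 x}
      \<le> ennreal (2 * exp (- c * sqrt (real n)))"
proof -
  define I1 where "I1 = (\<integral>x. f0 x / f x \<partial>FQ) / (2 * pi)"
  define I2 where "I2 = (\<integral>x. f x / f0 x \<partial>FQ) / (2 * pi)"
  have I1: "0 \<le> I1" unfolding I1_def
    by (intro divide_nonneg_pos integral_nonneg_AE AE_FQI) (simp_all add: less_imp_le power_bounded_pos[OF f] power_bounded_pos[OF f0])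
  obtain K where K: "0 < K" "\<forall>\<^sub>F n in sequentially. \<forall>y.
    qform n (toeplitz n f0) y \<le> K * sqrt (real n) * qform n (toeplitz n f) y"
    using toeplitz_dominated_sqrt[OF f0 f d] by blast
  \<comment> \<open>Solves \<open>(I1 + \<epsilon>) / (1 - \<theta>) = I1 + 2 * \<epsilon>\<close>:
    perturbing the inverse costs just one more \<open>\<epsilon>\<close>.\<close>
  define \<theta> where "\<theta> = \<epsilon> / (I1 + 2 * \<epsilon>)"
  have \<theta>: "0 < \<theta>" "\<theta> < 1" using \<epsilon> I1 by (auto simp: \<theta>_def field_simps)
  have \<theta>': "(I1 + \<epsilon>) / (1 - \<theta>) = I1 + 2 * \<epsilon>" using \<epsilon> I1 by (simp add: \<theta>_def field_simps add_pos_nonneg)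
  define c where "c = min (\<theta> * \<epsilon> / (2 * K)) (\<epsilon>\<^sup>2 / 8)"
  have c: "0 < c" using \<epsilon> \<theta> K by (simp add: c_def)
  note fi = power_bounded_integrable[OF f] and f0i = power_bounded_integrable[OF f0]
  have "\<forall>\<^sub>F n in sequentially. frob n (minv (toeplitz n f)) (toeplitz n f0) \<le> real n * (I1 + \<epsilon>)"
    unfolding I1_def by (rule power_bounded_trace(2)[OF f0 f]) (use d(1) \<epsilon> in linarith)+
  moreover have "\<forall>\<^sub>F n in sequentially. frob n (minv (toeplitz n f0)) (toeplitz n f) \<le> real n * (I2 + \<epsilon>)"
    unfolding I2_def by (rule power_bounded_trace(2)[OF f f0]) (use d(1) \<epsilon> in linarith)+
  moreover note K(2)
  ultimately have "\<forall>\<^sub>F n in sequentially.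
    lik_mass n f0 {x \<in> space (obs_space n). lik n f x < exp (- real n * (H + 5 * \<epsilon>) / 2) * lik n f0 x}
      \<le> ennreal (2 * exp (- c * sqrt (real n)))"
    using eventually_gt_at_top[of "0::nat"]
  proof eventually_elim
    case (elim n)
    let ?T = "toeplitz n f" and ?S = "toeplitz n f0"
    define r where "r = sqrt (real n)"
    have r: "0 < r" "r * r = real n" "1 \<le> r" using elim(4) by (auto simp: r_def)
    have rn: "r \<le> real n" using r(1,3) r(2)[symmetric] by simp
    note pd = pos_def_toeplitz[OF fi power_bounded_AE_pos[OF f], of n]
      and pd0 = pos_def_toeplitz[OF f0i power_bounded_AE_pos[OF f0], of n]
    \<comment> \<open>The slack \<open>5 * \<epsilon>\<close> is spent as
      \<open>3 * \<epsilon>\<close> on \<open>W1\<close>, \<open>\<epsilon>\<close> on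
      \<open>W2\<close> and \<open>\<epsilon>\<close> on the determinants.\<close>
    define W1 where "W1 = {x \<in> space (obs_space n). real n * (I1 + 3 * \<epsilon>) \<le> qform n (minv ?T) x}"
    define W2 where "W2 = {x \<in> space (obs_space n). qform n (minv ?S) x \<le> real n * (1 - \<epsilon>)}"
    have 1: "lik_mass n f0 W1 \<le> ennreal (exp (- c * r))"
    proof -
      \<comment> \<open>The largest parameter for which the operator bound keeps \<open>s\<close>
        times \<open>?S\<close> below \<open>\<theta>\<close> times \<open>?T\<close>. Being of
        order \<open>1 / r\<close>, it yields an exponent of order \<open>r\<close>.\<close>
      define s where "s = \<theta> / (K * r)"
      have s: "0 < s" using \<theta> K r by (simp add: s_def)
      have dom: "- (- s) * qform n ?S y \<le> \<theta> * qform n ?T y" for y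
      proof -
        have "s * qform n ?S y \<le> s * (K * r * qform n ?T y)"
          unfolding r_def by (rule mult_left_mono[OF spec[OF elim(3)] less_imp_le[OF s]])
        also have "\<dots> = \<theta> * qform n ?T y" using K r by (simp add: s_def)
        finally show ?thesis by simp
      qed
      note pA = pos_def_add_smult[OF pd pd0 \<theta>(2) dom]
      let ?A = "?T + (- s) \<cdot>\<^sub>m ?S"
      \<comment> \<open>The trace of the inverse of \<open>?A\<close> against \<open>?A\<close>
        itself is \<open>n\<close>, which turns the bound wanted for \<open>?T\<close> into one for
        \<open>?S\<close>.\<close>
      have "real n = frob n (minv ?A) ?T + - s * frob n (minv ?A) ?S"
        using frob_minv_self[OF pA(1)] by (simp only: frob_add_smult[OF toeplitz_carrier toeplitz_carrier])
      moreover have "frob n (minv ?A) ?S \<le> frob n (minv ?T) ?S / (1 - \<theta>)"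
      proof -
        have "frob n (minv ?A) ?S \<le> (\<integral>x. f0 x * kern n (minv ?T) x / (1 - \<theta>) \<partial>FQ)"
          unfolding frob_toeplitz[OF f0i]
        proof (intro integral_mono_AE AE_FQI)
          fix x assume x: "x \<in> freqs - {0}"
          have "(1 - \<theta>) * kern n (minv ?A) x \<le> kern n (minv ?T) x"
            unfolding kern_def distrib_left by (intro add_mono pA(2))
          then have "kern n (minv ?A) x \<le> kern n (minv ?T) x / (1 - \<theta>)"
            using \<theta> by (simp add: pos_le_divide_eq mult.commute)
          then show "f0 x * kern n (minv ?A) x \<le> f0 x * kern n (minv ?T) x / (1 - \<theta>)"
            using power_bounded_pos[OF f0 x] mult_left_mono by fastforce
        qed (use integrable_FQ_kern[OF f0i] in auto)
        then show ?thesis by (simp add: frob_toeplitz[OF f0i])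
      qed
      moreover have "frob n (minv ?T) ?S / (1 - \<theta>) \<le> real n * (I1 + 2 * \<epsilon>)"
        unfolding \<theta>'[symmetric] using divide_right_mono[OF elim(1), of "1 - \<theta>"] \<theta> by simp
      ultimately have "frob n (minv ?A) ?T \<le> real n + s * (real n * (I1 + 2 * \<epsilon>))"
        using s by (smt (verit) mult_left_mono mult_minus_left)
      then have D: "mdet ?T \<le> mdet ?A * exp (s * (real n * (I1 + 2 * \<epsilon>)))"
        by (rule det_le_det_exp[OF pA(1) pd])
      have "lik_mass n f0 W1 \<le>
          ennreal (exp (- s * (real n * (I1 + 3 * \<epsilon>)) / 2 + s * (real n * (I1 + 2 * \<epsilon>)) / 2))"
        by (rule chernoff[OF pd0 pd pA(1) _ D]) (use s in \<open>auto simp: W1_def\<close>)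
      also have "- s * (real n * (I1 + 3 * \<epsilon>)) / 2 + s * (real n * (I1 + 2 * \<epsilon>)) / 2 = - (s * real n * \<epsilon> / 2)"
        by (simp add: field_simps)
      also have "s * real n * \<epsilon> / 2 = (\<theta> * \<epsilon> / (2 * K)) * r"
        using r K unfolding s_def r(2)[symmetric] by (simp add: field_simps)
      also have "ennreal (exp (- ((\<theta> * \<epsilon> / (2 * K)) * r))) \<le> ennreal (exp (- c * r))"
      proof (intro ennreal_leI, subst exp_le_cancel_iff)
        have "c * r \<le> (\<theta> * \<epsilon> / (2 * K)) * r" using r by (intro mult_right_mono) (auto simp: c_def)
        then show "- ((\<theta> * \<epsilon> / (2 * K)) * r) \<le> - c * r" by simp
      qed
      finally show ?thesis .
    qed
    have 2: "lik_mass n f0 W2 \<le> ennreal (exp (- c * r))"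
    proof -
      \<comment> \<open>Under \<open>f0\<close> this form is chi-square with \<open>n\<close>
        degrees of freedom. Per observation the exponent is
        \<open>(s\<^sup>2 - s * \<epsilon>) / 2\<close>, minimal at \<open>\<epsilon> / 2\<close>
        with value \<open>- \<epsilon>\<^sup>2 / 8\<close>.\<close>
      define s where "s = \<epsilon> / 2"
      have s: "0 < s" using \<epsilon> by (simp add: s_def)
      have dom: "- s * qform n ?S y \<le> 0 * qform n ?S y" for y
        using pos_def_qform_nonneg[OF pd0, of y] s by simp
      have pA: "pos_def n (?S + s \<cdot>\<^sub>m ?S)" by (rule pos_def_add_smult(1)[OF pd0 pd0 _ dom]) simp
      let ?A = "?S + s \<cdot>\<^sub>m ?S"
      have "real n = frob n (minv ?A) ?S + s * frob n (minv ?A) ?S"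
        using frob_minv_self[OF pA] by (simp only: frob_add_smult[OF toeplitz_carrier toeplitz_carrier])
      then have "frob n (minv ?A) ?S = real n / (1 + s)" using s by (simp add: field_simps)
      also have "\<dots> \<le> real n + real n * (- s + s\<^sup>2)"
      proof -
        have "1 \<le> (1 - s + s\<^sup>2) * (1 + s)" using s by (simp add: power2_eq_square algebra_simps)
        then have "1 / (1 + s) \<le> 1 - s + s\<^sup>2" using s by (subst pos_divide_le_eq) auto
        from mult_left_mono[OF this, of "real n"] show ?thesis by (simp add: algebra_simps)
      qed
      finally have D: "mdet ?S \<le> mdet ?A * exp (real n * (- s + s\<^sup>2))"
        by (rule det_le_det_exp[OF pA pd0])
      have "lik_mass n f0 W2 \<le>
          ennreal (exp (s * (real n * (1 - \<epsilon>)) / 2 + real n * (- s + s\<^sup>2) / 2))"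
        by (rule chernoff[OF pd0 pd0 pA _ D]) (use s in \<open>auto simp: W2_def\<close>)
      also have "s * (real n * (1 - \<epsilon>)) / 2 + real n * (- s + s\<^sup>2) / 2 = - (\<epsilon>\<^sup>2 / 8 * real n)"
        by (simp add: s_def power2_eq_square field_simps)
      also have "ennreal (exp (- (\<epsilon>\<^sup>2 / 8 * real n))) \<le> ennreal (exp (- c * r))"
      proof (intro ennreal_leI, subst exp_le_cancel_iff)
        have "c * r \<le> \<epsilon>\<^sup>2 / 8 * real n" using r rn c by (intro mult_mono) (auto simp: c_def)
        then show "- (\<epsilon>\<^sup>2 / 8 * real n) \<le> - c * r" by simp
      qed
      finally show ?thesis .
    qed
    have sub: "x \<in> W1 \<union> W2"
      if x: "x \<in> space (obs_space n)" "lik n f x < exp (- real n * (H + 5 * \<epsilon>) / 2) * lik n f0 x" for x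
    proof (rule ccontr)
      assume "x \<notin> W1 \<union> W2"
      then have q: "qform n (minv ?T) x \<le> real n * (I1 + 3 * \<epsilon>)" "real n * (1 - \<epsilon>) \<le> qform n (minv ?S) x"
        using x(1) by (auto simp: W1_def W2_def)
      have "mdet ?T \<le> mdet ?S * exp (real n * (I2 + \<epsilon> - 1))"
        by (rule det_le_det_exp[OF pd0 pd]) (use elim(2) in \<open>simp add: algebra_simps\<close>)
      then have "(mdet ?S * exp (real n * (I2 + \<epsilon> - 1))) powr (- 1 / 2) \<le> mdet ?T powr (- 1 / 2)"
        using pos_def_det_pos[OF pd] by (intro powr_mono2') auto
      moreover have "exp (real n * (I2 + \<epsilon> - 1)) powr (- 1 / 2) = exp (- real n * (I2 + \<epsilon> - 1) / 2)"
        by (simp add: powr_def)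
      ultimately have D: "exp (- real n * (I2 + \<epsilon> - 1) / 2) * mdet ?S powr (- 1 / 2) \<le> mdet ?T powr (- 1 / 2)"
        using pos_def_det_pos[OF pd0] by (simp add: powr_mult mult.commute)
      have Q: "exp (- real n * (I1 + 4 * \<epsilon> - 1) / 2) * exp (- qform n (minv ?S) x / 2) \<le> exp (- qform n (minv ?T) x / 2)"
        using q by (simp add: exp_add[symmetric] field_simps)
      have "exp (- real n * (H + 5 * \<epsilon>) / 2) = exp (- real n * (I2 + \<epsilon> - 1) / 2) * exp (- real n * (I1 + 4 * \<epsilon> - 1) / 2)"
        by (simp add: H_def I1_def I2_def exp_add[symmetric] field_simps)
      then have "exp (- real n * (H + 5 * \<epsilon>) / 2) * lik n f0 x = (2 * pi) powr (- real n / 2) *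
        ((exp (- real n * (I2 + \<epsilon> - 1) / 2) * mdet ?S powr (- 1 / 2)) *
         (exp (- real n * (I1 + 4 * \<epsilon> - 1) / 2) * exp (- qform n (minv ?S) x / 2)))"
        by (simp add: lik_qform[OF pd0] mult_ac)
      also have "\<dots> \<le> (2 * pi) powr (- real n / 2) * (mdet ?T powr (- 1 / 2) * exp (- qform n (minv ?T) x / 2))"
        using D Q by (intro mult_left_mono mult_mono) auto
      also have "\<dots> = lik n f x" by (simp add: lik_qform[OF pd] mult_ac)
      finally show False using x(2) by simp
    qed
    have W: "W1 \<in> sets (obs_space n)" "W2 \<in> sets (obs_space n)" unfolding W1_def W2_def by measurable
    have "lik_mass n f0 {x \<in> space (obs_space n). lik n f x < exp (- real n * (H + 5 * \<epsilon>) / 2) * lik n f0 x}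
        \<le> (\<integral>\<^sup>+x. ennreal (lik n f0 x) * indicator W1 x + ennreal (lik n f0 x) * indicator W2 x \<partial>obs_space n)"
    proof (intro nn_integral_mono)
      fix x assume "x \<in> space (obs_space n)"
      with sub[of x] show "ennreal (lik n f0 x) * indicator {x \<in> space (obs_space n).
          lik n f x < exp (- real n * (H + 5 * \<epsilon>) / 2) * lik n f0 x} x
        \<le> ennreal (lik n f0 x) * indicator W1 x + ennreal (lik n f0 x) * indicator W2 x"
        by (cases "x \<in> W1"; cases "x \<in> W2") (auto simp: indicator_def)
    qed
    also have "\<dots> = lik_mass n f0 W1 + lik_mass n f0 W2"
      using lik_measurable[OF pd0] W by (intro nn_integral_add) auto
    also have "\<dots> \<le> ennreal (exp (- c * r)) + ennreal (exp (- c * r))" by (intro add_mono 1 2)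
    also have "\<dots> = ennreal (2 * exp (- c * sqrt (real n)))" by (simp add: r_def ennreal_plus[symmetric] del: ennreal_plus)
    finally show ?case .
  qed
  with c show ?thesis by blast
qed

section \<open>Summable error bounds and the Borel-Cantelli lemma\<close>

lemma summable_exp_sqrt:
  fixes c :: real assumes "0 < c" shows "summable (\<lambda>n. 2 * exp (- c * sqrt (real n)))"
proof (rule summable_comparison_test_bigo)
  show "summable (\<lambda>n. norm (1 / real n ^ 2))"
    using inverse_power_summable[of 2, where 'a = real] by (simp add: divide_inverse power_inverse)
  show "(\<lambda>n. 2 * exp (- c * sqrt (real n))) \<in> O(\<lambda>n. 1 / real n ^ 2)" using assms by real_asymp
qed

lemma summable_exp_linear:
  fixes c :: real assumes "0 < c" shows "summable (\<lambda>n. 2 * exp (- real n * c))"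
proof (rule summable_comparison_test_bigo)
  show "summable (\<lambda>n. norm (1 / real n ^ 2))"
    using inverse_power_summable[of 2, where 'a = real] by (simp add: divide_inverse power_inverse)
  show "(\<lambda>n. 2 * exp (- real n * c)) \<in> O(\<lambda>n. 1 / real n ^ 2)" using assms by real_asymp
qed

text \<open>Laws of observations concern restricted tuples, posteriors take the whole sequence; this
  passes between the two.\<close>

lemma lik_restrict: "lik n f (restrict x {..<n}) = lik n f x"
proof -
  have "vec n (restrict x {..<n}) = vec n x" by (rule eq_vecI) auto
  then show ?thesis by (simp add: lik_def)
qed

lemma gaussian_process_eventually_not_in:
  assumes X: "gaussian_process P X f0" and W: "\<And>n. W n \<in> sets (obs_space n)"
    and b: "\<forall>\<^sub>F n in sequentially. lik_mass n f0 (W n) \<le> ennreal (b n)"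
    and "\<And>n. 0 \<le> b n" "summable b"
  shows "AE \<omega> in P. \<forall>\<^sub>F n in sequentially. restrict (\<lambda>i. X i \<omega>) {..<n} \<notin> W n"
proof -
  interpret prob_space P using X by (simp add: gaussian_process_def)
  define A where "A = (\<lambda>n. {\<omega> \<in> space P. restrict (\<lambda>i. X i \<omega>) {..<n} \<in> W n})"
  have dist: "distributed P (obs_space n) (\<lambda>\<omega>. \<lambda>i\<in>{..<n}. X i \<omega>) (\<lambda>x. ennreal (lik n f0 x))" for n
    using X by (simp add: gaussian_process_def)
  have A: "A n = (\<lambda>\<omega>. \<lambda>i\<in>{..<n}. X i \<omega>) -` W n \<inter> space P" for n by (auto simp: A_def)
  have Am: "A n \<in> sets P" for n
    unfolding A using distributed_measurable[OF dist] W by (rule measurable_sets)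
  have "\<forall>\<^sub>F n in sequentially. measure P (A n) \<le> b n"
    using b
  proof eventually_elim
    case (elim n)
    have "emeasure P (A n) \<le> ennreal (b n)"
      unfolding A using distributed_emeasure[OF dist W] elim by simp
    then show ?case using assms(4) by (simp add: emeasure_eq_measure)
  qed
  then have "\<forall>\<^sub>F n in sequentially. norm (measure P (A n)) \<le> b n" by simp
  then have "summable (\<lambda>n. measure P (A n))" using assms(5) by (rule summable_comparison_test_ev)
  then have "AE \<omega> in P. \<forall>\<^sub>F n in sequentially. \<omega> \<in> space P - A n"
    using Am by (intro borel_cantelli_AE1) (auto simp: emeasure_eq_measure)
  then show ?thesis by eventually_elim (auto simp: A_def elim: eventually_mono)
qed

lemma likelihood_ratio_eventually:
  assumes X: "gaussian_process P X f0" and f0: "power_bounded f0 d0 m0 M0" and f: "power_bounded f d m M"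
    and d: "\<bar>d - d0\<bar> < 1/4" "- 1/2 < 2 * d0 - d" "2 * d0 - d < 1/2"
    and H: "(\<integral>x. f0 x / f x \<partial>FQ) / (2 * pi) + (\<integral>x. f x / f0 x \<partial>FQ) / (2 * pi) - 2 < 2 * \<kappa>"
  shows "AE \<omega> in P. \<forall>\<^sub>F n in sequentially.
    exp (- real n * \<kappa>) * lik n f0 (\<lambda>i. X i \<omega>) \<le> lik n f (\<lambda>i. X i \<omega>)"
proof -
  define h where "h = (\<integral>x. f0 x / f x \<partial>FQ) / (2 * pi) + (\<integral>x. f x / f0 x \<partial>FQ) / (2 * pi) - 2"
  \<comment> \<open>The strict inequality \<open>H\<close> leaves the room for the slack
    \<open>5 * \<epsilon>\<close> of \<open>likelihood_ratio_tail\<close>.\<close>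
  define \<epsilon> where "\<epsilon> = min 1 ((2 * \<kappa> - h) / 5)"
  have "\<epsilon> \<le> (2 * \<kappa> - h) / 5" unfolding \<epsilon>_def by (rule min.cobounded2)
  then have "h + 5 * \<epsilon> \<le> 2 * \<kappa>" by (simp add: pos_le_divide_eq)
  moreover have "0 < \<epsilon>" "\<epsilon> \<le> 1" using H by (auto simp: \<epsilon>_def h_def[symmetric])
  ultimately have \<epsilon>: "0 < \<epsilon>" "\<epsilon> \<le> 1" "h + 5 * \<epsilon> \<le> 2 * \<kappa>" by blast+
  define W where "W = (\<lambda>n. {x \<in> space (obs_space n). lik n f x < exp (- real n * (h + 5 * \<epsilon>) / 2) * lik n f0 x})"
  obtain c where c: "0 < c" "\<forall>\<^sub>F n in sequentially. lik_mass n f0 (W n) \<le> ennreal (2 * exp (- c * sqrt (real n)))"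
    using likelihood_ratio_tail[OF f0 f d \<epsilon>(1,2)] unfolding W_def h_def by blast
  note pd = pos_def_toeplitz[OF power_bounded_integrable[OF f] power_bounded_AE_pos[OF f]]
    and pd0 = pos_def_toeplitz[OF power_bounded_integrable[OF f0] power_bounded_AE_pos[OF f0]]
  have "W n \<in> sets (obs_space n)" for n
    unfolding W_def using lik_measurable[OF pd] lik_measurable[OF pd0] by measurable
  then have "AE \<omega> in P. \<forall>\<^sub>F n in sequentially. restrict (\<lambda>i. X i \<omega>) {..<n} \<notin> W n"
    by (rule gaussian_process_eventually_not_in[OF X _ c(2)]) (use summable_exp_sqrt[OF c(1)] in auto)
  then show ?thesis
  proof eventually_elim
    case (elim \<omega>)
    then show ?case
    proof eventually_elim
      case (elim n)
      have "restrict (\<lambda>i. X i \<omega>) {..<n} \<in> space (obs_space n)" by (simp add: space_PiM)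
      with elim have "exp (- real n * (h + 5 * \<epsilon>) / 2) * lik n f0 (\<lambda>i. X i \<omega>) \<le> lik n f (\<lambda>i. X i \<omega>)"
        by (auto simp: W_def lik_restrict)
      moreover have "exp (- real n * \<kappa>) \<le> exp (- real n * (h + 5 * \<epsilon>) / 2)"
        using mult_left_mono[OF \<epsilon>(3), of "real n"] by simp
      ultimately show ?case using lik_pos[OF pd0, of n] by (meson less_imp_le mult_right_mono order_trans)
    qed
  qed
qed

subsection \<open>The prior\<close>

lemma power_bounded_has_exponent:
  assumes "power_bounded f d m M" shows "has_exponent f d"
proof -
  have m: "0 < m" "- 1/2 < d" "d < 1/2" using assms by (auto simp: power_bounded_def)
  \<comment> \<open>The value \<open>m\<close> at the origin serves \<open>has_exponentI\<close>,
    whose bounds include that point.\<close>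
  define g where "g = (\<lambda>x. if x = 0 then m else \<bar>x\<bar> powr (2 * d) * f x)"
  have M: "m \<le> M"
  proof -
    have "pi \<in> freqs - {0}" by auto
    then have "m * pole d pi \<le> f pi" "f pi \<le> M * pole d pi"
      using assms unfolding power_bounded_def by blast+
    then have "m * pole d pi \<le> M * pole d pi" by (rule order_trans)
    then show ?thesis by simp
  qed
  show ?thesis
  proof (rule has_exponentI[OF m(2,3) _ m(1)])
    show "factors f d g" by (auto simp: factors_def g_def powr_add[symmetric] mult.assoc[symmetric])
    show "\<forall>x\<in>freqs. m \<le> g x \<and> g x \<le> M"
    proof
      fix x assume x: "x \<in> freqs"
      show "m \<le> g x \<and> g x \<le> M"
      proof (cases "x = 0")
        case False
        then have "m * pole d x \<le> f x \<and> f x \<le> M * pole d x"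
          using assms x by (auto simp: power_bounded_def)
        then have "\<bar>x\<bar> powr (2 * d) * (m * pole d x) \<le> g x \<and> g x \<le> \<bar>x\<bar> powr (2 * d) * (M * pole d x)"
          using False by (auto simp: g_def intro!: mult_left_mono)
        moreover have "\<bar>x\<bar> powr (2 * d) * (k * pole d x) = k" for k
          using False by (simp add: mult.left_commute powr_add[symmetric])
        ultimately show ?thesis by (simp only:)
      qed (use M in \<open>simp add: g_def\<close>)
    qed
  qed
qed

lemma factors_power_bounded:
  assumes f: "f \<in> F_class" "factors f d g" and d: "- 1/2 < d" "d < 1/2" and m: "0 < m"
    and g: "\<And>x. x \<in> freqs \<Longrightarrow> m \<le> g x \<and> g x \<le> M" "continuous_on (freqs - {0}) g"
  shows "power_bounded f d m M" "exponent f = d"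
proof -
  have eq: "f x = pole d x * g x" if "x \<in> freqs - {0}" for x
    using f(2) that unfolding factors_def by blast
  have "continuous_on (freqs - {0}) (\<lambda>x. pole d x * g x)"
    using g(2) by (intro continuous_intros) auto
  then have "continuous_on (freqs - {0}) f" by (rule continuous_on_cong[THEN iffD1, rotated 2]) (auto simp: eq)
  moreover have "\<forall>x\<in>freqs - {0}. m * pole d x \<le> f x \<and> f x \<le> M * pole d x"
    using g(1) by (auto simp: eq mult.commute intro!: mult_left_mono)
  moreover have "\<forall>x\<in>freqs - {0}. f (- x) = f x" using f(1) by (auto simp: F_class_def)
  ultimately show pb: "power_bounded f d m M" using d m by (auto simp: power_bounded_def)
  show "exponent f = d" by (rule exponent_eq[OF power_bounded_has_exponent[OF pb]])
qed

lemma hoelder_continuous_on: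
  fixes g :: "real \<Rightarrow> real"
  assumes "0 < \<rho>" "0 < L" "\<And>x y. x \<in> S \<Longrightarrow> y \<in> S \<Longrightarrow> \<bar>g x - g y\<bar> \<le> L * \<bar>x - y\<bar> powr \<rho>"
  shows "continuous_on S g"
  unfolding continuous_on_iff
proof (intro ballI allI impI)
  fix x e :: real assume x: "x \<in> S" and e: "0 < e"
  show "\<exists>\<delta>>0. \<forall>y\<in>S. dist y x < \<delta> \<longrightarrow> dist (g y) (g x) < e"
  proof (intro exI[of _ "(e / L) powr (1 / \<rho>)"] conjI ballI impI)
    fix y assume y: "y \<in> S" "dist y x < (e / L) powr (1 / \<rho>)"
    have "\<bar>y - x\<bar> powr \<rho> < ((e / L) powr (1 / \<rho>)) powr \<rho>"
      using y assms(1) by (intro powr_less_mono2) (auto simp: dist_real_def)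
    then have "\<bar>y - x\<bar> powr \<rho> < e / L" using assms e by (simp add: powr_powr)
    then have "L * \<bar>y - x\<bar> powr \<rho> < e" using assms by (simp add: pos_less_divide_eq mult.commute)
    then show "dist (g y) (g x) < e" using assms(3)[OF y(1) x] by (simp add: dist_real_def)
  qed (use e assms in auto)
qed

lemma L_star_continuous_on:
  assumes "h \<in> L_star M m L" "0 < L"
  shows "continuous_on (freqs - {0}) h"
  unfolding continuous_on_iff
proof (intro ballI allI impI)
  fix x e :: real assume x: "x \<in> freqs - {0}" and e: "0 < e"
  show "\<exists>\<delta>>0. \<forall>y\<in>freqs - {0}. dist y x < \<delta> \<longrightarrow> dist (h y) (h x) < e"
  \<comment> \<open>Within distance \<open>\<bar>x\<bar> / 2\<close> of \<open>x\<close> the smaller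
    of the two moduli is at least \<open>\<bar>x\<bar> / 2\<close>, which bounds the local Lipschitz
    factor; the second entry then makes the difference smaller than \<open>e\<close>.\<close>
  proof (intro exI[of _ "min (\<bar>x\<bar> / 2) (e * \<bar>x\<bar> / (2 * L))"] conjI ballI impI)
    fix y assume y: "y \<in> freqs - {0}" "dist y x < min (\<bar>x\<bar> / 2) (e * \<bar>x\<bar> / (2 * L))"
    have "\<bar>x\<bar> \<le> \<bar>y\<bar> + \<bar>y - x\<bar>" by arith
    moreover have "\<bar>y - x\<bar> < \<bar>x\<bar> / 2" using y(2) by (simp add: dist_real_def)
    ultimately have "\<bar>x\<bar> / 2 \<le> min \<bar>y\<bar> \<bar>x\<bar>" by simp
    then have "inverse (min \<bar>y\<bar> \<bar>x\<bar>) \<le> inverse (\<bar>x\<bar> / 2)" using x by (intro le_imp_inverse_le) auto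
    have "\<bar>h y - h x\<bar> \<le> L * \<bar>y - x\<bar> * inverse (min \<bar>y\<bar> \<bar>x\<bar>)"
      using assms x y(1) unfolding L_star_def by blast
    also have "\<dots> \<le> L * \<bar>y - x\<bar> * inverse (\<bar>x\<bar> / 2)"
      using assms(2) \<open>inverse (min \<bar>y\<bar> \<bar>x\<bar>) \<le> _\<close> by (intro mult_left_mono) auto
    also have "\<dots> < e"
    proof -
      have "\<bar>y - x\<bar> < e * \<bar>x\<bar> / (2 * L)" using y(2) by (simp add: dist_real_def)
      then show ?thesis using assms(2) x by (simp add: field_simps)
    qed
    finally show "dist (h y) (h x) < e" by (simp add: dist_real_def)
  qed (use x e assms in auto)
qed

lemma G_bar_power_bounded:
  assumes "f \<in> G_bar t M m L \<rho>" "0 < t" "0 < m" "0 < L" "0 < \<rho>"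
  shows "power_bounded f (exponent f) m M"
proof -
  obtain d g where d: "- 1/2 + t \<le> d" "d \<le> 1/2 - t" and f: "f \<in> F_tilde_plus" "factors f d g"
    and g: "\<forall>x\<in>freqs. m \<le> g x \<and> g x \<le> M" "\<forall>x\<in>freqs. \<forall>y\<in>freqs. \<bar>g x - g y\<bar> \<le> L * \<bar>x - y\<bar> powr \<rho>"
    using assms(1) unfolding G_bar_def G_class_def by auto
  have "continuous_on freqs g" by (rule hoelder_continuous_on[OF assms(5,4)]) (use g in blast)
  then have "continuous_on (freqs - {0}) g" by (rule continuous_on_subset) auto
  moreover have "f \<in> F_class" using f by (auto simp: F_tilde_plus_def F_tilde_def)
  ultimately show ?thesis
    using factors_power_bounded[of f d g m M] f(2) g(1) d assms(2,3) by simp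
qed

lemma L_bar_power_bounded:
  assumes "f \<in> L_bar t M m L" "0 < t" "0 < m" "0 < L"
  shows "power_bounded f (exponent f) m M"
proof -
  obtain d g where d: "- 1/2 + t \<le> d" "d \<le> 1/2 - t" and f: "f \<in> F_plus" "factors f d g"
    and g: "g \<in> L_star M m L"
    using assms(1) unfolding L_bar_def L_class_def by auto
  have "f \<in> F_class" using f by (auto simp: F_plus_def)
  moreover have "\<forall>x\<in>freqs. m \<le> g x \<and> g x \<le> M" using g by (auto simp: L_star_def)
  ultimately show ?thesis
    using factors_power_bounded[of f d g m M] f(2) L_star_continuous_on[OF g assms(4)] d assms(2,3) by simp
qed

section \<open>Measurability of determinants and inverse matrices\<close>

lemma det_measurable:
  fixes A :: "'b \<Rightarrow> real mat"
  assumes "\<And>x. A x \<in> carrier_mat n n"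
    and [measurable]: "\<And>i j. i < n \<Longrightarrow> j < n \<Longrightarrow> (\<lambda>x. A x $$ (i, j)) \<in> borel_measurable N"
  shows "(\<lambda>x. mdet (A x)) \<in> borel_measurable N"
  unfolding det_def'[OF assms(1)]
proof (intro borel_measurable_sum borel_measurable_times borel_measurable_const borel_measurable_prod)
  fix p i assume "p \<in> {p. p permutes {0..<n}}" "i \<in> {0..<n}"
  then have "p i < n" using permutes_in_image[of p "{0..<n}" i] by auto
  then show "(\<lambda>x. A x $$ (i, p i)) \<in> borel_measurable N" using \<open>i \<in> {0..<n}\<close> by simp
qed

text \<open>Cramer's rule replaces the elimination algorithm behind \<open>mat_inverse\<close> by a
  rational expression in the entries, from which measurability can be read off.\<close>

lemma minv_index:
  assumes A: "pos_def n A" and "i < n" "j < n"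
  shows "minv A $$ (i, j) = (-1) ^ (j + i) * mdet (mat_delete A j i) / mdet A"
proof -
  have car: "A \<in> carrier_mat n n" using A by (simp add: pos_def_def)
  have d: "mdet A \<noteq> 0" using pos_def_det_pos[OF A] by simp
  have "A * (inverse (mdet A) \<cdot>\<^sub>m adj_mat A) = inverse (mdet A) \<cdot>\<^sub>m (A * adj_mat A)"
    using car adj_mat(1)[OF car] by (simp add: mult_smult_distrib[where nr = n and n = n and nc = n])
  also have "\<dots> = 1\<^sub>m n" using d by (auto simp: adj_mat(2)[OF car] intro!: eq_matI)
  finally have "minv A = inverse (mdet A) \<cdot>\<^sub>m adj_mat A"
    by (intro minv_unique[OF A]) (use adj_mat(1)[OF car] in auto)
  then show ?thesis using car assms(2,3) by (simp add: adj_mat_def cofactor_def divide_inverse mult.commute)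
qed

lemma minv_measurable:
  fixes A :: "'b \<Rightarrow> real mat"
  assumes car: "\<And>x. A x \<in> carrier_mat n n" and pd: "\<And>x. x \<in> space N \<Longrightarrow> pos_def n (A x)"
    and [measurable]: "\<And>i j. i < n \<Longrightarrow> j < n \<Longrightarrow> (\<lambda>x. A x $$ (i, j)) \<in> borel_measurable N"
    and ij: "i < n" "j < n"
  shows "(\<lambda>x. minv (A x) $$ (i, j)) \<in> borel_measurable N"
proof -
  have "(\<lambda>x. mdet (mat_delete (A x) j i)) \<in> borel_measurable N"
  proof (rule det_measurable[OF mat_delete_carrier[OF car]])
    fix k l assume "k < n - 1" "l < n - 1"
    then show "(\<lambda>x. mat_delete (A x) j i $$ (k, l)) \<in> borel_measurable N"
      using carrier_matD[OF car] by (auto simp: mat_delete_def)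
  qed
  moreover have "(\<lambda>x. mdet (A x)) \<in> borel_measurable N" by (rule det_measurable[OF car]) simp
  ultimately have "(\<lambda>x. (-1) ^ (j + i) * mdet (mat_delete (A x) j i) / mdet (A x)) \<in> borel_measurable N"
    by measurable
  then show ?thesis by (rule measurable_cong[THEN iffD1, rotated]) (simp add: minv_index[OF pd ij])
qed

text \<open>From here on both function classes enter only through measurable evaluations and power
  bounds with common constants \<open>m\<close> and \<open>M\<close>.\<close>

locale regular_prior = prob_space \<pi> for \<pi> :: "(real \<Rightarrow> real) measure" +
  fixes m M :: real
  assumes evaluation_measurable: "\<And>x. x \<in> freqs - {0} \<Longrightarrow> (\<lambda>f. f x) \<in> borel_measurable \<pi>"
    and power_bounded_space: "\<And>f. f \<in> space \<pi> \<Longrightarrow> power_bounded f (exponent f) m M"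
begin

lemma pos_def_space: "f \<in> space \<pi> \<Longrightarrow> pos_def n (toeplitz n f)"
  using pos_def_toeplitz[OF power_bounded_integrable[OF power_bounded_space] power_bounded_AE_pos[OF power_bounded_space]] .

text \<open>The exponent is the limit of \<open>ln (f z) / (2 * ln (1 / z))\<close> as
  \<open>z\<close> decreases to 0, since \<open>m\<close> and \<open>M\<close> shift the numerator
  by bounded amounts only. A sequence of evaluations thus determines it.\<close>

lemma exponent_measurable: "exponent \<in> borel_measurable \<pi>"
proof (rule borel_measurable_LIMSEQ_real)
  \<comment> \<open>The shift by 2 keeps \<open>z k\<close> below 1 and hence \<open>y k\<close>
    positive.\<close>
  define z where "z = (\<lambda>k. 1 / real (k + 2))"
  define y where "y = (\<lambda>k. 2 * ln (real (k + 2)))"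
  have z: "z k \<in> freqs - {0}" for k
  proof -
    have "0 < z k" "z k \<le> 1" by (auto simp: z_def)
    moreover from this have "z k \<le> pi" "- pi \<le> z k" using pi_ge_two by linarith+
    ultimately show ?thesis by simp
  qed
  have y: "0 < y k" for k by (simp add: y_def)
  have lim: "filterlim y at_top sequentially"
    unfolding y_def by real_asymp
  show "(\<lambda>f. ln (f (z k)) / y k) \<in> borel_measurable \<pi>" for k
    using evaluation_measurable[OF z[of k]] by measurable
  fix f assume f: "f \<in> space \<pi>"
  define d where "d = exponent f"
  have pb: "power_bounded f d m M" unfolding d_def by (rule power_bounded_space[OF f])
  have m: "0 < m" "0 < M" using pb power_bounded_upper_pos by (auto simp: power_bounded_def)
  have pz: "pole d (z k) = exp (d * y k)" for k
    by (simp add: z_def y_def powr_def ln_div)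
  have ln_pz: "ln (c * pole d (z k)) = ln c + d * y k" if "0 < c" for c k
    unfolding pz using that by (simp add: ln_mult)
  have lo: "ln m / y k + d \<le> ln (f (z k)) / y k" and hi: "ln (f (z k)) / y k \<le> ln M / y k + d" for k
  proof -
    have p: "0 < pole d (z k)" using z[of k] by simp
    have b: "m * pole d (z k) \<le> f (z k)" "f (z k) \<le> M * pole d (z k)"
      using pb z[of k] unfolding power_bounded_def by blast+
    have fz: "0 < f (z k)" by (rule power_bounded_pos[OF pb z])
    have "ln (m * pole d (z k)) \<le> ln (f (z k))" "ln (f (z k)) \<le> ln (M * pole d (z k))"
      using b fz m p by (auto intro!: ln_mono mult_pos_pos)
    then have "ln m + d * y k \<le> ln (f (z k))" "ln (f (z k)) \<le> ln M + d * y k"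
      using ln_pz m by auto
    then have "(ln m + d * y k) / y k \<le> ln (f (z k)) / y k" "ln (f (z k)) / y k \<le> (ln M + d * y k) / y k"
      using y[of k] by (auto intro!: divide_right_mono)
    then show "ln m / y k + d \<le> ln (f (z k)) / y k" "ln (f (z k)) / y k \<le> ln M / y k + d"
      using y[of k] by (auto simp: add_divide_distrib)
  qed
  have t: "(\<lambda>k. c / y k + d) \<longlonglongrightarrow> 0 + d" for c
    by (intro tendsto_add tendsto_const real_tendsto_divide_at_top[OF tendsto_const lim])
  show "(\<lambda>k. ln (f (z k)) / y k) \<longlonglongrightarrow> exponent f"
    using tendsto_sandwich[OF always_eventually always_eventually t[of "ln m"] t[of "ln M"]] lo hi by (simp add: d_def)
qed

text \<open>Joint measurability comes from piecewise constant approximation: the frequency is rounded, away from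
  \<open>0\<close>, to a multiple of \<open>\<pi>/N\<close>.\<close>

lemma joint_evaluation_measurable:
  "(\<lambda>(f, x). if x \<in> freqs - {0} then f x else 0) \<in> borel_measurable (\<pi> \<Otimes>\<^sub>M borel)"
proof -
  define r where "r = (\<lambda>N x. sgn x * pi * of_int \<lceil>real (Suc N) * \<bar>x\<bar> / pi\<rceil> / real (Suc N))"
  have r_close: "\<bar>r N x - x\<bar> \<le> pi / real (Suc N)" and r_in: "r N x \<in> freqs - {0}" if x: "x \<in> freqs - {0}" for N x
  proof -
    define K where "K = real (Suc N)"
    have K: "0 < K" by (simp add: K_def)
    define c where "c = real_of_int \<lceil>K * \<bar>x\<bar> / pi\<rceil>"
    have c: "K * \<bar>x\<bar> / pi \<le> c" "c < K * \<bar>x\<bar> / pi + 1" unfolding c_def by linarith+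
    have rr: "r N x = sgn x * (pi * c / K)" by (simp add: r_def c_def K_def)
    have xa: "x = sgn x * \<bar>x\<bar>" "\<bar>sgn x\<bar> = 1" using x by (auto simp: sgn_if)
    have lo: "\<bar>x\<bar> \<le> pi * c / K" using c(1) K by (simp add: field_simps)
    have hi: "pi * c / K \<le> \<bar>x\<bar> + pi / K" using c(2) K by (simp add: field_simps)
    have "\<bar>r N x - x\<bar> = \<bar>sgn x * (pi * c / K - \<bar>x\<bar>)\<bar>"
      unfolding rr using xa(1) by (metis right_diff_distrib)
    also have "\<dots> = pi * c / K - \<bar>x\<bar>" using lo xa(2) by (simp add: abs_mult)
    finally show "\<bar>r N x - x\<bar> \<le> pi / real (Suc N)" using hi by (simp add: K_def)
    have "\<lceil>K * \<bar>x\<bar> / pi\<rceil> \<le> int (Suc N)"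
    proof (rule ceiling_le)
      have "K * \<bar>x\<bar> \<le> K * pi" using x K by (intro mult_left_mono) auto
      then have "K * \<bar>x\<bar> / pi \<le> K" by (simp add: pos_divide_le_eq)
      then show "K * \<bar>x\<bar> / pi \<le> of_int (int (Suc N))" by (simp add: K_def)
    qed
    then have "c \<le> K" unfolding c_def K_def by linarith
    then have "pi * c / K \<le> pi" using K by (simp add: pos_divide_le_eq)
    moreover have "\<bar>r N x\<bar> = pi * c / K"
      unfolding rr abs_mult[of "sgn x"] xa(2) using order_trans[OF abs_ge_zero lo] by (simp only: abs_of_nonneg mult_1)
    ultimately show "r N x \<in> freqs - {0}" using lo x by (auto simp: abs_le_iff)
  qed
  have rlim: "(\<lambda>N. r N x) \<longlonglongrightarrow> x" if x: "x \<in> freqs - {0}" for x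
  proof (subst LIM_zero_iff[symmetric], rule Lim_null_comparison)
    show "\<forall>\<^sub>F N in sequentially. norm (r N x - x) \<le> pi / real (Suc N)" using r_close[OF x] by simp
    show "(\<lambda>N. pi / real (Suc N)) \<longlonglongrightarrow> 0" by real_asymp
  qed
  \<comment> \<open>The rounded evaluation as a finite sum over grid points: each term is an
    evaluation at a fixed frequency times an indicator of the frequency variable, so its
    measurability is plain.\<close>
  define G where "G = (\<lambda>N (p :: (real \<Rightarrow> real) \<times> real). \<Sum>k\<in>{-int (Suc N)..int (Suc N)} - {0}.
    fst p (pi * of_int k / real (Suc N)) * indicator {x \<in> freqs - {0}. sgn x * of_int \<lceil>real (Suc N) * \<bar>x\<bar> / pi\<rceil> = real_of_int k} (snd p))"
  have G: "G N (f, x) = (if x \<in> freqs - {0} then f (r N x) else 0)" for N f x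
  proof (cases "x \<in> freqs - {0}")
    case True
    define K where "K = real (Suc N)"
    have K: "0 < K" by (simp add: K_def)
    obtain k :: int where k: "sgn x * of_int \<lceil>K * \<bar>x\<bar> / pi\<rceil> = real_of_int k"
    proof (cases "0 < x")
      case True then show thesis using that[of "\<lceil>K * \<bar>x\<bar> / pi\<rceil>"] by simp
    next
      case False then show thesis using that[of "- \<lceil>K * \<bar>x\<bar> / pi\<rceil>"] \<open>x \<in> freqs - {0}\<close> by (simp add: sgn_if)
    qed
    have "r N x = pi * (sgn x * of_int \<lceil>K * \<bar>x\<bar> / pi\<rceil>) / K"
      unfolding r_def K_def by (simp only: mult_ac)
    then have rk: "r N x = pi * of_int k / K" unfolding k .
    have "\<bar>pi * of_int k / K\<bar> \<le> pi" "k \<noteq> 0" using r_in[OF True, of N] unfolding rk by (auto simp: abs_le_iff)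
    then have "\<bar>real_of_int k\<bar> \<le> K" using K by (simp add: abs_mult pos_divide_le_eq)
    then have kin: "k \<in> {-int (Suc N)..int (Suc N)} - {0}" using \<open>k \<noteq> 0\<close> by (auto simp: K_def)
    have "G N (f, x) = (\<Sum>j\<in>{-int (Suc N)..int (Suc N)} - {0}. if j = k then f (pi * of_int k / K) else 0)"
      unfolding G_def using True k by (intro sum.cong refl) (auto simp: K_def indicator_def)
    also have "\<dots> = f (r N x)" using kin by (simp add: rk)
    finally show ?thesis using True by simp
  next
    case False
    then have "indicator {x \<in> freqs - {0}. Q x} x = (0::real)" for Q by (simp add: indicator_def)
    then have "G N (f, x) = 0" unfolding G_def snd_conv by (intro sum.neutral) simp
    then show ?thesis using False by (simp only: if_False)
  qed
  show ?thesis
  proof (rule borel_measurable_LIMSEQ_real)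
    show "G N \<in> borel_measurable (\<pi> \<Otimes>\<^sub>M borel)" for N
      unfolding G_def
    proof (intro borel_measurable_sum borel_measurable_times)
      fix k assume k: "k \<in> {-int (Suc N)..int (Suc N)} - {0}"
      have "\<bar>real_of_int k\<bar> \<le> real (Suc N)" using k by auto
      then have "\<bar>pi * of_int k / real (Suc N)\<bar> \<le> pi" by (simp add: abs_mult pos_divide_le_eq)
      then have "pi * of_int k / real (Suc N) \<le> pi" "- pi \<le> pi * of_int k / real (Suc N)"
        unfolding abs_le_iff by linarith+
      then have "pi * of_int k / real (Suc N) \<in> freqs - {0}" using k by simp
      from evaluation_measurable[OF this]
      show "(\<lambda>p. fst p (pi * of_int k / real (Suc N))) \<in> borel_measurable (\<pi> \<Otimes>\<^sub>M borel)"
        using measurable_compose[OF measurable_fst] by blast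
      have "{x \<in> freqs - {0}. sgn x * of_int \<lceil>real (Suc N) * \<bar>x\<bar> / pi\<rceil> = real_of_int k} \<in> sets borel"
        by measurable
      then show "(\<lambda>p. indicator {x \<in> freqs - {0}. sgn x * of_int \<lceil>real (Suc N) * \<bar>x\<bar> / pi\<rceil> = real_of_int k} (snd p))
          \<in> borel_measurable (\<pi> \<Otimes>\<^sub>M borel)"
        by measurable
    qed
    fix p assume "p \<in> space (\<pi> \<Otimes>\<^sub>M (borel :: real measure))"
    then obtain f x where p: "p = (f, x)" and f: "f \<in> space \<pi>" by (auto simp: space_pair_measure)
    show "(\<lambda>N. G N p) \<longlonglongrightarrow> (case p of (f, x) \<Rightarrow> if x \<in> freqs - {0} then f x else 0)"
    proof (cases "x \<in> freqs - {0}")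
      case True
      have "continuous_on (freqs - {0}) f" using power_bounded_space[OF f] by (simp add: power_bounded_def)
      then have "(\<lambda>N. f (r N x)) \<longlonglongrightarrow> f x"
        by (rule continuous_on_tendsto_compose[OF _ rlim[OF True] True]) (use r_in[OF True] in simp)
      then show ?thesis using True by (simp add: p G)
    next
      case False
      then show ?thesis by (simp only: p G if_False prod.case tendsto_const)
    qed
  qed
qed

lemma toeplitz_index_measurable:
  assumes "i < n" "j < n"
  shows "(\<lambda>f. toeplitz n f $$ (i, j)) \<in> borel_measurable \<pi>"
proof -
  interpret FQ: finite_measure FQ by (rule finite_measure_FQ)
  let ?c = "\<lambda>x. cos ((real i - real j) * x)"
  have id: "(\<lambda>x. x) \<in> measurable FQ borel"
    by (intro measurable_restrict_space1 measurable_completion) simp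
  have "(\<lambda>p. (fst p, snd p)) \<in> measurable (\<pi> \<Otimes>\<^sub>M FQ) (\<pi> \<Otimes>\<^sub>M borel)"
    by (intro measurable_Pair measurable_fst measurable_compose[OF measurable_snd id])
  from measurable_compose[OF this joint_evaluation_measurable]
  have m1: "(\<lambda>p. if snd p \<in> freqs - {0} then fst p (snd p) else 0) \<in> borel_measurable (\<pi> \<Otimes>\<^sub>M FQ)"
    by (simp add: case_prod_unfold)
  have "(\<lambda>p. snd p) \<in> measurable (\<pi> \<Otimes>\<^sub>M FQ) borel" by (rule measurable_compose[OF measurable_snd id])
  then have "(\<lambda>p. (if snd p \<in> freqs - {0} then fst p (snd p) else 0) * ?c (snd p)) \<in> borel_measurable (\<pi> \<Otimes>\<^sub>M FQ)"
    using m1 by measurable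
  then have "(\<lambda>f. \<integral>x. (if x \<in> freqs - {0} then f x else 0) * ?c x \<partial>FQ) \<in> borel_measurable \<pi>"
    by (intro FQ.borel_measurable_lebesgue_integral) (simp add: case_prod_unfold)
  then show ?thesis
  proof (rule measurable_cong[THEN iffD1, rotated])
    fix f assume f: "f \<in> space \<pi>"
    have pb: "power_bounded f (exponent f) m M" by (rule power_bounded_space[OF f])
    note fm = borel_measurable_integrable[OF power_bounded_integrable[OF pb]]
    have cm: "?c \<in> borel_measurable FQ" using id by measurable
    have "(\<integral>x. (if x \<in> freqs - {0} then f x else 0) * ?c x \<partial>FQ) = (\<integral>x. f x * ?c x \<partial>FQ)"
    proof (rule integral_cong_AE)
      have "(\<lambda>x. if x \<in> freqs - {0} then f x else 0) \<in> borel_measurable FQ"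
        using fm by (intro measurable_If_set) (auto simp: sets_restrict_space_iff)
      then show "(\<lambda>x. (if x \<in> freqs - {0} then f x else 0) * ?c x) \<in> borel_measurable FQ" using cm by simp
      show "(\<lambda>x. f x * ?c x) \<in> borel_measurable FQ" using fm cm by simp
    qed (rule AE_FQI, simp)
    then show "(\<integral>x. (if x \<in> freqs - {0} then f x else 0) * ?c x \<partial>FQ) = toeplitz n f $$ (i, j)"
      using assms by (simp add: toeplitz_index[OF power_bounded_integrable[OF pb]])
  qed
qed

lemma lik_joint_measurable:
  "(\<lambda>(x, f). lik n f x) \<in> borel_measurable (obs_space n \<Otimes>\<^sub>M \<pi>)"
proof -
  have d: "(\<lambda>f. mdet (toeplitz n f)) \<in> borel_measurable \<pi>"
    by (rule det_measurable[OF toeplitz_carrier toeplitz_index_measurable])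
  have i: "(\<lambda>f. minv (toeplitz n f) $$ (i, j)) \<in> borel_measurable \<pi>" if "i < n" "j < n" for i j
    by (rule minv_measurable[OF toeplitz_carrier pos_def_space toeplitz_index_measurable that])
  have comp: "(\<lambda>p. fst p i) \<in> borel_measurable (obs_space n \<Otimes>\<^sub>M \<pi>)" if "i < n" for i
    using measurable_compose[OF measurable_fst measurable_component_singleton[of i "{..<n}" "\<lambda>_. lborel"]] that by simp
  have q: "(\<lambda>p. qform n (minv (toeplitz n (snd p))) (fst p)) \<in> borel_measurable (obs_space n \<Otimes>\<^sub>M \<pi>)"
    unfolding qform_def
    by (intro borel_measurable_sum borel_measurable_times measurable_compose[OF measurable_snd i] comp) auto
  have "(\<lambda>p. (2 * pi) powr (- real n / 2) * mdet (toeplitz n (snd p)) powr (- 1 / 2) *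
     exp (- qform n (minv (toeplitz n (snd p))) (fst p) / 2)) \<in> borel_measurable (obs_space n \<Otimes>\<^sub>M \<pi>)"
    using q measurable_compose[OF measurable_snd d] by measurable
  then show ?thesis
    by (rule measurable_cong[THEN iffD1, rotated]) (auto simp: space_pair_measure lik_qform pos_def_space)
qed

text \<open>All densities in the support dominate a multiple of \<open>|x|\<close>, hence the likelihood is bounded.\<close>

lemma lik_bounded: "\<exists>K. \<forall>f\<in>space \<pi>. lik n f x \<le> K"
proof -
  \<comment> \<open>As \<open>1 + 2 * d\<close> lies between 0 and 2,
    \<open>\<bar>x\<bar> powr (1 + 2 * d)\<close> is at most \<open>pi\<^sup>2\<close> for every
    admissible \<open>d\<close>; this is the origin of the constant.\<close>
  define p where "p = (\<lambda>x. m / pi\<^sup>2 * \<bar>x\<bar>)"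
  obtain f1 where "f1 \<in> space \<pi>" using not_empty by blast
  from power_bounded_space[OF this] have m: "0 < m" by (simp add: power_bounded_def)
  have pint: "integrable FQ p" unfolding p_def by (intro continuous_imp_integrable_real continuous_intros)
  have pp: "AE x in FQ. 0 < p x" by (rule AE_FQI) (use m in \<open>auto simp: p_def\<close>)
  define K where "K = (2 * pi) powr (- real n / 2) * mdet (toeplitz n p) powr (- 1 / 2)"
  have "lik n f x \<le> K" if f: "f \<in> space \<pi>" for f
  proof -
    define d where "d = exponent f"
    have pb: "power_bounded f d m M" unfolding d_def by (rule power_bounded_space[OF f])
    have "AE x in FQ. p x \<le> f x"
    proof (rule AE_FQI)
      fix x assume x: "x \<in> freqs - {0}"
      have xp: "0 < \<bar>x\<bar>" "\<bar>x\<bar> \<le> pi" using x by auto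
      have d: "- 1/2 < d" "d < 1/2" using pb by (auto simp: power_bounded_def)
      have "\<bar>x\<bar> / pi\<^sup>2 \<le> pole d x"
      proof -
        have "\<bar>x\<bar> powr (1 + 2 * d) \<le> pi powr (1 + 2 * d)" using xp d by (intro powr_mono2) auto
        also have "\<dots> \<le> pi powr 2" using d pi_ge_two by (intro powr_mono) auto
        finally have "\<bar>x\<bar> powr (1 + 2 * d) \<le> pi\<^sup>2" by simp
        then have "\<bar>x\<bar> powr (1 + 2 * d) * pole d x \<le> pi\<^sup>2 * pole d x"
          by (rule mult_right_mono) simp
        then show ?thesis using xp by (simp add: powr_add[symmetric] pos_divide_le_eq mult.commute)
      qed
      then have "m * (\<bar>x\<bar> / pi\<^sup>2) \<le> m * pole d x" using m by (intro mult_left_mono) auto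
      also have "\<dots> \<le> f x" using pb x by (auto simp: power_bounded_def)
      finally show "p x \<le> f x" by (simp add: p_def)
    qed
    then have "mdet (toeplitz n p) \<le> mdet (toeplitz n f)"
      by (intro det_toeplitz_mono pint pp power_bounded_integrable[OF pb])
    then have "mdet (toeplitz n f) powr (- 1 / 2) \<le> mdet (toeplitz n p) powr (- 1 / 2)"
      using pos_def_det_pos[OF pos_def_toeplitz[OF pint pp]] by (intro powr_mono2') auto
    moreover have "exp (- qform n (minv (toeplitz n f)) x / 2) \<le> 1"
      using pos_def_qform_nonneg[OF pos_def_minv[OF pos_def_space[OF f, of n]], of x] by simp
    ultimately have "(2 * pi) powr (- real n / 2) * mdet (toeplitz n f) powr (- 1 / 2) *
        exp (- qform n (minv (toeplitz n f)) x / 2) \<le> K * 1"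
      unfolding K_def by (intro mult_mono mult_left_mono) auto
    then show ?thesis by (simp add: lik_qform[OF pos_def_space[OF f]])
  qed
  then show ?thesis by blast
qed

lemma lik_prior_measurable: "(\<lambda>f. lik n f x) \<in> borel_measurable \<pi>"
proof -
  have "restrict x {..<n} \<in> space (obs_space n)" by (simp add: space_PiM)
  from measurable_compose[OF measurable_Pair1'[OF this] lik_joint_measurable] show ?thesis
    by (simp add: lik_restrict)
qed

lemma lik_prior_integrable: "integrable \<pi> (\<lambda>f. lik n f x)"
proof -
  obtain K where K: "\<forall>f\<in>space \<pi>. lik n f x \<le> K" using lik_bounded by blast
  show ?thesis
  proof (rule integrable_const_bound[where B = K])
    show "AE f in \<pi>. norm (lik n f x) \<le> K"
      using K by (intro AE_I2) (simp add: lik_pos[OF pos_def_space] less_imp_le)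
  qed (rule lik_prior_measurable)
qed

end

subsection \<open>Prior evidence\<close>

lemma freq_integral_eq:
  assumes "AE x in FQ. x \<notin> Z"
  shows "freq_integral Z g = (\<integral>\<^sup>+x. ennreal (g x) \<partial>FQ)"
proof -
  have "freq_integral Z g = (\<integral>\<^sup>+x. (if x \<in> Z then \<infinity> else ennreal (g x)) \<partial>FQ)"
    unfolding freq_integral_def by (rule nn_integral_restrict_space[symmetric]) simp
  also have "\<dots> = (\<integral>\<^sup>+x. ennreal (g x) \<partial>FQ)"
    by (rule nn_integral_cong_AE) (use assms in eventually_elim, simp)
  finally show ?thesis .
qed

lemma h_disc_eq:
  assumes f0: "power_bounded f0 d0 m0 M0" and f: "power_bounded f d m M"
  shows "h_disc f0 f = ennreal (1 / (2 * pi)) * (\<integral>\<^sup>+x. ennreal (f0 x / f x + f x / f0 x - 2) \<partial>FQ)"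
proof -
  have "AE x in FQ. x \<notin> {x. f0 x = 0 \<or> f x = 0}"
    using power_bounded_AE_pos[OF f0] power_bounded_AE_pos[OF f] by eventually_elim auto
  then show ?thesis unfolding h_disc_def by (simp add: freq_integral_eq)
qed

text \<open>The value 3 makes \<open>z + 1 / z - 2\<close> at least 1 for the ratio
  \<open>z\<close>. The two densities are later used in either order.\<close>

lemma ratio_ge_of_exponents:
  assumes f0: "power_bounded f0 d0 m0 M0" and f: "power_bounded f d m M"
    and a: "0 < a" "a \<le> d - d0" and \<delta>: "0 < \<delta>" "\<delta> \<le> 1" "3 \<le> m / M0 * \<delta> powr (- 2 * a)"
    and x: "x \<in> freqs - {0}" "\<bar>x\<bar> \<le> \<delta>"
  shows "3 \<le> f x / f0 x"
proof -
  have m: "0 < m" "0 < M0" using f f0 power_bounded_upper_pos by (auto simp: power_bounded_def)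
  note p = power_bounded_pos[OF f0 x(1)]
  have xp: "0 < \<bar>x\<bar>" using x by auto
  have "\<delta> powr (- 2 * a) \<le> pole a x" using xp x a by (intro powr_mono2') auto
  also have "\<dots> \<le> pole (d - d0) x" using xp x \<delta> a by (intro powr_mono') auto
  finally have "m / M0 * \<delta> powr (- 2 * a) \<le> m / M0 * pole (d - d0) x"
    using m by (intro mult_left_mono) auto
  with \<delta>(3) have 1: "3 \<le> m / M0 * pole (d - d0) x" by linarith
  have "3 * f0 x \<le> (m / M0 * pole (d - d0) x) * (M0 * pole d0 x)"
    using 1 p f0 x by (intro mult_mono) (auto simp: power_bounded_def)
  also have "\<dots> = m * pole d x"
    using m by (simp add: mult.left_commute powr_add[symmetric] algebra_simps)
  also have "\<dots> \<le> f x" using f x by (auto simp: power_bounded_def)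
  finally show ?thesis using p by (simp add: pos_le_divide_eq)
qed

text \<open>If the exponents are at least \<open>a\<close> apart, one of the two ratios is at least
  3 on a band \<open>|x| \<le> \<delta>\<close> determined by \<open>a\<close> and the bounds alone.
  Then \<open>h_disc\<close> is at least \<open>\<delta> / pi\<close>, twice the threshold
  chosen.\<close>

lemma h_disc_small_imp_exponent_close:
  assumes f0: "power_bounded f0 d0 m0 M0" and m: "0 < m" "0 < M" and a: "0 < a"
  shows "\<exists>\<epsilon>>0. \<forall>f d. power_bounded f d m M \<and> h_disc f0 f \<le> ennreal \<epsilon> \<longrightarrow> \<bar>d - d0\<bar> < a"
proof -
  have m0: "0 < m0" "0 < M0" using f0 power_bounded_upper_pos by (auto simp: power_bounded_def)
  define c where "c = min (m / M0) (m0 / M)"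
  have c: "0 < c" using m m0 by (simp add: c_def)
  \<comment> \<open>Without the cap this solves \<open>c * \<delta> powr (- 2 * a) = 3\<close>; the
    cap 1 lets larger exponent gaps only increase the ratio.\<close>
  define \<delta> where "\<delta> = min 1 ((3 / c) powr (- 1 / (2 * a)))"
  have \<delta>: "0 < \<delta>" "\<delta> \<le> 1" using c by (auto simp: \<delta>_def)
  have "3 \<le> c * \<delta> powr (- 2 * a)"
  proof -
    have "3 / c = (3 / c) powr (- 1 / (2 * a) * (- 2 * a))" using c a by simp
    also have "\<dots> = ((3 / c) powr (- 1 / (2 * a))) powr (- 2 * a)" by (rule powr_powr[symmetric])
    also have "\<dots> \<le> \<delta> powr (- 2 * a)" using \<delta> a by (intro powr_mono2') (auto simp: \<delta>_def)
    finally show ?thesis using c by (simp add: pos_divide_le_eq mult.commute)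
  qed
  moreover have "c * \<delta> powr (- 2 * a) \<le> m / M0 * \<delta> powr (- 2 * a)" "c * \<delta> powr (- 2 * a) \<le> m0 / M * \<delta> powr (- 2 * a)"
    by (rule mult_right_mono; simp add: c_def)+
  ultimately have \<delta>3: "3 \<le> m / M0 * \<delta> powr (- 2 * a)" "3 \<le> m0 / M * \<delta> powr (- 2 * a)" by linarith+
  have "\<bar>d - d0\<bar> < a" if f: "power_bounded f d m M" and h: "h_disc f0 f \<le> ennreal (\<delta> / (2 * pi))" for f d
  proof (rule ccontr)
    assume "\<not> \<bar>d - d0\<bar> < a"
    then have far: "a \<le> d - d0 \<or> a \<le> d0 - d" by linarith
    have "{-\<delta>..\<delta>} \<in> sets FQ" using \<delta> pi_ge_two by (subst sets_restrict_space_iff) auto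
    moreover have "emeasure FQ {-\<delta>..\<delta>} = ennreal (2 * \<delta>)"
      using \<delta> pi_ge_two by (subst emeasure_restrict_space) auto
    ultimately have "ennreal (2 * \<delta>) = (\<integral>\<^sup>+x. indicator {-\<delta>..\<delta>} x \<partial>FQ)" by simp
    also have "\<dots> \<le> (\<integral>\<^sup>+x. ennreal (f0 x / f x + f x / f0 x - 2) \<partial>FQ)"
    proof (rule nn_integral_mono_AE, rule AE_FQI)
      fix x assume x: "x \<in> freqs - {0}"
      show "indicator {-\<delta>..\<delta>} x \<le> ennreal (f0 x / f x + f x / f0 x - 2)"
      proof (cases "x \<in> {-\<delta>..\<delta>}")
        case True
        then have x\<delta>: "\<bar>x\<bar> \<le> \<delta>" by auto
        have "0 < f x / f0 x" "0 < f0 x / f x"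
          using power_bounded_pos[OF f0 x] power_bounded_pos[OF f x] by auto
        moreover from far have "3 \<le> f x / f0 x \<or> 3 \<le> f0 x / f x"
          using ratio_ge_of_exponents[OF f0 f a _ \<delta> \<delta>3(1) x x\<delta>] ratio_ge_of_exponents[OF f f0 a _ \<delta> \<delta>3(2) x x\<delta>] by blast
        ultimately have "1 \<le> f0 x / f x + f x / f0 x - 2" by linarith
        then show ?thesis using True by (simp add: ennreal_leI flip: ennreal_1)
      qed simp
    qed
    finally have "ennreal (1 / (2 * pi)) * ennreal (2 * \<delta>) \<le> h_disc f0 f"
      unfolding h_disc_eq[OF f0 f] by (intro mult_left_mono) auto
    then have "ennreal (1 / (2 * pi) * (2 * \<delta>)) \<le> ennreal (\<delta> / (2 * pi))"
      using order_trans[OF _ h] \<delta> by (simp add: ennreal_mult'[symmetric] del: times_divide_eq_left times_divide_eq_right)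
    then have "1 / (2 * pi) * (2 * \<delta>) \<le> \<delta> / (2 * pi)" using \<delta> by (subst (asm) ennreal_le_iff) auto
    then show False using \<delta> by (simp add: field_simps)
  qed
  then show ?thesis using \<delta> by (intro exI[of _ "\<delta> / (2 * pi)"]) auto
qed

text \<open>Close exponents make both ratios integrable, so the integral splits into the two terms
  that the likelihood bound contains.\<close>

lemma h_disc_integral_le:
  assumes f0: "power_bounded f0 d0 m0 M0" and f: "power_bounded f d m M"
    and d: "\<bar>d - d0\<bar> < 1/2" and h: "h_disc f0 f \<le> ennreal \<epsilon>" and \<epsilon>: "0 \<le> \<epsilon>"
  shows "(\<integral>x. f0 x / f x \<partial>FQ) / (2 * pi) + (\<integral>x. f x / f0 x \<partial>FQ) / (2 * pi) - 2 \<le> \<epsilon>"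
proof -
  have d': "\<bar>d0 - d\<bar> < 1/2" using d by linarith
  note i = power_bounded_trace(1)[OF f0 f d'] power_bounded_trace(1)[OF f f0 d]
  have ii: "integrable FQ (\<lambda>x. f0 x / f x + f x / f0 x - 2)"
    by (intro Bochner_Integration.integrable_diff Bochner_Integration.integrable_add i integrable_FQ_const)
  have nn: "AE x in FQ. 0 \<le> f0 x / f x + f x / f0 x - 2"
  proof (rule AE_FQI)
    fix x assume x: "x \<in> freqs - {0}"
    note p = power_bounded_pos[OF f0 x] power_bounded_pos[OF f x]
    have "f0 x / f x + f x / f0 x - 2 = (f0 x - f x)\<^sup>2 / (f0 x * f x)"
      using p by (simp add: power2_eq_square field_simps)
    then show "0 \<le> f0 x / f x + f x / f0 x - 2" using p by simp
  qed
  define I where "I = (\<integral>x. f0 x / f x + f x / f0 x - 2 \<partial>FQ)"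
  have "I = (\<integral>x. f0 x / f x \<partial>FQ) + (\<integral>x. f x / f0 x \<partial>FQ) - 2 * pi * 2"
    unfolding I_def using i by (simp add: integrable_FQ_const measure_FQ)
  then have eq: "(\<integral>x. f0 x / f x \<partial>FQ) / (2 * pi) + (\<integral>x. f x / f0 x \<partial>FQ) / (2 * pi) - 2 = 1 / (2 * pi) * I"
    by (simp add: field_simps)
  have "h_disc f0 f = ennreal (1 / (2 * pi)) * ennreal I"
    unfolding h_disc_eq[OF f0 f] I_def by (simp add: nn_integral_eq_integral[OF ii nn])
  also have "\<dots> = ennreal (1 / (2 * pi) * I)" by (simp add: ennreal_mult'[symmetric])
  finally show ?thesis using h \<epsilon> unfolding eq by (metis ennreal_le_iff)
qed

context regular_prior
begin

text \<open>The unnormalised posterior mass, with values in \<open>ennreal\<close> so that Tonelli's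
  theorem applies directly.\<close>

definition evidence :: "nat \<Rightarrow> (nat \<Rightarrow> real) \<Rightarrow> (real \<Rightarrow> real) set \<Rightarrow> ennreal" where
  "evidence n x B = (\<integral>\<^sup>+f\<in>B. ennreal (lik n f x) \<partial>\<pi>)"

lemma evidence_restrict: "evidence n (restrict x {..<n}) B = evidence n x B"
  by (simp add: evidence_def lik_restrict)

lemma sigma_finite_obs: "sigma_finite_measure (obs_space n)"
proof -
  interpret product_sigma_finite "\<lambda>_::nat. lborel :: real measure" ..
  show ?thesis by (rule sigma_finite) simp
qed

lemma evidence_measurable:
  assumes [measurable]: "B \<in> sets \<pi>"
  shows "(\<lambda>x. evidence n x B) \<in> borel_measurable (obs_space n)"
proof -
  have [measurable]: "(\<lambda>(x, f). lik n f x) \<in> borel_measurable (obs_space n \<Otimes>\<^sub>M \<pi>)" by (rule lik_joint_measurable)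
  show ?thesis unfolding evidence_def by measurable
qed

text \<open>By Tonelli, the integral of the evidence of \<open>B\<close> over the acceptance region averages the type II errors.\<close>

lemma evidence_tested:
  assumes X: "gaussian_process P X f0" and pd0: "\<And>n. pos_def n (toeplitz n f0)"
    and B: "B \<in> sets \<pi>" and \<delta>: "0 < \<delta>" and W: "\<And>n. W n \<in> sets (obs_space n)"
    and type_I: "\<forall>\<^sub>F n in sequentially. lik_mass n f0 (W n) \<le> ennreal (exp (- real n * \<delta>))"
    and type_II: "\<forall>\<^sub>F n in sequentially. \<forall>f\<in>B. lik_mass n f (space (obs_space n) - W n) \<le> ennreal (exp (- real n * \<delta>))"
  shows "AE \<omega> in P. \<forall>\<^sub>F n in sequentially.
    evidence n (\<lambda>i. X i \<omega>) B \<le> ennreal (exp (- real n * (\<delta> / 2)) * lik n f0 (\<lambda>i. X i \<omega>))"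
proof -
  \<comment> \<open>On \<open>V n\<close> the test accepts although the evidence is too large. Half
    of the rate \<open>\<delta>\<close> is spent in this threshold; Markov's inequality leaves the
    other half for the Borel-Cantelli lemma.\<close>
  define V where "V = (\<lambda>n. {x \<in> space (obs_space n). x \<notin> W n \<and> ennreal (exp (- real n * (\<delta> / 2)) * lik n f0 x) < evidence n x B})"
  note l0m = lik_measurable[OF pd0]
  have V: "V n \<in> sets (obs_space n)" for n
    unfolding V_def using l0m[of n] evidence_measurable[OF B, of n] W[of n] by measurable
  have ev: "\<forall>\<^sub>F n in sequentially. lik_mass n f0 (W n \<union> V n) \<le> ennreal (2 * exp (- real n * (\<delta> / 2)))"
    using type_I type_II
  proof eventually_elim
    case (elim n)
    interpret obs: sigma_finite_measure "obs_space n" by (rule sigma_finite_obs)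
    interpret pair_sigma_finite "obs_space n" \<pi> ..
    let ?E = "exp (real n * (\<delta> / 2))"
    have "lik_mass n f0 (V n) \<le>
        (\<integral>\<^sup>+x. ennreal ?E * (evidence n x B * indicator (space (obs_space n) - W n) x) \<partial>obs_space n)"
    proof (rule nn_integral_mono)
      fix x assume x: "x \<in> space (obs_space n)"
      show "ennreal (lik n f0 x) * indicator (V n) x \<le> ennreal ?E * (evidence n x B * indicator (space (obs_space n) - W n) x)"
      proof (cases "x \<in> V n")
        case True
        then have xW: "x \<notin> W n" and le: "ennreal (exp (- real n * (\<delta> / 2)) * lik n f0 x) \<le> evidence n x B"
          by (auto simp: V_def)
        have "ennreal (lik n f0 x) = ennreal ?E * ennreal (exp (- real n * (\<delta> / 2)) * lik n f0 x)"
          by (simp add: ennreal_mult'[symmetric] mult.assoc[symmetric] exp_add[symmetric])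
        also have "\<dots> \<le> ennreal ?E * evidence n x B" using le by (rule mult_left_mono) simp
        finally show ?thesis using True xW x by simp
      qed simp
    qed
    also have "\<dots> = ennreal ?E * (\<integral>\<^sup>+x. evidence n x B * indicator (space (obs_space n) - W n) x \<partial>obs_space n)"
      by (intro nn_integral_cmult borel_measurable_times_ennreal evidence_measurable[OF B]
          borel_measurable_indicator sets.Diff sets.top W)
    also have "(\<integral>\<^sup>+x. evidence n x B * indicator (space (obs_space n) - W n) x \<partial>obs_space n) =
        (\<integral>\<^sup>+x. (\<integral>\<^sup>+f. ennreal (lik n f x) * indicator B f * indicator (space (obs_space n) - W n) x \<partial>\<pi>) \<partial>obs_space n)"
      unfolding evidence_def using lik_prior_measurable B by (intro nn_integral_cong nn_integral_multc[symmetric]) simp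
    also have "\<dots> = (\<integral>\<^sup>+f. (\<integral>\<^sup>+x. ennreal (lik n f x) * indicator B f * indicator (space (obs_space n) - W n) x \<partial>obs_space n) \<partial>\<pi>)"
    proof (rule Fubini'[symmetric])
      have [measurable]: "(\<lambda>(x, f). lik n f x) \<in> borel_measurable (obs_space n \<Otimes>\<^sub>M \<pi>)" by (rule lik_joint_measurable)
      note [measurable] = B W
      show "(\<lambda>(x, f). ennreal (lik n f x) * indicator B f * indicator (space (obs_space n) - W n) x) \<in> borel_measurable (obs_space n \<Otimes>\<^sub>M \<pi>)"
        by measurable
    qed
    also have "\<dots> \<le> (\<integral>\<^sup>+f. ennreal (exp (- real n * \<delta>)) \<partial>\<pi>)"
    proof (rule nn_integral_mono)
      fix f assume "f \<in> space \<pi>"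
      show "(\<integral>\<^sup>+x. ennreal (lik n f x) * indicator B f * indicator (space (obs_space n) - W n) x \<partial>obs_space n) \<le> ennreal (exp (- real n * \<delta>))"
        using elim(2) by (cases "f \<in> B") auto
    qed
    also have "\<dots> = ennreal (exp (- real n * \<delta>))" by (simp add: emeasure_space_1)
    also have "ennreal ?E * \<dots> = ennreal (exp (- real n * (\<delta> / 2)))"
      by (simp add: ennreal_mult'[symmetric] exp_add[symmetric] field_simps)
    finally have 2: "lik_mass n f0 (V n) \<le> ennreal (exp (- real n * (\<delta> / 2)))"
      by (simp add: mult_left_mono)
    have "lik_mass n f0 (W n) \<le> ennreal (exp (- real n * (\<delta> / 2)))"
      using elim(1) by (rule order_trans) (use \<delta> in \<open>simp add: ennreal_leI field_simps\<close>)
    with 2 have s: "lik_mass n f0 (W n) + lik_mass n f0 (V n) \<le>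
        ennreal (exp (- real n * (\<delta> / 2))) + ennreal (exp (- real n * (\<delta> / 2)))" by (intro add_mono)
    have "lik_mass n f0 (W n \<union> V n) \<le>
        (\<integral>\<^sup>+x. ennreal (lik n f0 x) * indicator (W n) x + ennreal (lik n f0 x) * indicator (V n) x \<partial>obs_space n)"
      by (intro nn_integral_mono) (auto simp: indicator_def)
    also have "\<dots> = lik_mass n f0 (W n) + lik_mass n f0 (V n)"
      using l0m[of n] W[of n] V[of n] by (intro nn_integral_add) auto
    also note s
    finally show ?case by (simp add: ennreal_plus[symmetric] del: ennreal_plus)
  qed
  have "AE \<omega> in P. \<forall>\<^sub>F n in sequentially. restrict (\<lambda>i. X i \<omega>) {..<n} \<notin> W n \<union> V n"
    by (rule gaussian_process_eventually_not_in[OF X _ ev]) (use W V summable_exp_linear[of "\<delta> / 2"] \<delta> in auto)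
  then show ?thesis
  proof eventually_elim
    case (elim \<omega>)
    then show ?case
    proof eventually_elim
      case (elim n)
      have "restrict (\<lambda>i. X i \<omega>) {..<n} \<in> space (obs_space n)" by (simp add: space_PiM)
      with elim show ?case by (auto simp: V_def lik_restrict evidence_restrict not_less)
    qed
  qed
qed

text \<open>The ratio bound holds from an index on that depends on \<open>f\<close> and on the
  outcome. Exchanging the two almost-sure quantifiers fixes the outcome first; then the sets
  \<open>G N\<close> of densities for which \<open>N\<close> suffices cover almost all of
  \<open>B\<close>, so one of them has positive mass, and this mass is \<open>c\<close>.\<close>

lemma evidence_lower:
  assumes X: "gaussian_process P X f0" and pd0: "\<And>n. pos_def n (toeplitz n f0)"
    and B: "B \<in> sets \<pi>" "0 < emeasure \<pi> B"
    and ratio: "\<And>f. f \<in> B \<Longrightarrow> AE \<omega> in P. \<forall>\<^sub>F n in sequentially.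
      exp (- real n * \<kappa>) * lik n f0 (\<lambda>i. X i \<omega>) \<le> lik n f (\<lambda>i. X i \<omega>)"
  shows "AE \<omega> in P. \<exists>c>0. \<forall>\<^sub>F n in sequentially.
    ennreal (c * (exp (- real n * \<kappa>) * lik n f0 (\<lambda>i. X i \<omega>))) \<le> evidence n (\<lambda>i. X i \<omega>) (space \<pi>)"
proof -
  interpret P: prob_space P using X by (simp add: gaussian_process_def)
  interpret pair_sigma_finite P \<pi> ..
  define Q where "Q = (\<lambda>n \<omega> f. exp (- real n * \<kappa>) * lik n f0 (\<lambda>i. X i \<omega>) \<le> lik n f (\<lambda>i. X i \<omega>))"
  have Xm: "(\<lambda>\<omega>. \<lambda>i\<in>{..<n}. X i \<omega>) \<in> measurable P (obs_space n)" for n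
    using X distributed_measurable unfolding gaussian_process_def by blast
  have lm: "(\<lambda>p. lik n (snd p) (\<lambda>i. X i (fst p))) \<in> borel_measurable (P \<Otimes>\<^sub>M \<pi>)" for n
  proof -
    have "(\<lambda>p. (\<lambda>i\<in>{..<n}. X i (fst p), snd p)) \<in> measurable (P \<Otimes>\<^sub>M \<pi>) (obs_space n \<Otimes>\<^sub>M \<pi>)"
      by (intro measurable_Pair measurable_snd measurable_compose[OF measurable_fst Xm])
    from measurable_compose[OF this lik_joint_measurable] show ?thesis by (simp add: lik_restrict)
  qed
  have l0m: "(\<lambda>\<omega>. lik n f0 (\<lambda>i. X i \<omega>)) \<in> borel_measurable P" for n
    using measurable_compose[OF Xm lik_measurable[OF pd0]] by (simp add: lik_restrict)
  have Qm: "Measurable.pred (P \<Otimes>\<^sub>M \<pi>) (\<lambda>p. Q n (fst p) (snd p))" for n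
    unfolding Q_def using lm[of n] measurable_compose[OF measurable_fst l0m[of n], of \<pi>] by measurable
  have "AE f in \<pi>. AE \<omega> in P. f \<in> B \<longrightarrow> (\<forall>\<^sub>F n in sequentially. Q n \<omega> f)"
  proof (rule AE_I2)
    fix f
    show "AE \<omega> in P. f \<in> B \<longrightarrow> (\<forall>\<^sub>F n in sequentially. Q n \<omega> f)"
      using ratio[of f] by (cases "f \<in> B") (simp_all add: Q_def)
  qed
  moreover have "{p \<in> space (P \<Otimes>\<^sub>M \<pi>). snd p \<in> B \<longrightarrow> (\<forall>\<^sub>F n in sequentially. Q n (fst p) (snd p))} \<in> sets (P \<Otimes>\<^sub>M \<pi>)"
    unfolding eventually_sequentially using Qm B(1) by measurable
  ultimately have "AE \<omega> in P. AE f in \<pi>. f \<in> B \<longrightarrow> (\<forall>\<^sub>F n in sequentially. Q n \<omega> f)"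
    by (subst AE_commute)
  moreover have "AE \<omega> in P. \<omega> \<in> space P" by simp
  ultimately show ?thesis
  proof eventually_elim
    case (elim \<omega>)
    define G where "G = (\<lambda>N. {f \<in> space \<pi>. f \<in> B \<and> (\<forall>n\<ge>N. Q n \<omega> f)})"
    have Qf: "Measurable.pred \<pi> (\<lambda>f. Q n \<omega> f)" for n
      using measurable_compose[OF measurable_Pair1'[OF elim(2)] Qm[of n]] by simp
    have G: "G N \<in> sets \<pi>" for N unfolding G_def using Qf B(1) by measurable
    have "emeasure \<pi> B \<le> emeasure \<pi> (\<Union>N. G N)"
    proof (rule emeasure_mono_AE)
      show "AE f in \<pi>. f \<in> B \<longrightarrow> f \<in> (\<Union>N. G N)"
        using elim(1) AE_space by eventually_elim (auto simp: G_def eventually_sequentially)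
    qed (use G in auto)
    then have "emeasure \<pi> (\<Union>N. G N) \<noteq> 0" using B(2) by auto
    then obtain N where N: "emeasure \<pi> (G N) \<noteq> 0"
      using emeasure_UN_eq_0[of \<pi> G] G by blast
    define c where "c = measure \<pi> (G N)"
    have c: "0 < c" "emeasure \<pi> (G N) = ennreal c" using N by (auto simp: c_def emeasure_eq_measure zero_less_measure_iff)
    have "ennreal (c * (exp (- real n * \<kappa>) * lik n f0 (\<lambda>i. X i \<omega>))) \<le> evidence n (\<lambda>i. X i \<omega>) (space \<pi>)" if "N \<le> n" for n
    proof -
      let ?l = "exp (- real n * \<kappa>) * lik n f0 (\<lambda>i. X i \<omega>)"
      have "ennreal (c * ?l) = ennreal ?l * emeasure \<pi> (G N)"
        using c(1) by (simp add: c(2) mult.commute ennreal_mult')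
      also have "\<dots> = (\<integral>\<^sup>+f. ennreal ?l * indicator (G N) f \<partial>\<pi>)"
        using G by (simp add: nn_integral_cmult_indicator)
      also have "\<dots> \<le> evidence n (\<lambda>i. X i \<omega>) (space \<pi>)"
        unfolding evidence_def
        by (intro nn_integral_mono) (use that in \<open>auto simp: G_def Q_def indicator_def ennreal_leI\<close>)
      finally show ?thesis .
    qed
    then show ?case using c(1) by (auto simp: eventually_sequentially)
  qed
qed

lemma evidence_eq_integral:
  assumes B: "B \<inter> space \<pi> \<in> sets \<pi>"
  shows "evidence n x (B \<inter> space \<pi>) = ennreal (LINT f:B|\<pi>. lik n f x)"
    "integrable \<pi> (\<lambda>f. indicator B f *\<^sub>R lik n f x)"
proof -
  have e: "indicator B f *\<^sub>R lik n f x = indicator (B \<inter> space \<pi>) f *\<^sub>R lik n f x" if "f \<in> space \<pi>" for f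
    using that by (simp add: indicator_def)
  have i: "integrable \<pi> (\<lambda>f. indicator (B \<inter> space \<pi>) f *\<^sub>R lik n f x)"
    using B lik_prior_integrable[of n x] by (rule integrable_mult_indicator)
  then show i': "integrable \<pi> (\<lambda>f. indicator B f *\<^sub>R lik n f x)"
    by (subst Bochner_Integration.integrable_cong[OF refl e])
  have "evidence n x (B \<inter> space \<pi>) = (\<integral>\<^sup>+f. ennreal (indicator B f *\<^sub>R lik n f x) \<partial>\<pi>)"
    unfolding evidence_def by (intro nn_integral_cong) (simp add: indicator_def)
  also have "\<dots> = ennreal (LINT f:B|\<pi>. lik n f x)"
    unfolding set_lebesgue_integral_def using i'
    by (intro nn_integral_eq_integral AE_I2) (auto simp: less_imp_le lik_pos[OF pos_def_space])
  finally show "evidence n x (B \<inter> space \<pi>) = ennreal (LINT f:B|\<pi>. lik n f x)" .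
qed

lemma integral_lik_pos: "0 < (LINT f|\<pi>. lik n f x)"
proof -
  have "0 \<le> (LINT f|\<pi>. lik n f x)" by (intro integral_nonneg_AE AE_I2) (simp add: less_imp_le lik_pos[OF pos_def_space])
  moreover have "(LINT f|\<pi>. lik n f x) \<noteq> 0"
  proof
    assume "(LINT f|\<pi>. lik n f x) = 0"
    then have "AE f in \<pi>. lik n f x = 0"
      by (subst (asm) integral_nonneg_eq_0_iff_AE[OF lik_prior_integrable])
        (auto simp: less_imp_le lik_pos[OF pos_def_space])
    then have "AE f in \<pi>. False"
      using AE_space
    proof eventually_elim
      case (elim f)
      then show ?case using lik_pos[OF pos_def_space[OF elim(2)], of n x] by simp
    qed
    then show False by simp
  qed
  ultimately show ?thesis by simp
qed

text \<open>All exponents lie between -1/2 and 1/2, so the deviation from \<open>d0\<close> is at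
  most 1 on the exceptional set and at most \<open>e\<close> off it.\<close>

lemma posterior_mean_le:
  assumes d0: "- 1/2 < d0" "d0 < 1/2" and e: "0 \<le> e"
  shows "\<bar>posterior_expectation \<pi> n x exponent - d0\<bar> \<le> e + posterior \<pi> n x {f. \<bar>exponent f - d0\<bar> > e}"
proof -
  let ?B = "{f. \<bar>exponent f - d0\<bar> > e}" and ?l = "\<lambda>f. lik n f x"
  note [measurable] = exponent_measurable lik_prior_measurable
  define Z where "Z = (LINT f|\<pi>. ?l f)"
  have Z: "0 < Z" unfolding Z_def by (rule integral_lik_pos)
  have lp: "0 \<le> ?l f" if "f \<in> space \<pi>" for f using lik_pos[OF pos_def_space[OF that], of n x] by simp
  have ex: "\<bar>exponent f - d0\<bar> \<le> 1" "\<bar>exponent f\<bar> \<le> 1" if "f \<in> space \<pi>" for f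
    using power_bounded_space[OF that] d0 unfolding power_bounded_def by linarith+
  have i1: "integrable \<pi> (\<lambda>f. exponent f * ?l f)"
    by (rule Bochner_Integration.integrable_bound[OF lik_prior_integrable[of n x]])
      (use ex lp in \<open>auto simp: abs_mult mult_left_le_one_le intro!: AE_I2\<close>)
  have "{f \<in> space \<pi>. \<bar>exponent f - d0\<bar> > e} \<in> sets \<pi>" by measurable
  moreover have "?B \<inter> space \<pi> = {f \<in> space \<pi>. \<bar>exponent f - d0\<bar> > e}" by auto
  ultimately have B: "?B \<inter> space \<pi> \<in> sets \<pi>" by simp
  note i2 = evidence_eq_integral(2)[OF B, of n x]
  have "posterior_expectation \<pi> n x exponent - d0 = (LINT f|\<pi>. exponent f * ?l f - d0 * ?l f) / Z"
    using i1 lik_prior_integrable[of n x] Z by (simp add: posterior_expectation_def Z_def[symmetric] diff_divide_distrib)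
  also have "\<bar>\<dots>\<bar> \<le> (LINT f|\<pi>. e * ?l f + indicator ?B f *\<^sub>R ?l f) / Z"
    unfolding abs_divide abs_of_pos[OF Z]
  proof (intro divide_right_mono order_trans[OF integral_abs_bound] integral_mono)
    fix f assume f: "f \<in> space \<pi>"
    have "\<bar>exponent f * ?l f - d0 * ?l f\<bar> = \<bar>exponent f - d0\<bar> * ?l f"
      using lp[OF f] by (simp add: abs_mult flip: left_diff_distrib)
    also have "\<dots> \<le> (e + indicator ?B f) * ?l f"
      using ex[OF f] e lp[OF f] by (intro mult_right_mono) (auto simp: indicator_def)
    finally show "\<bar>exponent f * ?l f - d0 * ?l f\<bar> \<le> e * ?l f + indicator ?B f *\<^sub>R ?l f"
      by (simp add: distrib_right)
  qed (use i1 i2 lik_prior_integrable[of n x] Z in auto)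
  also have "\<dots> = e + posterior \<pi> n x ?B"
    using i2 lik_prior_integrable[of n x] Z
    by (simp add: posterior_def set_lebesgue_integral_def Z_def[symmetric] add_divide_distrib)
  finally show ?thesis .
qed

end

subsection \<open>Consistency\<close>

text \<open>Used to pass from the exponent of a density to the boundary exponent of a test. Because
  \<open>\<bar>x\<bar>\<close> may exceed 1 a constant is lost, and \<open>pi\<^sup>2\<close> covers
  all gaps up to 1.\<close>

lemma powr_exponent_compare:
  fixes x c d :: real
  assumes "0 < \<bar>x\<bar>" "\<bar>x\<bar> \<le> pi" "c \<le> d" "d \<le> c + 1"
  shows "pole c x \<le> pi\<^sup>2 * pole d x"
proof -
  have "\<bar>x\<bar> powr (2 * (d - c)) \<le> pi powr (2 * (d - c))" using assms by (intro powr_mono2) auto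
  also have "\<dots> \<le> pi powr 2" using assms pi_ge_two by (intro powr_mono) auto
  finally have "\<bar>x\<bar> powr (2 * (d - c)) * pole d x \<le> pi\<^sup>2 * pole d x"
    by (intro mult_right_mono) auto
  then show ?thesis by (simp add: powr_add[symmetric] algebra_simps)
qed

context regular_prior
begin

lemma posterior_le:
  assumes B: "B \<inter> space \<pi> \<in> sets \<pi>" and c: "0 < c" "0 < l" "0 < b"
    and num: "evidence n x (B \<inter> space \<pi>) \<le> ennreal (a * l)" and a: "0 \<le> a"
    and den: "ennreal (c * (b * l)) \<le> evidence n x (space \<pi>)"
  shows "0 \<le> posterior \<pi> n x B \<and> posterior \<pi> n x B \<le> a / (c * b)"
proof -
  define N where "N = (LINT f:B|\<pi>. lik n f x)"
  define Z where "Z = (LINT f|\<pi>. lik n f x)"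
  have Z: "0 < Z" unfolding Z_def by (rule integral_lik_pos)
  have N: "0 \<le> N" unfolding N_def set_lebesgue_integral_def
    by (intro integral_nonneg_AE AE_I2) (simp add: less_imp_le[OF lik_pos[OF pos_def_space]])
  have "ennreal N \<le> ennreal (a * l)"
    using num evidence_eq_integral(1)[OF B, of n x] by (simp add: N_def)
  then have Na: "N \<le> a * l" using a c by (subst (asm) ennreal_le_iff) auto
  have "evidence n x (UNIV \<inter> space \<pi>) = ennreal (LINT f:UNIV|\<pi>. lik n f x)"
    by (rule evidence_eq_integral(1)) simp
  then have "ennreal (c * (b * l)) \<le> ennreal Z" using den by (simp add: Z_def set_lebesgue_integral_def)
  then have Zc: "c * (b * l) \<le> Z" using Z by (subst (asm) ennreal_le_iff) auto
  have "N / Z \<le> (a * l) / (c * (b * l))" using N Na Zc c a by (intro frac_le) auto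
  also have "\<dots> = a / (c * b)" using c by simp
  finally show ?thesis using N Z by (simp add: posterior_def N_def Z_def)
qed

lemma evidence_mono: "A \<subseteq> B \<Longrightarrow> evidence n x A \<le> evidence n x B"
  unfolding evidence_def by (intro nn_integral_mono mult_left_mono) (auto simp: indicator_def)

lemma evidence_Un_le:
  assumes "A \<in> sets \<pi>" "B \<in> sets \<pi>"
  shows "evidence n x (A \<union> B) \<le> evidence n x A + evidence n x B"
proof -
  have "evidence n x (A \<union> B) \<le> (\<integral>\<^sup>+f. ennreal (lik n f x) * indicator A f + ennreal (lik n f x) * indicator B f \<partial>\<pi>)"
    unfolding evidence_def by (intro nn_integral_mono) (auto simp: indicator_def)
  also have "\<dots> = evidence n x A + evidence n x B"
    unfolding evidence_def using assms lik_prior_measurable by (intro nn_integral_add) auto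
  finally show ?thesis .
qed

lemma posterior_exponent_tendsto:
  assumes X: "gaussian_process P X f0" and f0: "power_bounded f0 d0 m0 M0"
    and support: "\<And>\<epsilon>. 0 < \<epsilon> \<Longrightarrow> \<exists>B\<in>sets \<pi>. 0 < emeasure \<pi> B \<and> (\<forall>f\<in>B. h_disc f0 f \<le> ennreal \<epsilon>)"
    and e: "0 < e"
  shows "AE \<omega> in P. (\<lambda>n. posterior \<pi> n (\<lambda>i. X i \<omega>) {f. \<bar>exponent f - d0\<bar> > e}) \<longlonglongrightarrow> 0"
proof -
  note [measurable] = exponent_measurable
  have d0: "- 1/2 < d0" "d0 < 1/2" and m0: "0 < m0" "0 < M0"
    using f0 power_bounded_upper_pos by (auto simp: power_bounded_def)
  obtain f1 where "f1 \<in> space \<pi>" using not_empty by blast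
  from power_bounded_space[OF this] power_bounded_upper_pos[OF power_bounded_space[OF this]]
  have m: "0 < m" "0 < M" by (auto simp: power_bounded_def)
  note f0i = power_bounded_integrable[OF f0]
  note pd0 = pos_def_toeplitz[OF f0i power_bounded_AE_pos[OF f0]]
  \<comment> \<open>Shrinking \<open>e\<close> only enlarges the exceptional set. The bound 1/4
    serves the likelihood ratios; the last two keep \<open>d0 + e'\<close>, \<open>d0 - e'\<close>
    and the reflected exponents \<open>2 * d0 - d\<close> between -1/2 and 1/2.\<close>
  define e' where "e' = min (min e (1/4)) (min ((1/2 - d0) / 2) ((d0 + 1/2) / 2))"
  have e'_le: "e' \<le> 1/4" "e' \<le> (1/2 - d0) / 2" "e' \<le> (d0 + 1/2) / 2"
    unfolding e'_def by (meson min.cobounded1 min.cobounded2 order_trans)+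
  have "0 < e'" "e' \<le> e" using e d0 by (auto simp: e'_def)
  with e'_le have e': "0 < e'" "e' \<le> e" "e' < 1/2" "d0 + e' < 1/2" "- 1/2 < d0 - e'"
    using d0 by (auto simp: field_simps)
  have fb: "power_bounded f (exponent f) m M" "exponent f < 1/2" "- 1/2 < exponent f" if "f \<in> space \<pi>" for f
    using power_bounded_space[OF that] by (auto simp: power_bounded_def)
  have f0b: "0 < f0 x" "m0 * pole d0 x \<le> f0 x" "f0 x \<le> M0 * pole d0 x" if "x \<in> freqs - {0}" for x
    using f0 that power_bounded_pos[OF f0 that] by (auto simp: power_bounded_def)

  define Bp where "Bp = {f \<in> space \<pi>. d0 + e' < exponent f}"
  define Bm where "Bm = {f \<in> space \<pi>. exponent f < d0 - e'}"
  have Bp: "Bp \<in> sets \<pi>" and Bm: "Bm \<in> sets \<pi>" unfolding Bp_def Bm_def by measurable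
  obtain \<delta>p Wp where \<delta>p: "0 < \<delta>p" and Wp: "\<And>n. Wp n \<in> sets (obs_space n)"
    and testp: "\<forall>\<^sub>F n in sequentially.
      (\<forall>f. integrable FQ f \<and> (\<forall>x\<in>freqs - {0}. 0 < f x \<and> f x \<le> M0 * pole d0 x) \<longrightarrow>
         lik_mass n f (Wp n) \<le> ennreal (exp (- real n * \<delta>p))) \<and>
      (\<forall>f. integrable FQ f \<and> (\<forall>x\<in>freqs - {0}. m / pi\<^sup>2 * pole (d0 + e') x \<le> f x) \<longrightarrow>
         lik_mass n f (- Wp n) \<le> ennreal (exp (- real n * \<delta>p)))"
    using low_frequency_test[of M0 "m / pi\<^sup>2" d0 "d0 + e'"] m0 m d0 e' by auto
  obtain \<delta>m Wm where \<delta>m: "0 < \<delta>m" and Wm: "\<And>n. Wm n \<in> sets (obs_space n)"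
    and testm: "\<forall>\<^sub>F n in sequentially.
      (\<forall>f. integrable FQ f \<and> (\<forall>x\<in>freqs - {0}. 0 < f x \<and> f x \<le> M * pi\<^sup>2 * pole (d0 - e') x) \<longrightarrow>
         lik_mass n f (Wm n) \<le> ennreal (exp (- real n * \<delta>m))) \<and>
      (\<forall>f. integrable FQ f \<and> (\<forall>x\<in>freqs - {0}. m0 * pole d0 x \<le> f x) \<longrightarrow>
         lik_mass n f (- Wm n) \<le> ennreal (exp (- real n * \<delta>m)))"
    using low_frequency_test[of "M * pi\<^sup>2" m0 "d0 - e'" d0] m0 m d0 e' by auto
  have compl: "lik_mass n f (space (obs_space n) - W) = lik_mass n f (- W)" for n W f
    by (intro nn_integral_cong) (auto simp: indicator_def)
  have nump: "AE \<omega> in P. \<forall>\<^sub>F n in sequentially.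
      evidence n (\<lambda>i. X i \<omega>) Bp \<le> ennreal (exp (- real n * (\<delta>p / 2)) * lik n f0 (\<lambda>i. X i \<omega>))"
  proof (rule evidence_tested[OF X pd0 Bp \<delta>p Wp])
    show "\<forall>\<^sub>F n in sequentially. lik_mass n f0 (Wp n) \<le> ennreal (exp (- real n * \<delta>p))"
      using testp by eventually_elim (use f0i f0b in blast)
    show "\<forall>\<^sub>F n in sequentially. \<forall>f\<in>Bp. lik_mass n f (space (obs_space n) - Wp n) \<le> ennreal (exp (- real n * \<delta>p))"
      using testp
    proof eventually_elim
      case (elim n)
      show ?case
      proof
        fix f assume f: "f \<in> Bp"
        then have pb: "power_bounded f (exponent f) m M" and d: "d0 + e' < exponent f" "exponent f < 1/2"
          using fb by (auto simp: Bp_def)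
        have "m / pi\<^sup>2 * pole (d0 + e') x \<le> f x" if x: "x \<in> freqs - {0}" for x
        proof -
          have "pole (d0 + e') x \<le> pi\<^sup>2 * pole (exponent f) x"
            using x d d0 e' by (intro powr_exponent_compare) auto
          then have "m / pi\<^sup>2 * pole (d0 + e') x \<le> m / pi\<^sup>2 * (pi\<^sup>2 * pole (exponent f) x)"
            using m by (intro mult_left_mono) auto
          also have "\<dots> = m * pole (exponent f) x" by simp
          also have "\<dots> \<le> f x" using pb x unfolding power_bounded_def by blast
          finally show ?thesis .
        qed
        then show "lik_mass n f (space (obs_space n) - Wp n) \<le> ennreal (exp (- real n * \<delta>p))"
          unfolding compl using elim power_bounded_integrable[OF pb] by blast
      qed
    qed
  qed
  have numm: "AE \<omega> in P. \<forall>\<^sub>F n in sequentially.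
      evidence n (\<lambda>i. X i \<omega>) Bm \<le> ennreal (exp (- real n * (\<delta>m / 2)) * lik n f0 (\<lambda>i. X i \<omega>))"
  \<comment> \<open>Against smaller exponents \<open>f0\<close> is the density with more energy at
    low frequencies, so rejection of \<open>f0\<close> now means the complement of
    \<open>Wm n\<close>.\<close>
  proof (rule evidence_tested[OF X pd0 Bm \<delta>m, where W = "\<lambda>n. space (obs_space n) - Wm n"])
    show "space (obs_space n) - Wm n \<in> sets (obs_space n)" for n using Wm by auto
    show "\<forall>\<^sub>F n in sequentially. lik_mass n f0 (space (obs_space n) - Wm n) \<le> ennreal (exp (- real n * \<delta>m))"
      unfolding compl using testm by eventually_elim (use f0i f0b in blast)
    show "\<forall>\<^sub>F n in sequentially. \<forall>f\<in>Bm. lik_mass n f (space (obs_space n) - (space (obs_space n) - Wm n)) \<le> ennreal (exp (- real n * \<delta>m))"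
      using testm
    proof eventually_elim
      case (elim n)
      show ?case
      proof
        fix f assume f: "f \<in> Bm"
        then have pb: "power_bounded f (exponent f) m M" and d: "exponent f < d0 - e'" "- 1/2 < exponent f"
          using fb by (auto simp: Bm_def)
        have "0 < f x \<and> f x \<le> M * pi\<^sup>2 * pole (d0 - e') x" if x: "x \<in> freqs - {0}" for x
        proof -
          have "f x \<le> M * pole (exponent f) x" using pb x unfolding power_bounded_def by blast
          also have "\<dots> \<le> M * (pi\<^sup>2 * pole (d0 - e') x)"
            using x d d0 e' m by (intro mult_left_mono powr_exponent_compare) auto
          finally show ?thesis using power_bounded_pos[OF pb x] by (simp add: mult.assoc)
        qed
        then have "lik_mass n f (Wm n) \<le> ennreal (exp (- real n * \<delta>m))"
          using elim power_bounded_integrable[OF pb] by blast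
        moreover have "space (obs_space n) - (space (obs_space n) - Wm n) = Wm n"
          using sets.sets_into_space[OF Wm[of n]] by blast
        ultimately show "lik_mass n f (space (obs_space n) - (space (obs_space n) - Wm n)) \<le> ennreal (exp (- real n * \<delta>m))"
          by (simp only:)
      qed
    qed
  qed

  define \<delta> where "\<delta> = min \<delta>p \<delta>m"
  have \<delta>: "0 < \<delta>" "\<delta> \<le> \<delta>p" "\<delta> \<le> \<delta>m" using \<delta>p \<delta>m by (auto simp: \<delta>_def)
  \<comment> \<open>The numerator decays at rate \<open>\<delta> / 2\<close>, twice the loss
    \<open>\<kappa>\<close> allowed in the denominator, so the quotient keeps the rate
    \<open>\<kappa>\<close>.\<close>
  define \<kappa> where "\<kappa> = \<delta> / 4"
  have \<kappa>: "0 < \<kappa>" using \<delta> by (simp add: \<kappa>_def)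
  obtain \<epsilon>1 where \<epsilon>1: "0 < \<epsilon>1" "\<forall>f d. power_bounded f d m M \<and> h_disc f0 f \<le> ennreal \<epsilon>1 \<longrightarrow> \<bar>d - d0\<bar> < e'"
    using h_disc_small_imp_exponent_close[OF f0 m e'(1)] by blast
  \<comment> \<open>\<open>\<epsilon>1\<close> forces the exponents close together, and
    \<open>\<kappa>\<close> keeps the discrepancy strictly below the \<open>2 * \<kappa>\<close> of
    \<open>likelihood_ratio_eventually\<close>.\<close>
  obtain B where B: "B \<in> sets \<pi>" "0 < emeasure \<pi> B" "\<forall>f\<in>B. h_disc f0 f \<le> ennreal (min \<epsilon>1 \<kappa>)"
    using support[of "min \<epsilon>1 \<kappa>"] \<epsilon>1(1) \<kappa> by auto
  have den: "AE \<omega> in P. \<exists>c>0. \<forall>\<^sub>F n in sequentially.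
    ennreal (c * (exp (- real n * \<kappa>) * lik n f0 (\<lambda>i. X i \<omega>))) \<le> evidence n (\<lambda>i. X i \<omega>) (space \<pi>)"
  proof (rule evidence_lower[OF X pd0 B(1,2)])
    fix f assume f: "f \<in> B"
    then have "f \<in> space \<pi>" using sets.sets_into_space[OF B(1)] by blast
    note pb = fb(1)[OF this]
    have h: "h_disc f0 f \<le> ennreal \<epsilon>1" "h_disc f0 f \<le> ennreal \<kappa>"
      by (rule order_trans[OF bspec[OF B(3) f]], rule ennreal_leI, simp)+
    have near: "\<bar>exponent f - d0\<bar> < e'" using \<epsilon>1(2) pb h(1) by blast
    then have "- 1/2 < 2 * d0 - exponent f" "2 * d0 - exponent f < 1/2"
      using e'_le(2,3) d0 by (auto simp: field_simps abs_less_iff)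
    with less_le_trans[OF near e'_le(1)]
    have close: "\<bar>exponent f - d0\<bar> < 1/4" "- 1/2 < 2 * d0 - exponent f" "2 * d0 - exponent f < 1/2"
      by blast+
    have "\<bar>exponent f - d0\<bar> < 1/2" using close(1) by linarith
    from h_disc_integral_le[OF f0 pb this h(2)] \<kappa>
    show "AE \<omega> in P. \<forall>\<^sub>F n in sequentially. exp (- real n * \<kappa>) * lik n f0 (\<lambda>i. X i \<omega>) \<le> lik n f (\<lambda>i. X i \<omega>)"
      by (intro likelihood_ratio_eventually[OF X f0 pb close]) linarith
  qed

  let ?B = "{f. \<bar>exponent f - d0\<bar> > e}"
  have "{f \<in> space \<pi>. \<bar>exponent f - d0\<bar> > e} \<in> sets \<pi>" by measurable
  moreover have "?B \<inter> space \<pi> = {f \<in> space \<pi>. \<bar>exponent f - d0\<bar> > e}" by auto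
  ultimately have Bs: "?B \<inter> space \<pi> \<in> sets \<pi>" by simp
  have sub: "?B \<inter> space \<pi> \<subseteq> Bp \<union> Bm" using e'(2) by (auto simp: Bp_def Bm_def)
  show ?thesis
    using nump numm den
  proof eventually_elim
    case (elim \<omega>)
    let ?x = "\<lambda>i. X i \<omega>"
    obtain c where c: "0 < c" "\<forall>\<^sub>F n in sequentially.
        ennreal (c * (exp (- real n * \<kappa>) * lik n f0 ?x)) \<le> evidence n ?x (space \<pi>)"
      using elim(3) by blast
    have ev: "\<forall>\<^sub>F n in sequentially. 0 \<le> posterior \<pi> n ?x ?B \<and> posterior \<pi> n ?x ?B \<le> 2 / c * exp (- real n * \<kappa>)"
      using elim(1,2) c(2)
    proof eventually_elim
      case (elim n)
      have l: "0 < lik n f0 ?x" by (rule lik_pos[OF pd0])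
      have ex: "exp (- real n * (\<delta>p / 2)) \<le> exp (- real n * (\<delta> / 2))" "exp (- real n * (\<delta>m / 2)) \<le> exp (- real n * (\<delta> / 2))"
        using \<delta> by (auto intro!: mult_left_mono)
      have "evidence n ?x (?B \<inter> space \<pi>) \<le> evidence n ?x Bp + evidence n ?x Bm"
        using evidence_mono[OF sub] evidence_Un_le[OF Bp Bm] by (rule order_trans)
      also have "\<dots> \<le> ennreal (exp (- real n * (\<delta> / 2)) * lik n f0 ?x) + ennreal (exp (- real n * (\<delta> / 2)) * lik n f0 ?x)"
        by (intro add_mono order_trans[OF elim(1)] order_trans[OF elim(2)] ennreal_leI mult_right_mono ex)
          (use l in auto)
      also have "\<dots> = ennreal (2 * exp (- real n * (\<delta> / 2)) * lik n f0 ?x)"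
        using l by (simp add: ennreal_plus[symmetric] del: ennreal_plus)
      finally have num: "evidence n ?x (?B \<inter> space \<pi>) \<le> ennreal (2 * exp (- real n * (\<delta> / 2)) * lik n f0 ?x)" .
      have "0 \<le> posterior \<pi> n ?x ?B \<and> posterior \<pi> n ?x ?B \<le> 2 * exp (- real n * (\<delta> / 2)) / (c * exp (- real n * \<kappa>))"
        by (rule posterior_le[OF Bs c(1) l _ num _ elim(3)]) auto
      moreover have "exp (- real n * (\<delta> / 2)) = exp (- real n * \<kappa>) * exp (- real n * \<kappa>)"
        by (simp add: exp_add[symmetric] \<kappa>_def field_simps)
      ultimately show ?case by simp
    qed
    have lim: "(\<lambda>n. 2 / c * exp (- real n * \<kappa>)) \<longlonglongrightarrow> 0" using c(1) \<kappa> by real_asymp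
    show ?case
      by (rule tendsto_sandwich[OF _ _ tendsto_const lim]; rule eventually_mono[OF ev]; elim conjE)
  qed
qed

end

theorem corollary1:
  fixes P :: "'a measure" and X :: "nat \<Rightarrow> 'a \<Rightarrow> real"
    and f0 :: "real \<Rightarrow> real" and d0 t0 M0 m0 L0 \<rho>0 :: real
    and \<pi> :: "(real \<Rightarrow> real) measure" and C :: "(real \<Rightarrow> real) set"
    and t M m L \<rho> \<gamma> :: real
  assumes process: "gaussian_process P X f0"
    and d0: "has_exponent f0 d0"
    and pos0: "0 < t0" "0 < M0" "0 < m0" "0 < L0"
    and f0: "(0 < \<rho>0 \<and> \<rho>0 \<le> 1 \<and> f0 \<in> G_bar t0 M0 m0 L0 \<rho>0) \<or>
             (\<rho>0 = 1 \<and> f0 \<in> L_bar t0 M0 m0 L0)"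
    and pos: "0 < t" "0 < m" "0 < M" "0 < L"
    and C: "(0 < \<rho> \<and> C = G_bar t M m L \<rho>) \<or> (\<rho> = 1 \<and> C = L_bar t M m L)"
    and prior: "prior_on C \<pi>"
    and t: "t < min \<rho> \<rho>0 / 4"
    and \<gamma>: "\<gamma> = min (min \<rho> \<rho>0) (1/2)"
    and i: "\<And>\<epsilon>. 0 < \<epsilon> \<Longrightarrow> measure \<pi> (B_set f0 d0 t M m \<gamma> \<epsilon> \<inter> space \<pi>) > 0"
    and ii: "\<forall>\<^sub>F \<epsilon> in at_right 0. \<exists>r>0. \<exists>c1 \<le> \<epsilon> * inverse (\<bar>ln \<epsilon>\<bar>\<^sup>2). \<exists>F :: nat \<Rightarrow> (real \<Rightarrow> real) set.
        (\<forall>n. F n \<subseteq> F_tilde_plus \<and> F n \<inter> space \<pi> \<in> sets \<pi> \<and>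
             measure \<pi> (space \<pi> - F n) \<le> exp (- real n * r)) \<and>
        (\<forall>\<^sub>F n in sequentially.
             (\<exists>H. is_net f0 d0 C \<rho> \<gamma> t \<epsilon> (F n) H) \<and>
             net_entropy f0 d0 C \<rho> \<gamma> t \<epsilon> (F n) \<le> real n * c1)"
  shows "(\<forall>e>0. AE \<omega> in P.
            (\<lambda>n. posterior \<pi> n (\<lambda>i. X i \<omega>) {f. \<bar>exponent f - d0\<bar> > e}) \<longlonglongrightarrow> 0) \<and>
         (AE \<omega> in P. (\<lambda>n. posterior_expectation \<pi> n (\<lambda>i. X i \<omega>) exponent) \<longlonglongrightarrow> d0)"
proof -
  have "power_bounded f0 (exponent f0) m0 M0"
    using f0 pos0 G_bar_power_bounded L_bar_power_bounded by blast
  then have pb0: "power_bounded f0 d0 m0 M0" using exponent_eq[OF d0] by simp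
  interpret regular_prior \<pi> m M
  proof -
    interpret prob_space \<pi> using prior by (simp add: prior_on_def)
    show "regular_prior \<pi> m M"
    proof
      show "power_bounded f (exponent f) m M" if "f \<in> space \<pi>" for f
        using that prior C pos G_bar_power_bounded L_bar_power_bounded unfolding prior_on_def by blast
    qed (use prior in \<open>auto simp: prior_on_def\<close>)
  qed
  have support: "\<exists>B\<in>sets \<pi>. 0 < emeasure \<pi> B \<and> (\<forall>f\<in>B. h_disc f0 f \<le> ennreal \<epsilon>)" if "0 < \<epsilon>" for \<epsilon>
  proof
    let ?B = "B_set f0 d0 t M m \<gamma> \<epsilon> \<inter> space \<pi>"
    \<comment> \<open>\<open>measure\<close> is 0 on non-measurable sets, so positivity already
      gives measurability.\<close>
    show "?B \<in> sets \<pi>" using i[OF that] measure_notin_sets[of ?B \<pi>] by fastforce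
    show "0 < emeasure \<pi> ?B \<and> (\<forall>f\<in>?B. h_disc f0 f \<le> ennreal \<epsilon>)"
      using i[OF that] by (auto simp: emeasure_eq_measure B_set_def)
  qed
  have conv: "AE \<omega> in P. (\<lambda>n. posterior \<pi> n (\<lambda>i. X i \<omega>) {f. \<bar>exponent f - d0\<bar> > e}) \<longlonglongrightarrow> 0" if "0 < e" for e
    by (rule posterior_exponent_tendsto[OF process pb0 support that])
  \<comment> \<open>Countably many radii suffice for the posterior mean and share one null
    set.\<close>
  have "AE \<omega> in P. \<forall>k. (\<lambda>n. posterior \<pi> n (\<lambda>i. X i \<omega>) {f. \<bar>exponent f - d0\<bar> > 1 / real (Suc k)}) \<longlonglongrightarrow> 0"
    unfolding AE_all_countable by (intro allI conv) simp
  then have "AE \<omega> in P. (\<lambda>n. posterior_expectation \<pi> n (\<lambda>i. X i \<omega>) exponent) \<longlonglongrightarrow> d0"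
  proof eventually_elim
    case (elim \<omega>)
    show ?case
    proof (rule tendstoI)
      fix e :: real assume "0 < e"
      then obtain k where k: "1 / real (Suc k) < e / 2" using nat_approx_posE[of "e / 2"] by auto
      have "\<forall>\<^sub>F n in sequentially. posterior \<pi> n (\<lambda>i. X i \<omega>) {f. \<bar>exponent f - d0\<bar> > 1 / real (Suc k)} < e / 2"
        using elim \<open>0 < e\<close> by (intro order_tendstoD(2)[of _ 0]) auto
      then show "\<forall>\<^sub>F n in sequentially. dist (posterior_expectation \<pi> n (\<lambda>i. X i \<omega>) exponent) d0 < e"
      proof eventually_elim
        case (elim n)
        have "\<bar>posterior_expectation \<pi> n (\<lambda>i. X i \<omega>) exponent - d0\<bar> \<le>
            1 / real (Suc k) + posterior \<pi> n (\<lambda>i. X i \<omega>) {f. \<bar>exponent f - d0\<bar> > 1 / real (Suc k)}"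
          using pb0 by (intro posterior_mean_le) (auto simp: power_bounded_def)
        then show ?case using elim k by (simp add: dist_real_def)
      qed
    qed
  qed
  with conv show ?thesis by blast
qed

end
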